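(* Let $k\ge1$, $m\ge1$, let $1\le t_1,\dots,t_m\le k$ be distinct integers, $a_1,\dots,a_m$ positive integers, $P=R_{t_1}^{a_1}\cup\cdots\cup R_{t_m}^{a_m}$, and for $u\in\mathbb Z_{>0}$ let $\alpha_u=\#\{v:1\le v\le m,\ t_v\ge u\}$. Then for $1\le r\le k$, $$\frac{g^{(k)}_{P\cup(r)}}{g^{(k)}_P}=\sum_{s=0}^{r}\binom{\alpha_r+r-s-1}{r-s}h_s .$$ In particular, if $\max_i t_i<r$ (so $\alpha_r=0$), then $g^{(k)}_{P\cup(r)}/g^{(k)}_P=h_r=g^{(k)}_{(r)}$; and for a single $k$-rectangle $R_t$ ($1\le t\le k$), $$\frac{g^{(k)}_{R_t\cup(r)}}{g^{(k)}_{R_t}}=\begin{cases}h_r & \text{if } r>t,\\ h_r+h_{r-1}+\cdots+h_0 & \text{if } r\le t.\end{cases}$$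
   Context: Partitions are identified with Young diagrams in French notation (cells $(i,j)$ with $j\le\lambda_i$, row $i$ from the bottom); $\lambda'$ is the conjugate; $\lambda\cup\mu$ is the partition whose multiset of parts is the union of those of $\lambda$ and $\mu$; $(r)$ is the one-part partition. $\mathcal P^k$ is the set of partitions with $\lambda_1\le k$. For $1\le t\le k$, $R_t=(t^{k+1-t})$ and $R_t^a$ is the union of $a$ copies of $R_t$. The hook length of $c=(i,j)\in\lambda$ is $\lambda_i+\lambda'_j-i-j+1$. A $(k+1)$-core has no cell of hook length $k+1$; $|\kappa|_{k+1}$ is its number of cells of hook length $<k+1$. The map $\mathfrak p(\kappa)_i=\#\{j:(i,j)\in\kappa,\ \text{hook length}\le k\}$ is a bijection from $(k+1)$-cores to $\mathcal P^k$ with inverse $\mathfrak c$. The residue of $(i,j)$ is $j-i\bmod(k+1)$. For $(k+1)$-cores $\tau\subset\kappa$, $\kappa/\tau$ is a weak $r$-strip if it is a horizontal strip, $|\kappa|_{k+1}=|\tau|_{k+1}+r$, and its cells have exactly $r$ distinct residues. A removable corner of $\mu$ is $(i,j)\in\mu$ with $(i+1,j),(i,j+1)\notin\mu$; $(i,j)$ is $\lambda$-blocked if $(i+1,j)\in\lambda$; $r_{\lambda\mu}$ is the number of distinct residues of non-$\lambda$-blocked removable corners of $\mu$. $h_r$ are the complete homogeneous symmetric functions ($h_0=1$), $\Lambda^{(k)}=\mathbb Z[h_1,\dots,h_k]$. $\binom ab=a(a-1)\cdots(a-b+1)/b!$ for $a\in\mathbb Z$, $b\ge0$ (so $\binom{-1}{0}=1$),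 and $0$ for $b<0$. The $K$-$k$-Schur functions $\{g^{(k)}_\lambda\}_{\lambda\in\mathcal P^k}$ are the unique elements of $\Lambda^{(k)}$ with $g^{(k)}_\emptyset=1$ and, for $\lambda\in\mathcal P^k$, $0\le r\le k$, $$h_r\,g^{(k)}_\lambda=\sum_{s=0}^{r}(-1)^{r-s}\sum_{\mu\in\mathcal P^k:\ \mathfrak c(\mu)/\mathfrak c(\lambda)\text{ weak }s\text{-strip}}\binom{r_{\mathfrak c(\mu)\mathfrak c(\lambda)}}{r-s}g^{(k)}_\mu .$$ They form a $\mathbb Z$-basis of $\Lambda^{(k)}$, $g^{(k)}_{(r)}=h_r$ for $1\le r\le k$, and $g^{(k)}_P$ divides $g^{(k)}_{P\cup\lambda}$ in $\Lambda^{(k)}$; the quotient denotes the element $q\in\Lambda^{(k)}$ with $g^{(k)}_{P\cup(r)}=g^{(k)}_Pq$. *)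

theory Defs
  imports
    "HOL-Library.Multiset"
    "HOL-Library.Poly_Mapping"
    "HOL-Library.Function_Algebras"
begin

subsection \<open>Partitions and Young diagrams\<close>

text \<open>
  A partition is its multiset of (positive) parts, so that \<open>\<lambda> \<union> \<mu>\<close> is multiset sum
  and the one-part partition \<open>(r)\<close> is \<open>{#r#}\<close>.
  Rows, columns and parts are numbered from 1.
\<close>

type_synonym partition = "nat multiset"

definition is_partition :: "partition \<Rightarrow> bool" where
  "is_partition lam \<longleftrightarrow> 0 \<notin># lam"

text \<open>The \<open>i\<close>-th largest part, and \<open>0\<close> beyond the last part.\<close>
definition part :: "partition \<Rightarrow> nat \<Rightarrow> nat" where
  "part lam i = (if 1 \<le> i \<and> i \<le> size lam then rev (sorted_list_of_multiset lam) ! (i - 1) else 0)"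

definition diagram :: "partition \<Rightarrow> (nat \<times> nat) set" where
  "diagram lam = {(i, j). 1 \<le> i \<and> 1 \<le> j \<and> j \<le> part lam i}"

definition conj_part :: "partition \<Rightarrow> nat \<Rightarrow> nat" where
  "conj_part lam j = card {i. (i, j) \<in> diagram lam}"

definition bounded_partitions :: "nat \<Rightarrow> partition set" where
  "bounded_partitions k = {lam. is_partition lam \<and> part lam 1 \<le> k}"

definition k_rectangle :: "nat \<Rightarrow> nat \<Rightarrow> partition" where
  "k_rectangle k t = replicate_mset (k + 1 - t) t"


subsection \<open>Cores\<close>

text \<open>The order of the summands avoids truncated subtraction for cells of the diagram.\<close>
definition hook_length :: "partition \<Rightarrow> nat \<times> nat \<Rightarrow> nat" where
  "hook_length lam = (\<lambda>(i, j). part lam i + conj_part lam j + 1 - i - j)"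

definition is_core :: "nat \<Rightarrow> partition \<Rightarrow> bool" where
  "is_core n kap \<longleftrightarrow> is_partition kap \<and> (\<forall>c \<in> diagram kap. hook_length kap c \<noteq> n)"

definition core_size :: "nat \<Rightarrow> partition \<Rightarrow> nat" where
  "core_size n kap = card {c \<in> diagram kap. hook_length kap c < n}"

text \<open>
  The partition whose \<open>i\<close>-th part is the number of cells of hook length at most \<open>k\<close> in row
  \<open>i\<close>; for a \<open>(k + 1)\<close>-core these row counts are weakly decreasing, so nothing is lost by
  recording them as a multiset.
\<close>
definition core_to_bounded :: "nat \<Rightarrow> partition \<Rightarrow> partition" where
  "core_to_bounded k kap =
     filter_mset (\<lambda>x. x > 0)
       (image_mset (\<lambda>i. card {j. (i, j) \<in> diagram kap \<and> hook_length kap (i, j) \<le> k})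
         (mset_set {1..size kap}))"

definition bounded_to_core :: "nat \<Rightarrow> partition \<Rightarrow> partition" where
  "bounded_to_core k = the_inv_into {kap. is_core (k + 1) kap} (core_to_bounded k)"

definition residue :: "nat \<Rightarrow> nat \<times> nat \<Rightarrow> int" where
  "residue k = (\<lambda>(i, j). (int j - int i) mod (int k + 1))"

definition horizontal_strip :: "partition \<Rightarrow> partition \<Rightarrow> bool" where
  "horizontal_strip kap tau \<longleftrightarrow>
     diagram tau \<subseteq> diagram kap \<and> inj_on snd (diagram kap - diagram tau)"

definition weak_strip :: "nat \<Rightarrow> nat \<Rightarrow> partition \<Rightarrow> partition \<Rightarrow> bool" where
  "weak_strip k r kap tau \<longleftrightarrow>
     is_core (k + 1) kap \<and> is_core (k + 1) tau \<and>
     horizontal_strip kap tau \<and>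
     core_size (k + 1) kap = core_size (k + 1) tau + r \<and>
     card (residue k ` (diagram kap - diagram tau)) = r"

definition removable_corners :: "partition \<Rightarrow> (nat \<times> nat) set" where
  "removable_corners mu =
     {(i, j). (i, j) \<in> diagram mu \<and> (i + 1, j) \<notin> diagram mu \<and> (i, j + 1) \<notin> diagram mu}"

definition blocked :: "partition \<Rightarrow> nat \<times> nat \<Rightarrow> bool" where
  "blocked lam = (\<lambda>(i, j). (i + 1, j) \<in> diagram lam)"

text \<open>\<open>corner_residues k lam mu\<close> is \<open>r\<^bsub>lam mu\<^esub>\<close>.\<close>
definition corner_residues :: "nat \<Rightarrow> partition \<Rightarrow> partition \<Rightarrow> nat" where
  "corner_residues k lam mu = card (residue k ` {c \<in> removable_corners mu. \<not> blocked lam c})"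


subsection \<open>Binomial coefficients\<close>

text \<open>
  \<open>a (a - 1) \<cdots> (a - b + 1) / b!\<close> for an integer \<open>a\<close>; the division is exact. This is what
  \<^const>\<open>gbinomial\<close> unfolds to on \<^typ>\<open>int\<close>; that constant is not used directly because its
  sort constraint for parsing is restricted to fields after most theory merges.
\<close>
definition int_choose :: "int \<Rightarrow> nat \<Rightarrow> int" where
  "int_choose a b = (\<Prod>i = 0..<b. a - int i) div fact b"


subsection \<open>Symmetric functions\<close>

text \<open>
  Polynomials over \<open>\<int>\<close> in variables \<open>x\<^sub>0, x\<^sub>1, \<dots>\<close> are finitely supported maps from exponent
  vectors to coefficients. The ring of symmetric functions is realised as the usual (graded)
  inverse limit of the rings of symmetric polynomials: a symmetric function \<open>f\<close> is the sequence
  whose \<open>n\<close>-th term is the polynomial \<open>f(x\<^sub>0, \<dots>, x\<^bsub>n-1\<^esub>)\<close>, and the ring operations are pointwise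
  in \<open>n\<close>. The ambient type contains all sequences of polynomials; only its subrings
  \<open>Lambda_k k\<close> are used.
\<close>
type_synonym symfun = "nat \<Rightarrow> ((nat \<Rightarrow>\<^sub>0 nat) \<Rightarrow>\<^sub>0 int)"

text \<open>The complete homogeneous symmetric function: the sum of all monomials of degree \<open>r\<close>.\<close>
definition hsym :: "nat \<Rightarrow> symfun" where
  "hsym r = (\<lambda>n. \<Sum>e | Poly_Mapping.keys e \<subseteq> {..<n} \<and> (\<Sum>i<n. Poly_Mapping.lookup e i) = r. Poly_Mapping.single e 1)"

lemma hsym_0: "hsym 0 = 1"
proof
  fix n
  have "{e :: nat \<Rightarrow>\<^sub>0 nat. Poly_Mapping.keys e \<subseteq> {..<n} \<and> (\<Sum>i<n. Poly_Mapping.lookup e i) = 0} = {0}"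
  proof -
    have "e = 0" if "Poly_Mapping.keys e \<subseteq> {..<n}" "(\<Sum>i<n. Poly_Mapping.lookup e i) = 0" for e :: "nat \<Rightarrow>\<^sub>0 nat"
    proof -
      have "\<forall>i<n. Poly_Mapping.lookup e i = 0" using that(2) by simp
      moreover have "Poly_Mapping.lookup e i = 0" if "\<not> i < n" for i
        using that \<open>Poly_Mapping.keys e \<subseteq> {..<n}\<close> by (meson in_keys_iff lessThan_iff subsetD)
      ultimately show ?thesis by (metis poly_mapping_eqI lookup_zero)
    qed
    then show ?thesis by (auto simp del: sum_eq_0_iff)
  qed
  then show "hsym 0 n = 1 n" by (simp add: hsym_def)
qed

text \<open>\<open>\<Lambda>\<^sup>(\<^sup>k\<^sup>) = \<int>[h\<^sub>1, \<dots>, h\<^sub>k]\<close>, the subring generated by \<open>h\<^sub>1, \<dots>, h\<^sub>k\<close>.\<close>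
inductive_set Lambda_k :: "nat \<Rightarrow> symfun set" for k :: nat where
  one: "1 \<in> Lambda_k k"
| gen: "1 \<le> r \<Longrightarrow> r \<le> k \<Longrightarrow> hsym r \<in> Lambda_k k"
| diff: "f \<in> Lambda_k k \<Longrightarrow> f' \<in> Lambda_k k \<Longrightarrow> f - f' \<in> Lambda_k k"
| mult: "f \<in> Lambda_k k \<Longrightarrow> f' \<in> Lambda_k k \<Longrightarrow> f * f' \<in> Lambda_k k"

text \<open>\<open>q\<close> is the quotient \<open>f / d\<close> in \<open>\<Lambda>\<^sup>(\<^sup>k\<^sup>)\<close>: the one and only element with \<open>f = d q\<close>.\<close>
definition is_quotient :: "nat \<Rightarrow> symfun \<Rightarrow> symfun \<Rightarrow> symfun \<Rightarrow> bool" where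
  "is_quotient k f d q \<longleftrightarrow>
     q \<in> Lambda_k k \<and> f = d * q \<and> (\<forall>q' \<in> Lambda_k k. f = d * q' \<longrightarrow> q' = q)"


subsection \<open>K-k-Schur functions\<close>

text \<open>
  The characterisation of the family \<open>g\<close> by its Pieri rule, which determines \<open>g\<close> uniquely
  on \<open>bounded_partitions k\<close>. Values of \<open>g\<close> at other multisets are irrelevant.
\<close>
definition K_k_Schur :: "nat \<Rightarrow> (partition \<Rightarrow> symfun) \<Rightarrow> bool" where
  "K_k_Schur k g \<longleftrightarrow>
     (\<forall>lam \<in> bounded_partitions k. g lam \<in> Lambda_k k) \<and>
     g {#} = 1 \<and>
     (\<forall>lam \<in> bounded_partitions k. \<forall>r \<le> k.
        hsym r * g lam =
          (\<Sum>s = 0..r. (- 1) ^ (r - s) *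
             (\<Sum>mu | mu \<in> bounded_partitions k \<and>
                      weak_strip k s (bounded_to_core k mu) (bounded_to_core k lam).
                of_nat (corner_residues k (bounded_to_core k mu) (bounded_to_core k lam)
                          choose (r - s)) * g mu)))"

end

theory Submission
  imports Defs "HOL-Computational_Algebra.Computational_Algebra"
begin

text \<open>
  Record a partition by its beads \<open>\<lambda>\<^sub>i - i\<close>. It is a \<open>(k + 1)\<close>-core iff the bead set is closed under
  subtracting \<open>k + 1\<close>, and the \<open>i\<close>-th part of the associated bounded partition counts the gaps among
  the \<open>k\<close> positions below the \<open>i\<close>-th bead. For a union \<open>P\<close> of rectangles \<open>R\<^bsub>N 0\<^esub>, \<dots>, R\<^bsub>N (Q-1)\<^esub>\<close>
  with \<open>N 0 \<le> \<dots> \<le> N (Q-1)\<close>, cut the integers into levels of \<open>k + 1\<close> consecutive positions; the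
  beads of the core of \<open>P\<close> on level \<open>q\<close> are position \<open>0\<close> and the positions above \<open>N q\<close>. All addable
  corners have the residue of position \<open>0\<close>, so a weak \<open>s\<close>-strip moves the bead \<open>0\<close> of each level to
  some \<open>d q \<le> N q\<close>, and comparing core sizes forces \<open>d q = min s (N q)\<close>. Hence \<open>P \<union> (s)\<close> is the only
  weak \<open>s\<close>-strip over \<open>P\<close>, the corner on level \<open>q\<close> is blocked iff \<open>N q \<le> s\<close>, and the Pieri rule
  becomes \<open>h\<^sub>r g\<^sub>P = \<Sum>\<^sub>s (-1)\<^bsup>r-s\<^esup> (\<alpha>\<^bsub>s+1\<^esub> choose r-s) g\<^bsub>P \<union> (s)\<^esub>\<close>, which is inverted by summation.

  The quotient is unique because \<open>g\<^sub>P \<noteq> 0\<close> in \<open>k\<close> variables: over the complex numbers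
  \<open>h\<^sub>1, \<dots>, h\<^sub>k\<close> take arbitrary values there, so the products \<open>h\<^sub>\<mu>\<close> are linearly independent, and they
  lie in the span of equally many \<open>g\<^sub>\<mu>\<close>.
\<close>

subsection \<open>Bead sets of partitions\<close>

text \<open>If the upper index in the Pieri rule over \<open>P\<close> were a constant
  \<open>a\<close>, the rule would say that the series of the \<open>h\<close> times the function of
  \<open>P\<close> is \<open>(1 - t)^a\<close> times the series of the functions of \<open>P\<close>
  with \<open>(s)\<close> added. Inverting gives \<open>(1 - t)^(-a)\<close>, whose coefficients are
  the binomials of the theorem. The obstacle is that the index depends on \<open>s\<close>; it drops
  by at most one per step, because widths are counted without multiplicity, and one such drop is
  exactly what Pascal's rule absorbs. Since \<open>bounded_to_core\<close> is an inverse on an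
  image, nothing can be computed with it before the map from cores to bounded partitions is known to
  be bijective. That is proved by building a core row by row, the longest row last: then only one
  bead is new at each step. Cancelling \<open>g P\<close> needs care: sequences of polynomials form
  a ring with zero divisors. The \<open>k\<close>-th component has none, and \<open>Lambda_k\<close>
  embeds into it. The same fact, proved by evaluation at complex points, supplies the linear
  independence needed for \<open>g P\<close>.\<close>

definition bead :: "partition \<Rightarrow> nat \<Rightarrow> int" where
  "bead lam i = int (part lam i) - int i"

definition beads :: "partition \<Rightarrow> int set" where
  "beads lam = bead lam ` {1..}"

lemma part_antimono:
  assumes "1 \<le> i" "i \<le> j"
  shows "part lam j \<le> part lam i"
proof (cases "j \<le> size lam")
  case True
  let ?xs = "sorted_list_of_multiset lam"
  have len: "length ?xs = size lam"
    by (metis mset_sorted_list_of_multiset size_mset)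
  have "sorted ?xs" by simp
  then have "?xs ! (size lam - j) \<le> ?xs ! (size lam - i)"
    using assms True len by (intro sorted_nth_mono) auto
  then show ?thesis
    using assms True len by (simp add: part_def rev_nth)
qed (simp add: part_def)

lemma part_pos_iff:
  assumes "is_partition lam"
  shows "0 < part lam i \<longleftrightarrow> 1 \<le> i \<and> i \<le> size lam"
proof -
  let ?xs = "rev (sorted_list_of_multiset lam)"
  have "length ?xs = size lam"
    by (metis length_rev mset_sorted_list_of_multiset size_mset)
  moreover have "set ?xs = set_mset lam" by simp
  ultimately have "?xs ! (i - 1) \<in># lam" if "1 \<le> i" "i \<le> size lam"
    using that by (metis One_nat_def Suc_le_eq Suc_pred nth_mem)
  then show ?thesis
    using assms unfolding is_partition_def part_def by (metis gr0I not_gr0)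
qed

lemma mset_parts: "image_mset (part lam) (mset_set {1..size lam}) = lam"
proof -
  let ?xs = "rev (sorted_list_of_multiset lam)"
  have len: "length ?xs = size lam"
    by (metis length_rev mset_sorted_list_of_multiset size_mset)
  have "?xs = map (part lam) [1..<Suc (size lam)]"
    by (rule nth_equalityI) (use len in \<open>auto simp: part_def simp del: upt_Suc\<close>)
  then have "mset ?xs = image_mset (part lam) (mset [1..<Suc (size lam)])"
    by (metis mset_map)
  then show ?thesis
    by (simp add: atLeastLessThanSuc_atLeastAtMost del: upt_Suc)
qed

lemma part_add_max:
  assumes "\<forall>y \<in># M. y \<le> x"
  shows "part (add_mset x M) (Suc 0) = x"
    and "1 \<le> i \<Longrightarrow> part (add_mset x M) (Suc i) = part M i"
proof -
  let ?xs = "sorted_list_of_multiset M"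
  have len: "length ?xs = size M"
    by (metis mset_sorted_list_of_multiset size_mset)
  have "sorted_list_of_multiset (add_mset x M) = ?xs @ [x]"
    using assms by (simp add: sorted_insort_is_snoc)
  then have rev: "rev (sorted_list_of_multiset (add_mset x M)) = x # rev ?xs" by simp
  show "part (add_mset x M) (Suc 0) = x"
    unfolding part_def rev by simp
  show "part (add_mset x M) (Suc i) = part M i" if "1 \<le> i"
    using that unfolding part_def rev by (cases i) auto
qed

lemma bead_less: "1 \<le> i \<Longrightarrow> i < j \<Longrightarrow> bead lam j < bead lam i"
  using part_antimono[of i j lam] by (simp add: bead_def)

lemma bead_less_iff: "1 \<le> i \<Longrightarrow> 1 \<le> j \<Longrightarrow> bead lam j < bead lam i \<longleftrightarrow> i < j"
  by (metis bead_less less_asym' linorder_neqE_nat)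

lemma inj_on_bead: "inj_on (bead lam) {1..}"
  by (rule inj_onI) (metis atLeast_iff bead_less linorder_neqE_nat order_less_irrefl)

text \<open>Turns a count of rows into a condition on a single row; it serves for beads above a
  threshold, for column lengths and for the part of a strip inside one level.\<close>

lemma down_closed_eq:
  fixes S :: "nat set"
  assumes "finite S" "S \<subseteq> {1..}" "\<And>i j. 1 \<le> i \<Longrightarrow> i \<le> j \<Longrightarrow> j \<in> S \<Longrightarrow> i \<in> S"
  shows "S = {1..card S}"
proof (cases "S = {}")
  case False
  have S: "S = {1..Max S}"
  proof (rule set_eqI)
    fix i show "i \<in> S \<longleftrightarrow> i \<in> {1..Max S}"
      using assms(1,2) assms(3)[of i "Max S"] Max_in[OF assms(1) False] Max_ge[OF assms(1), of i]
      by (auto simp: subset_iff)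
  qed
  then have "card S = card {1..Max S}" by (rule arg_cong)
  then have "card S = Max S" by simp
  with S show ?thesis by simp
qed simp

text \<open>Up to a summand that depends on \<open>x\<close> only, this is the number of cells of
  content \<open>x\<close>: \<open>x \<le> bead lam i\<close> says that row \<open>i\<close> reaches
  column \<open>x + i\<close>, and rows with \<open>x + i \<le> 0\<close> always count.\<close>

definition bead_count :: "partition \<Rightarrow> int \<Rightarrow> nat" where
  "bead_count lam x = card {b \<in> beads lam. x \<le> b}"

lemma bead_count_eq: "{i. 1 \<le> i \<and> x \<le> bead lam i} = {1..bead_count lam x}"
  and finite_beads_ge: "finite {b \<in> beads lam. x \<le> b}"
proof -
  let ?S = "{i. 1 \<le> i \<and> x \<le> bead lam i}"
  have "i \<le> nat (int (part lam 1) - x)" if "i \<in> ?S" for i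
    using that part_antimono[of 1 i lam] by (auto simp: bead_def)
  then have fin: "finite ?S" by (meson finite_nat_set_iff_bounded_le)
  have img: "{b \<in> beads lam. x \<le> b} = bead lam ` ?S" by (auto simp: beads_def)
  then show "finite {b \<in> beads lam. x \<le> b}" using fin by simp
  have "card (bead lam ` ?S) = card ?S"
    by (rule card_image, rule inj_on_subset[OF inj_on_bead]) auto
  then have "bead_count lam x = card ?S" by (simp add: bead_count_def img)
  moreover have "?S = {1..card ?S}"
  proof (rule down_closed_eq[OF fin])
    fix i j :: nat assume "1 \<le> i" "i \<le> j" "j \<in> ?S"
    then show "i \<in> ?S" using bead_less[of i j lam] by (cases "i = j") auto
  qed auto
  ultimately show "?S = {1..bead_count lam x}" by simp
qed

lemma le_bead_iff: "1 \<le> i \<Longrightarrow> x \<le> bead lam i \<longleftrightarrow> i \<le> bead_count lam x"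
  using bead_count_eq[of x lam] by (auto simp: set_eq_iff)

lemma bead_count_rec:
  "bead_count lam x = bead_count lam (x + 1) + (if x \<in> beads lam then 1 else 0)"
proof -
  have "{b \<in> beads lam. x \<le> b} = {b \<in> beads lam. x + 1 \<le> b} \<union> (if x \<in> beads lam then {x} else {})"
  proof (rule set_eqI)
    fix b show "b \<in> {b \<in> beads lam. x \<le> b} \<longleftrightarrow>
        b \<in> {b \<in> beads lam. x + 1 \<le> b} \<union> (if x \<in> beads lam then {x} else {})"
      by (cases "b = x") auto
  qed
  then show ?thesis
    using finite_beads_ge[of lam "x + 1"] unfolding bead_count_def by (auto simp: card_insert_if)
qed

lemma bead_count_eq_0: "int (part lam 1) \<le> x \<Longrightarrow> bead_count lam x = 0"
proof -
  assume *: "int (part lam 1) \<le> x"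
  have "\<not> x \<le> bead lam 1" using * by (simp add: bead_def)
  then show ?thesis using le_bead_iff[of 1 x lam] by simp
qed

lemma bead_beyond: "size lam < i \<Longrightarrow> bead lam i = - int i"
  by (simp add: bead_def part_def)

lemma beads_below: "x < - int (size lam) \<Longrightarrow> x \<in> beads lam"
  unfolding beads_def by (rule image_eqI[of _ _ "nat (- x)"]) (auto simp: bead_beyond)

text \<open>A new longest row raises the index of every old row by one, so all old beads drop by
  one. The inductions that build a partition or a core rest on this.\<close>

lemma beads_add_max:
  assumes "\<forall>y \<in># M. y \<le> x"
  shows "beads (add_mset x M) = insert (int x - 1) ((\<lambda>b. b - 1) ` beads M)"
proof -
  have "{1..} = insert 1 (Suc ` {1..})"
  proof (rule set_eqI)
    fix n :: nat show "n \<in> {1..} \<longleftrightarrow> n \<in> insert 1 (Suc ` {1..})" by (cases n) auto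
  qed
  then have "beads (add_mset x M) = insert (bead (add_mset x M) 1) (bead (add_mset x M) ` Suc ` {1..})"
    by (metis beads_def image_insert)
  moreover have "bead (add_mset x M) 1 = int x - 1"
    using part_add_max(1)[OF assms] by (simp add: bead_def)
  moreover have "bead (add_mset x M) ` Suc ` {1..} = (\<lambda>b. b - 1) ` beads M"
    unfolding beads_def image_image
    by (rule image_cong) (auto simp: bead_def part_add_max(2)[OF assms])
  ultimately show ?thesis by simp
qed

lemma beads_empty: "beads {#} = {..<0}"
  by (auto simp: beads_def bead_def part_def image_iff) (rule bexI[of _ "nat (- x)" for x], auto)

lemma part_1_add: "\<forall>y \<in># M. y \<le> part M 1"
proof
  fix y assume "y \<in># M"
  then have "y \<in># image_mset (part M) (mset_set {1..size M})" by (simp only: mset_parts)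
  then obtain i where "1 \<le> i" "y = part M i" by auto
  then show "y \<le> part M 1" using part_antimono[of 1 i M] by simp
qed

text \<open>The threshold \<open>- card X\<close> is the normalisation of a bead set: as many beads
  lie above the full tail as the empty partition has there. Induction on the number of these beads
  removes the largest one.\<close>

lemma exists_partition_beads:
  assumes "finite X" "\<forall>x\<in>X. - int (card X) \<le> x"
  shows "\<exists>lam. is_partition lam \<and> beads lam = {..< - int (card X)} \<union> X"
  using assms
proof (induction "card X" arbitrary: X)
  case 0
  then show ?case by (intro exI[of _ "{#}"]) (auto simp: is_partition_def beads_empty)
next
  case (Suc l)
  define b where "b = Max X"
  have "X \<noteq> {}" using Suc.hyps by auto
  then have b: "b \<in> X" "\<forall>x\<in>X. x \<le> b" using Suc.prems by (auto simp: b_def)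
  show ?case
  proof (cases "b < 0")
    case True
    have "X \<subseteq> {- int (card X)..<0}" using Suc.prems b True by force
    moreover have "card {- int (card X)..<0} = card X" by simp
    ultimately have "X = {- int (card X)..<0}" using card_subset_eq[of "{- int (card X)..<0}" X] by simp
    then have "{..< - int (card X)} \<union> X = {..<0}" by (metis ivl_disj_un_one(2) neg_le_0_iff_le of_nat_0_le_iff)
    then show ?thesis by (intro exI[of _ "{#}"]) (auto simp: is_partition_def beads_empty)
  next
    case False
    \<comment> \<open>Inverse of adding a longest row: drop the top bead, which stands for a part
      \<open>b + 1\<close>, and undo the shift by one.\<close>
    define Y where "Y = (\<lambda>x. x + 1) ` (X - {b})"
    have "card Y = card (X - {b})" unfolding Y_def by (rule card_image) (auto simp: inj_on_def)
    then have cY: "card Y = l" using Suc b by simp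
    have "\<forall>x\<in>X. - int (Suc l) \<le> x" using Suc.prems(2) Suc.hyps(2) by simp
    then have "\<forall>x\<in>Y. - int (card Y) \<le> x" unfolding cY by (auto simp: Y_def)
    then obtain lam where lam: "is_partition lam" "beads lam = {..< - int l} \<union> Y"
      using Suc.hyps(1)[of Y] Suc.prems cY by (auto simp: Y_def)
    have "bead lam 1 \<in> beads lam" by (simp add: beads_def)
    moreover have "x \<le> b" if "x \<in> beads lam" for x
    proof -
      have "x < - int l \<or> (\<exists>y\<in>X. y \<noteq> b \<and> x = y + 1)" using that by (auto simp: lam Y_def)
      then show ?thesis using b False by force
    qed
    ultimately have "part lam 1 \<le> nat (b + 1)" by (force simp: bead_def)
    then have mx: "\<forall>y\<in>#lam. y \<le> nat (b + 1)" using part_1_add[of lam] by force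
    have "is_partition (add_mset (nat (b + 1)) lam)" using lam False by (auto simp: is_partition_def)
    moreover have "(\<lambda>x. x - 1) ` {..< - int l} = {..< - int (Suc l)}"
    proof (rule set_eqI)
      fix y show "y \<in> (\<lambda>x. x - 1) ` {..< - int l} \<longleftrightarrow> y \<in> {..< - int (Suc l)}"
        by (auto simp: image_iff intro: bexI[of _ "y + 1"])
    qed
    then have "beads (add_mset (nat (b + 1)) lam) = {..< - int (card X)} \<union> X"
      using b False Suc.hyps(2) by (auto simp: beads_add_max[OF mx] lam image_Un Y_def image_image)
    ultimately show ?thesis by blast
  qed
qed

subsection \<open>Hook lengths and cores in terms of beads\<close>

text \<open>This is \<open>-1\<close> minus the \<open>j\<close>-th bead of the conjugate: rows give
  the beads and columns the gaps of one boundary path.\<close>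

definition gap :: "partition \<Rightarrow> nat \<Rightarrow> int" where
  "gap lam j = int j - 1 - int (conj_part lam j)"

definition window_gaps :: "nat \<Rightarrow> int set \<Rightarrow> int \<Rightarrow> nat" where
  "window_gaps k B b = card ({b - int k..<b} - B)"

lemma in_diagram_iff: "(i, j) \<in> diagram lam \<longleftrightarrow> 1 \<le> i \<and> 1 \<le> j \<and> j \<le> part lam i"
  by (simp add: diagram_def)

lemma diagram_row_le: "(i, j) \<in> diagram lam \<Longrightarrow> i \<le> size lam"
  by (auto simp: diagram_def part_def split: if_splits)

lemma le_conj_part_iff:
  assumes "1 \<le> i" "1 \<le> j"
  shows "i \<le> conj_part lam j \<longleftrightarrow> j \<le> part lam i"
proof -
  let ?S = "{i. (i, j) \<in> diagram lam}"
  have "finite ?S" by (rule finite_subset[of _ "{..size lam}"]) (auto dest: diagram_row_le)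
  moreover have "a \<in> ?S" if "1 \<le> a" "a \<le> b" "b \<in> ?S" for a b
    using that part_antimono[of a b lam] by (auto simp: in_diagram_iff)
  ultimately have "?S = {1..conj_part lam j}"
    unfolding conj_part_def by (intro down_closed_eq) (auto simp: in_diagram_iff)
  then show ?thesis using assms by (auto simp: set_eq_iff in_diagram_iff)
qed

lemma in_diagram_iff_gap:
  assumes "1 \<le> i" "1 \<le> j"
  shows "(i, j) \<in> diagram lam \<longleftrightarrow> gap lam j < bead lam i"
  using le_conj_part_iff[OF assms, of lam] assms
  by (cases "j \<le> part lam i") (auto simp: in_diagram_iff gap_def bead_def)

lemma hook_length_eq:
  assumes "(i, j) \<in> diagram lam"
  shows "int (hook_length lam (i, j)) = bead lam i - gap lam j"
  using assms le_conj_part_iff[of i j lam]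
  by (auto simp: in_diagram_iff gap_def bead_def hook_length_def)

lemma gap_not_bead:
  assumes "1 \<le> j"
  shows "gap lam j \<notin> beads lam"
proof
  assume "gap lam j \<in> beads lam"
  then obtain i where i: "1 \<le> i" "gap lam j = bead lam i" by (auto simp: beads_def)
  then show False using le_conj_part_iff[OF i(1) assms, of lam]
    by (cases "j \<le> part lam i") (auto simp: gap_def bead_def)
qed

lemma gap_less:
  assumes "1 \<le> i" "i < j"
  shows "gap lam i < gap lam j"
proof -
  have "conj_part lam j \<le> conj_part lam i"
    using le_conj_part_iff[of "conj_part lam j" j lam] le_conj_part_iff[of "conj_part lam j" i lam] assms
    by (cases "conj_part lam j = 0") auto
  then show ?thesis using assms by (simp add: gap_def)
qed

lemma inj_on_gap: "inj_on (gap lam) {1..}"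
  by (rule inj_onI) (metis atLeast_iff gap_less linorder_neqE_nat order_less_irrefl)

lemma gap_image: "gap lam ` {1..} = - beads lam"
proof
  show "gap lam ` {1..} \<subseteq> - beads lam" using gap_not_bead by auto
  show "- beads lam \<subseteq> gap lam ` {1..}"
  proof
    fix x assume x: "x \<in> - beads lam"
    \<comment> \<open>The column belonging to a gap has as many cells as there are beads above the
      gap. This forces its length \<open>i\<close>, and then its number
      \<open>x + 1 + i\<close>.\<close>
    define i where "i = bead_count lam x"
    have Suc_i: "bead lam (Suc i) < x"
      using le_bead_iff[of "Suc i" x lam] by (simp add: i_def)
    define j where "j = nat (x + 1 + int i)"
    have j: "int j = x + 1 + int i" "1 \<le> j"
      using Suc_i by (auto simp: j_def bead_def)
    have "\<not> j \<le> part lam (Suc i)" using Suc_i j by (simp add: bead_def)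
    then have "conj_part lam j \<le> i" using le_conj_part_iff[of "Suc i" j lam] j by auto
    moreover have "i \<le> conj_part lam j"
    proof (cases "i = 0")
      case False
      then have "x \<le> bead lam i" using le_bead_iff[of i x lam] by (simp add: i_def)
      moreover have "bead lam i \<noteq> x" using x False by (auto simp: beads_def)
      ultimately have "x < bead lam i" by simp
      then have "j \<le> part lam i" using j by (simp add: bead_def)
      then show ?thesis using le_conj_part_iff[of i j lam] j False by simp
    qed simp
    ultimately have "gap lam j = x" using j by (simp add: gap_def)
    then show "x \<in> gap lam ` {1..}" using j by auto
  qed
qed

lemma is_core_iff:
  assumes "is_partition lam" "1 \<le> n"
  shows "is_core n lam \<longleftrightarrow> (\<forall>b \<in> beads lam. b - int n \<in> beads lam)"
proof
  assume core: "is_core n lam"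
  show "\<forall>b \<in> beads lam. b - int n \<in> beads lam"
  proof (rule ballI, rule ccontr)
    fix b assume "b \<in> beads lam" "b - int n \<notin> beads lam"
    then have "b \<in> bead lam ` {1..}" "b - int n \<in> gap lam ` {1..}"
      unfolding gap_image by (auto simp: beads_def)
    then obtain i j where ij: "1 \<le> i" "b = bead lam i" "1 \<le> j" "b - int n = gap lam j"
      by auto
    then have "(i, j) \<in> diagram lam" using assms(2) by (subst in_diagram_iff_gap) auto
    moreover from hook_length_eq[OF this] ij have "hook_length lam (i, j) = n" by simp
    ultimately show False using core by (auto simp: is_core_def)
  qed
next
  assume *: "\<forall>b \<in> beads lam. b - int n \<in> beads lam"
  show "is_core n lam" unfolding is_core_def
  proof (intro conjI ballI assms(1))
    fix c assume "c \<in> diagram lam"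
    then obtain i j where c: "c = (i, j)" "(i, j) \<in> diagram lam" by (cases c) auto
    then have ij: "1 \<le> i" "1 \<le> j" by (auto simp: in_diagram_iff)
    then have "bead lam i \<in> beads lam" by (auto simp: beads_def)
    then have "bead lam i - int n \<noteq> gap lam j" using * gap_not_bead[OF ij(2)] by metis
    then show "hook_length lam c \<noteq> n" using hook_length_eq[OF c(2)] c by auto
  qed
qed

text \<open>A hook length is the distance from the gap of its column up to the bead of its row, and
  distinct columns have distinct gaps.\<close>

lemma card_row_hooks:
  assumes "1 \<le> i"
  shows "card {j. (i, j) \<in> diagram lam \<and> hook_length lam (i, j) \<le> k} = window_gaps k (beads lam) (bead lam i)"
proof -
  let ?J = "{j. (i, j) \<in> diagram lam \<and> hook_length lam (i, j) \<le> k}"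
  have J: "?J = {j. 1 \<le> j \<and> gap lam j \<in> {bead lam i - int k..<bead lam i}}"
  proof (rule set_eqI)
    fix j
    show "j \<in> ?J \<longleftrightarrow> j \<in> {j. 1 \<le> j \<and> gap lam j \<in> {bead lam i - int k..<bead lam i}}"
    proof (cases "1 \<le> j")
      case True
      then show ?thesis
        using in_diagram_iff_gap[OF assms True, of lam] hook_length_eq[of i j lam] by auto
    qed (auto simp: in_diagram_iff)
  qed
  have "gap lam ` ?J = gap lam ` {1..} \<inter> {bead lam i - int k..<bead lam i}"
    unfolding J by auto
  also have "\<dots> = {bead lam i - int k..<bead lam i} - beads lam"
    unfolding gap_image by auto
  finally have "window_gaps k (beads lam) (bead lam i) = card (gap lam ` ?J)"
    by (simp add: window_gaps_def)
  also have "\<dots> = card ?J"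
    by (rule card_image, rule inj_on_subset[OF inj_on_gap]) (auto simp: in_diagram_iff)
  finally show ?thesis by simp
qed

lemma core_to_bounded_eq:
  "core_to_bounded k lam = filter_mset (\<lambda>x. 0 < x)
     (image_mset (\<lambda>i. window_gaps k (beads lam) (bead lam i)) (mset_set {1..size lam}))"
  unfolding core_to_bounded_def
  by (rule arg_cong[where f = "filter_mset _"], rule image_mset_cong) (simp add: card_row_hooks)

lemma window_gaps_shift: "window_gaps k ((\<lambda>b. b + d) ` B) (b + d) = window_gaps k B b"
proof -
  have "{b + d - int k..<b + d} - (\<lambda>b. b + d) ` B = (\<lambda>b. b + d) ` ({b - int k..<b} - B)"
  proof -
    have "{b + d - int k..<b + d} = (\<lambda>b. b + d) ` {b - int k..<b}"
      by (simp add: algebra_simps)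
    then show ?thesis by (simp add: image_set_diff)
  qed
  then show ?thesis unfolding window_gaps_def by (simp add: card_image)
qed

lemma window_gaps_zero_beyond: "size lam < i \<Longrightarrow> window_gaps k (beads lam) (bead lam i) = 0"
proof -
  assume "size lam < i"
  then have "{bead lam i - int k..<bead lam i} \<subseteq> beads lam"
    by (auto simp: bead_beyond intro: beads_below)
  then have "{bead lam i - int k..<bead lam i} - beads lam = {}" by blast
  then show ?thesis unfolding window_gaps_def by simp
qed

text \<open>Frees the computation from row numbers: any finite set of beads containing all nonzero
  rows will do. Beads can then be listed level by level.\<close>

lemma core_to_bounded_beads:
  assumes "finite X" "X \<subseteq> beads lam" "\<And>b. b \<in> beads lam \<Longrightarrow> 0 < window_gaps k (beads lam) b \<Longrightarrow> b \<in> X"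
  shows "core_to_bounded k lam = filter_mset (\<lambda>x. 0 < x) (image_mset (window_gaps k (beads lam)) (mset_set X))"
proof -
  let ?W = "window_gaps k (beads lam)"
  let ?Y = "bead lam ` {1..size lam}"
  have "image_mset (\<lambda>i. ?W (bead lam i)) (mset_set {1..size lam}) = image_mset ?W (image_mset (bead lam) (mset_set {1..size lam}))"
    by (simp add: multiset.map_comp comp_def)
  also have "image_mset (bead lam) (mset_set {1..size lam}) = mset_set ?Y"
    by (rule image_mset_mset_set, rule inj_on_subset[OF inj_on_bead]) auto
  finally have "core_to_bounded k lam = filter_mset (\<lambda>x. 0 < x) (image_mset ?W (mset_set ?Y))"
    by (simp add: core_to_bounded_eq)
  also have "\<dots> = image_mset ?W (mset_set {b \<in> ?Y. 0 < ?W b})"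
    by (simp add: filter_mset_image_mset filter_mset_mset_set)
  also have "{b \<in> ?Y. 0 < ?W b} = {b \<in> X. 0 < ?W b}"
  proof -
    have "b \<in> ?Y" if b: "b \<in> beads lam" "0 < ?W b" for b
    proof -
      obtain i where i: "1 \<le> i" "b = bead lam i" using b(1) unfolding beads_def by auto
      have "\<not> size lam < i"
      proof
        assume "size lam < i"
        then show False using window_gaps_zero_beyond[of lam i k] b(2) unfolding i(2) by simp
      qed
      then show ?thesis using i by auto
    qed
    moreover have "?Y \<subseteq> beads lam" by (auto simp: beads_def)
    ultimately show ?thesis using assms(2,3) by blast
  qed
  also have "image_mset ?W (mset_set {b \<in> X. 0 < ?W b}) = filter_mset (\<lambda>x. 0 < x) (image_mset ?W (mset_set X))"
    using assms(1) by (simp add: filter_mset_image_mset filter_mset_mset_set)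
  finally show ?thesis .
qed

lemma sum_mset_filter_pos: "sum_mset (filter_mset (\<lambda>x. 0 < x) M) = sum_mset (M :: nat multiset)"
  by (induction M) auto

lemma finite_diagram: "finite (diagram lam)"
proof (rule finite_subset)
  show "diagram lam \<subseteq> {..size lam} \<times> {..part lam 1}"
    using part_antimono[of 1 _ lam] diagram_row_le[of _ _ lam] by (force simp: in_diagram_iff)
qed simp

lemma core_size_eq: "core_size (Suc k) lam = sum_mset (core_to_bounded k lam)"
proof -
  let ?J = "\<lambda>i. {j. (i, j) \<in> diagram lam \<and> hook_length lam (i, j) \<le> k}"
  have "{c \<in> diagram lam. hook_length lam c < Suc k} = (SIGMA i:{1..size lam}. ?J i)"
    by (auto simp: in_diagram_iff less_Suc_eq_le dest: diagram_row_le)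
      (metis diagram_row_le in_diagram_iff One_nat_def)
  moreover have "finite (?J i)" for i
    by (rule finite_subset[of _ "snd ` diagram lam"]) (use finite_diagram in \<open>force+\<close>)
  ultimately have "core_size (Suc k) lam = (\<Sum>i\<in>{1..size lam}. card (?J i))"
    by (simp add: core_size_def)
  also have "\<dots> = (\<Sum>i\<in>{1..size lam}. window_gaps k (beads lam) (bead lam i))"
    by (rule sum.cong) (auto simp: card_row_hooks)
  finally show ?thesis by (simp add: core_to_bounded_eq sum_mset_filter_pos sum_unfold_sum_mset)
qed

subsection \<open>The bijection between cores and bounded partitions\<close>

text \<open>Moving the window from \<open>y\<close> up to \<open>x\<close> discards
  \<open>x - y\<close> places, one of which, \<open>x - (k + 1)\<close>, is a bead, so at most
  \<open>x - y - 1\<close> gaps are lost. The places strictly between \<open>y\<close> and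
  \<open>x\<close> are gained as gaps, and \<open>y\<close> as well when it is no bead.\<close>

lemma window_gaps_mono:
  assumes "y < x" "x - int (Suc k) \<in> B" "\<And>z. y < z \<Longrightarrow> z < x \<Longrightarrow> z \<notin> B"
  shows "window_gaps k B y \<le> window_gaps k B x"
    and "y \<notin> B \<Longrightarrow> window_gaps k B y < window_gaps k B x"
proof -
  let ?I = "{x - int k..<y} - B"
  have xy: "x - int (Suc k) \<le> y" using assms(3)[of "x - int (Suc k)"] assms(2) by force
  have "{y - int k..<y} - B \<subseteq> {y - int k..<x - int k - 1} \<union> ?I"
  proof
    fix z assume z: "z \<in> {y - int k..<y} - B"
    have "z \<noteq> x - int k - 1" using z assms(2) by (auto simp: algebra_simps)
    then show "z \<in> {y - int k..<x - int k - 1} \<union> ?I" using z by auto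
  qed
  then have "window_gaps k B y \<le> card ({y - int k..<x - int k - 1} \<union> ?I)"
    unfolding window_gaps_def by (intro card_mono) auto
  also have "\<dots> \<le> card {y - int k..<x - int k - 1} + card ?I" by (rule card_Un_le)
  finally have 1: "int (window_gaps k B y) \<le> x - 1 - y + int (card ?I)"
    using assms(1) by simp
  have 2: "card ?I + card G \<le> window_gaps k B x"
    if "G \<subseteq> {x - int k..<x} - B" "G \<subseteq> {y..<x}" for G
  proof -
    have "card (?I \<union> G) = card ?I + card G"
      using that by (intro card_Un_disjoint) (auto intro: finite_subset)
    moreover have "card (?I \<union> G) \<le> window_gaps k B x"
      unfolding window_gaps_def using that assms(1) by (intro card_mono) auto
    ultimately show ?thesis by simp
  qed
  have "card ?I + card {y<..<x} \<le> window_gaps k B x"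
    using xy assms(3) by (intro 2) auto
  then show "window_gaps k B y \<le> window_gaps k B x" using 1 assms(1) by simp
  show "window_gaps k B y < window_gaps k B x" if "y \<notin> B"
  proof -
    have "x - int (Suc k) \<noteq> y" using that assms(2) by auto
    moreover have "z \<notin> B" if "y \<le> z" "z < x" for z
      using that assms(3)[of z] \<open>y \<notin> B\<close> by (cases "z = y") auto
    ultimately have "card ?I + card {y..<x} \<le> window_gaps k B x"
      using xy by (intro 2) auto
    then show ?thesis using 1 assms(1) by simp
  qed
qed

text \<open>A discrete intermediate value argument over the places \<open>x\<close> with a bead at
  \<open>x - (k + 1)\<close>. From one such place \<open>y\<close> to the next one \<open>x\<close>
  exactly \<open>x - y - 1\<close> gaps leave the window. At most \<open>x - y\<close> enter, and at
  most \<open>x - y - 1\<close> if \<open>y\<close> is the bead \<beta>. So the count rises by at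
  most one, and not at all on the first step; the least candidate with count at least
  \<open>r\<close> has count \<open>r\<close>.\<close>

lemma window_gaps_surj:
  assumes "\<beta> \<in> B" "\<And>b. b \<in> B \<Longrightarrow> b \<le> \<beta>" "\<beta> - int (Suc k) \<in> B"
    and "window_gaps k B \<beta> \<le> r" "r \<le> k"
  shows "\<exists>x > \<beta>. x - int (Suc k) \<in> B \<and> window_gaps k B x = r"
proof -
  let ?W = "window_gaps k B"
  define X where "X = {x \<in> {\<beta><..\<beta> + int (Suc k)}. x - int (Suc k) \<in> B \<and> r \<le> ?W x}"
  \<comment> \<open>One period above the largest bead the window consists of gaps only, so a
    candidate with count \<open>k\<close> exists.\<close>
  have "{\<beta> + int (Suc k) - int k..<\<beta> + int (Suc k)} - B = {\<beta> + 1..<\<beta> + 1 + int k}"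
    using assms(2) by force
  then have "?W (\<beta> + int (Suc k)) = k" unfolding window_gaps_def by simp
  then have "\<beta> + int (Suc k) \<in> X" using assms by (auto simp: X_def)
  moreover have fin: "finite X" by (rule finite_subset[of _ "{\<beta><..\<beta> + int (Suc k)}"]) (auto simp: X_def)
  ultimately have MX: "Min X \<in> X" by (intro Min_in) auto
  define x where "x = Min X"
  have x: "\<beta> < x" "x \<le> \<beta> + int (Suc k)" "x - int (Suc k) \<in> B" "r \<le> ?W x"
    using MX by (auto simp: x_def X_def)
  define Y where "Y = {y \<in> {\<beta>..<x}. y - int (Suc k) \<in> B}"
  define y where "y = Max Y"
  have finY: "finite Y" by (rule finite_subset[of _ "{\<beta>..<x}"]) (auto simp: Y_def)
  have "\<beta> \<in> Y" using x assms by (auto simp: Y_def)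
  then have "y \<in> Y" unfolding y_def using finY by (intro Max_in) auto
  then have y: "\<beta> \<le> y" "y < x" "y - int (Suc k) \<in> B" by (auto simp: Y_def)
  have between: "z \<notin> B" if "y - int (Suc k) < z" "z < x - int (Suc k)" for z
  proof
    assume "z \<in> B"
    then have "z + int (Suc k) \<in> Y" using that y by (auto simp: Y_def)
    then have "z + int (Suc k) \<le> y" unfolding y_def using finY by simp
    then show False using that by simp
  qed
  let ?I = "{x - int k..<y} - B"
  let ?L = "{y - int k..<x - int k - 1}"
  have "card (?I \<union> ?L) = card ?I + card ?L" by (rule card_Un_disjoint) auto
  moreover have "card (?I \<union> ?L) \<le> ?W y"
    unfolding window_gaps_def using between x(2) y by (intro card_mono) auto
  ultimately have Wy: "int (card ?I) + (x - 1 - y) \<le> int (?W y)" using y by simp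
  have "?W x \<le> card (?I \<union> ({y..<x} - B))"
    unfolding window_gaps_def using x(2) y by (intro card_mono) auto
  also have "\<dots> \<le> card ?I + card ({y..<x} - B)" by (rule card_Un_le)
  finally have Wx: "?W x \<le> card ?I + card ({y..<x} - B)" .
  have "?W x \<le> r"
  proof (cases "y = \<beta>")
    case True
    have "card ({y..<x} - B) \<le> card {y<..<x}"
      using True assms(1) by (intro card_mono) (auto simp: order_le_less)
    then show ?thesis using Wx Wy True assms(4) y by simp
  next
    case False
    have "y \<notin> X"
    proof
      assume "y \<in> X"
      then have "x \<le> y" unfolding x_def by (rule Min_le[OF fin])
      then show False using y(2) by simp
    qed
    then have "?W y < r" using False y x by (auto simp: X_def)
    moreover have "card ({y..<x} - B) \<le> card {y..<x}" by (intro card_mono) auto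
    ultimately show ?thesis using Wx Wy y by simp
  qed
  then show ?thesis using x by (intro exI[of _ x]) auto
qed

section \<open>Adding a longest row to a core\<close>

lemma window_gaps_insert: "b \<le> a \<Longrightarrow> window_gaps k (insert a B) b = window_gaps k B b"
  unfolding window_gaps_def by (rule arg_cong[where f = card]) auto

lemma bead_le_bead_1: "b \<in> beads lam \<Longrightarrow> b \<le> bead lam 1"
  unfolding beads_def using part_antimono[of 1 _ lam] by (force simp: bead_def)

lemma bead_add_max:
  assumes "\<forall>y \<in># M. y \<le> x" "1 \<le> i"
  shows "bead (add_mset x M) (Suc i) = bead M i - 1"
  using part_add_max(2)[OF assms] by (simp add: bead_def)

lemma part_1_le_iff: "part M 1 \<le> x \<longleftrightarrow> (\<forall>y \<in># M. y \<le> x)"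
proof
  show "part M 1 \<le> x \<Longrightarrow> \<forall>y \<in># M. y \<le> x" using part_1_add[of M] by force
  assume *: "\<forall>y \<in># M. y \<le> x"
  show "part M 1 \<le> x"
  proof (cases "M = {#}")
    case False
    then have "part M 1 \<in># image_mset (part M) (mset_set {1..size M})"
      by (auto simp: Suc_le_eq nonempty_has_size)
    then have "part M 1 \<in># M" by (simp only: mset_parts)
    then show ?thesis using * by simp
  qed (simp add: part_def)
qed

lemma bead_1_less: "\<forall>y \<in># M. y \<le> x \<Longrightarrow> bead M 1 < int x"
  using part_1_le_iff[of M x] by (auto simp: bead_def)

lemma window_gaps_add_max:
  assumes "\<forall>y \<in># M. y \<le> x" "b \<le> int x"
  shows "window_gaps k (beads (add_mset x M)) (b - 1) = window_gaps k (beads M) b"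
  using window_gaps_shift[of k "-1" "beads M" b] assms(2)
  by (simp add: beads_add_max[OF assms(1)] window_gaps_insert)

text \<open>The windows of the old beads lie below the new bead, so the old rows keep their counts.
  \<open>int x\<close> is the place of the new bead before everything drops by one.\<close>

lemma core_to_bounded_add_max:
  assumes "\<forall>y \<in># M. y \<le> x"
  shows "core_to_bounded k (add_mset x M) =
    filter_mset (\<lambda>x. 0 < x) {#window_gaps k (beads M) (int x)#} + core_to_bounded k M"
proof -
  let ?W = "\<lambda>M i. window_gaps k (beads M) (bead M i)"
  have "{1..size (add_mset x M)} = insert 1 (Suc ` {1..size M})"
  proof (rule set_eqI)
    fix i show "i \<in> {1..size (add_mset x M)} \<longleftrightarrow> i \<in> insert 1 (Suc ` {1..size M})"
      by (cases i) auto
  qed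
  moreover have "mset_set (insert 1 (Suc ` {1..size M})) = add_mset 1 (mset_set (Suc ` {1..size M}))"
    by (rule mset_set.insert) auto
  moreover have "image_mset Suc (mset_set {1..size M}) = mset_set (Suc ` {1..size M})"
    by (rule image_mset_mset_set) simp
  ultimately have "mset_set {1..size (add_mset x M)} = add_mset 1 (image_mset Suc (mset_set {1..size M}))"
    by (simp only:)
  then have "image_mset (?W (add_mset x M)) (mset_set {1..size (add_mset x M)}) =
      add_mset (?W (add_mset x M) 1) (image_mset (\<lambda>i. ?W (add_mset x M) (Suc i)) (mset_set {1..size M}))"
    by (simp add: multiset.map_comp comp_def)
  also have "image_mset (\<lambda>i. ?W (add_mset x M) (Suc i)) (mset_set {1..size M}) = image_mset (?W M) (mset_set {1..size M})"
  proof (rule image_mset_cong)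
    fix i assume "i \<in># mset_set {1..size M}"
    then have i: "1 \<le> i" by simp
    then have "bead M i \<in> beads M" by (simp add: beads_def)
    then have "bead M i \<le> int x"
      using bead_1_less[OF assms] bead_le_bead_1[of "bead M i" M] by linarith
    then show "?W (add_mset x M) (Suc i) = ?W M i"
      by (simp add: bead_add_max[OF assms i] window_gaps_add_max[OF assms])
  qed
  also have "?W (add_mset x M) 1 = window_gaps k (beads M) (int x)"
    using window_gaps_add_max[OF assms, of "int x"] part_add_max(1)[OF assms] by (simp add: bead_def)
  finally show ?thesis unfolding core_to_bounded_eq by simp
qed

text \<open>The new bead is the largest, so no other bead needs it \<open>n\<close> places below;
  the only new closure condition concerns the place below the new bead itself.\<close>

lemma is_core_add_max:
  assumes "\<forall>y \<in># M. y \<le> x" "1 \<le> x" "is_partition M" "1 \<le> n"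
  shows "is_core n (add_mset x M) \<longleftrightarrow> is_core n M \<and> int x - int n \<in> beads M"
proof -
  have part: "is_partition (add_mset x M)" using assms by (auto simp: is_partition_def)
  have less: "b < int x" if "b \<in> beads M" for b
    using bead_1_less[OF assms(1)] bead_le_bead_1[OF that] by linarith
  have mem: "b - 1 \<in> beads (add_mset x M) \<longleftrightarrow> b = int x \<or> b \<in> beads M" for b
    unfolding beads_add_max[OF assms(1)] by (auto simp: image_iff)
  have "is_core n (add_mset x M) \<longleftrightarrow> (\<forall>b. b - 1 \<in> beads (add_mset x M) \<longrightarrow> (b - int n) - 1 \<in> beads (add_mset x M))"
    unfolding is_core_iff[OF part assms(4)]
    by (metis (no_types, opaque_lifting) add.commute diff_add_cancel diff_diff_eq)
  also have "\<dots> \<longleftrightarrow> (\<forall>b. b = int x \<or> b \<in> beads M \<longrightarrow> b - int n = int x \<or> b - int n \<in> beads M)"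
    unfolding mem ..
  also have "\<dots> \<longleftrightarrow> (\<forall>b \<in> beads M. b - int n \<in> beads M) \<and> int x - int n \<in> beads M"
    using less assms(4) by force
  finally show ?thesis by (simp add: is_core_iff[OF assms(3,4)])
qed

lemma core_closed: "is_core (Suc k) lam \<Longrightarrow> b \<in> beads lam \<Longrightarrow> b - int (Suc k) \<in> beads lam"
  using is_core_iff[of lam "Suc k"] by (auto simp: is_core_def)

lemma window_gaps_bead_le_1:
  assumes "is_core (Suc k) lam" "1 \<le> i"
  shows "window_gaps k (beads lam) (bead lam i) \<le> window_gaps k (beads lam) (bead lam 1)"
  using assms(2)
proof (induction rule: dec_induct)
  case (step i)
  have "window_gaps k (beads lam) (bead lam (Suc i)) \<le> window_gaps k (beads lam) (bead lam i)"
  proof (rule window_gaps_mono(1))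
    show "bead lam (Suc i) < bead lam i" using step by (intro bead_less) auto
    show "bead lam i - int (Suc k) \<in> beads lam"
      using step by (intro core_closed[OF assms(1)]) (auto simp: beads_def)
    show "z \<notin> beads lam" if "bead lam (Suc i) < z" "z < bead lam i" for z
      using that step by (auto simp: beads_def bead_less_iff)
  qed
  then show ?case using step by simp
qed simp

text \<open>If the window below a bead had no gap, it would, together with the place
  \<open>k + 1\<close> below, fill a whole period; closure then makes every smaller integer a bead.
  But the gap of column 1 lies below the bead of every nonempty row.\<close>

lemma core_row_pos:
  assumes "is_core (Suc k) lam" "1 \<le> i" "i \<le> size lam"
  shows "0 < window_gaps k (beads lam) (bead lam i)"
proof (rule ccontr)
  assume "\<not> ?thesis"
  then have win: "{bead lam i - int k..<bead lam i} \<subseteq> beads lam" by (auto simp: window_gaps_def)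
  have "bead lam i \<in> beads lam" using assms(2) by (auto simp: beads_def)
  then have "bead lam i - int (Suc k) \<in> beads lam" by (rule core_closed[OF assms(1)])
  have all: "bead lam i - int m \<in> beads lam" for m
  proof (induction m rule: less_induct)
    case (less m)
    show ?case
    proof (cases "m \<le> Suc k")
      case True
      then show ?thesis
        using win \<open>bead lam i - int (Suc k) \<in> beads lam\<close> \<open>bead lam i \<in> beads lam\<close>
        by (cases "m = 0 \<or> m = Suc k") auto
    next
      case False
      then have "bead lam i - int (m - Suc k) - int (Suc k) \<in> beads lam"
        by (intro core_closed[OF assms(1)] less) auto
      then show ?thesis using False by (simp add: of_nat_diff)
    qed
  qed
  have "is_partition lam" using assms(1) by (simp add: is_core_def)
  then have "(i, 1) \<in> diagram lam" using part_pos_iff[of lam i] assms(2,3) by (simp add: in_diagram_iff)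
  then have "gap lam 1 < bead lam i" using in_diagram_iff_gap[of i 1 lam] assms(2) by simp
  then show False using all[of "nat (bead lam i - gap lam 1)"] gap_not_bead[of 1 lam] by simp
qed

lemma size_core_to_bounded: "is_core (Suc k) lam \<Longrightarrow> size (core_to_bounded k lam) = size lam"
proof -
  assume "is_core (Suc k) lam"
  then have "core_to_bounded k lam = image_mset (\<lambda>i. window_gaps k (beads lam) (bead lam i)) (mset_set {1..size lam})"
    unfolding core_to_bounded_eq by (subst filter_mset_eq_conv) (auto intro: core_row_pos)
  then show ?thesis by simp
qed

lemma core_add_max_row:
  assumes "is_core (Suc k) M" "\<forall>y \<in># M. y \<le> x" "int x - int (Suc k) \<in> beads M"
  shows "\<forall>y \<in># core_to_bounded k M. y \<le> window_gaps k (beads M) (int x)"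
proof
  fix y assume "y \<in># core_to_bounded k M"
  then obtain i where i: "1 \<le> i" "y = window_gaps k (beads M) (bead M i)"
    by (auto simp: core_to_bounded_eq)
  have "window_gaps k (beads M) (bead M 1) \<le> window_gaps k (beads M) (int x)"
    using bead_1_less[OF assms(2)] bead_le_bead_1[of _ M] assms(3) by (intro window_gaps_mono(1)) force+
  then show "y \<le> window_gaps k (beads M) (int x)"
    using window_gaps_bead_le_1[OF assms(1) i(1)] i by simp
qed

text \<open>The longest row has the largest count (\<open>core_add_max_row\<close>), so the image
  determines this count and, by induction, the core formed by the other rows. Two different places
  for the top bead would both lie above all other beads, where \<open>window_gaps_mono\<close> is
  strict.\<close>

lemma core_to_bounded_inj:
  assumes "is_core (Suc k) lam" "is_core (Suc k) mu" "core_to_bounded k lam = core_to_bounded k mu"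
  shows "lam = mu"
  using assms
proof (induction lam arbitrary: mu rule: multiset_induct_max)
  case empty
  then show ?case using size_core_to_bounded[of k mu] size_core_to_bounded[of k "{#}"] by simp
next
  case (add x M)
  have split: "1 \<le> x \<and> is_partition M" if "is_core (Suc k) (add_mset x M)" for x M
    using that by (auto simp: is_core_def is_partition_def Suc_le_eq)
  have core: "is_core (Suc k) M" "int x - int (Suc k) \<in> beads M"
    using is_core_add_max[of M x "Suc k"] split[OF add.prems(1)] add by auto
  have "size (add_mset x M) = size mu"
    using size_core_to_bounded[OF add.prems(1)] size_core_to_bounded[OF add.prems(2)] add.prems(3) by simp
  then have ne: "mu \<noteq> {#}" by auto
  define x' where "x' = Max_mset mu"
  define M' where "M' = mu - {#x'#}"
  have mu: "mu = add_mset x' M'" using ne by (simp add: M'_def x'_def)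
  have mx': "\<forall>y \<in># M'. y \<le> x'" unfolding M'_def x'_def by (auto dest: in_diffD)
  have core': "is_core (Suc k) M'" "int x' - int (Suc k) \<in> beads M'"
    using is_core_add_max[of M' x' "Suc k"] split[of x' M'] add.prems(2) mx' mu by auto
  let ?w = "window_gaps k (beads M) (int x)" and ?w' = "window_gaps k (beads M') (int x')"
  have pos: "0 < window_gaps k (beads M) (int x)" if "is_core (Suc k) (add_mset x M)" "\<forall>y \<in># M. y \<le> x" for x M
    using core_row_pos[OF that(1), of 1] window_gaps_add_max[OF that(2), of "int x"] part_add_max(1)[OF that(2)]
    by (simp add: bead_def)
  have "0 < ?w" "0 < ?w'" using pos[of x M] pos[of x' M'] add mx' mu by auto
  then have eq: "add_mset ?w (core_to_bounded k M) = add_mset ?w' (core_to_bounded k M')"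
    using core_to_bounded_add_max[of M x k] core_to_bounded_add_max[OF mx', of k] add.prems(3) add.hyps(1) mu by simp
  have "?w = Max_mset (add_mset ?w (core_to_bounded k M))"
    using core_add_max_row[OF core(1) _ core(2)] add.hyps(1) by (intro Max_eqI[symmetric]) auto
  moreover have "?w' = Max_mset (add_mset ?w' (core_to_bounded k M'))"
    using core_add_max_row[OF core'(1) mx' core'(2)] by (intro Max_eqI[symmetric]) auto
  ultimately have w: "?w = ?w'" using eq by metis
  then have "core_to_bounded k M = core_to_bounded k M'" using eq by simp
  then have MM: "M = M'" using add.IH core core' by blast
  have less: False
    if "int x < int x'" "\<forall>y \<in># M. y \<le> x" "int x' - int (Suc k) \<in> beads M"
      "window_gaps k (beads M) (int x) = window_gaps k (beads M) (int x')" for x x'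
  proof -
    have "z \<notin> beads M" if "int x \<le> z" for z
      using bead_1_less[OF \<open>\<forall>y \<in># M. y \<le> x\<close>] bead_le_bead_1[of z M] that by auto
    then have "window_gaps k (beads M) (int x) < window_gaps k (beads M) (int x')"
      using that by (intro window_gaps_mono(2)) auto
    then show False using that by simp
  qed
  have "x = x'"
  proof (rule linorder_cases[of x x'])
    assume "x < x'" then show ?thesis using less[of x x'] add.hyps(1) core' w MM by auto
  next
    assume "x' < x" then show ?thesis using less[of x' x] mx' core w MM by auto
  qed
  then show ?case using MM mu by simp
qed

text \<open>Parts are added in increasing order. The top row of the core so far counts at most the
  next part \<open>r\<close>, so \<open>window_gaps_surj\<close> finds a place for a bead whose row
  counts exactly \<open>r\<close>.\<close>

lemma exists_core:
  assumes "\<forall>y \<in># mu. 1 \<le> y \<and> y \<le> k"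
  shows "\<exists>lam. is_core (Suc k) lam \<and> core_to_bounded k lam = mu"
  using assms
proof (induction mu rule: multiset_induct_max)
  case empty
  have "is_core (Suc k) {#}" by (auto simp: is_core_def is_partition_def diagram_def part_def)
  then show ?case by (intro exI[of _ "{#}"]) (simp add: core_to_bounded_eq)
next
  case (add r N)
  then obtain M where M: "is_core (Suc k) M" "core_to_bounded k M = N" by auto
  then have part: "is_partition M" by (simp add: is_core_def)
  let ?W = "window_gaps k (beads M)"
  have "?W (bead M 1) \<le> r"
  proof (cases "?W (bead M 1) = 0")
    case False
    then have "\<not> size M < 1" using window_gaps_zero_beyond[of M 1 k] by (intro notI) simp
    then have "1 \<le> size M" by linarith
    then have "?W (bead M 1) \<in># core_to_bounded k M"
      using False unfolding core_to_bounded_eq by auto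
    then show ?thesis using M(2) add.hyps(1) by simp
  qed simp
  moreover have "bead M 1 \<in> beads M" by (simp add: beads_def)
  ultimately obtain x where x: "bead M 1 < x" "x - int (Suc k) \<in> beads M" "?W x = r"
    using window_gaps_surj[of "bead M 1" "beads M" k r] bead_le_bead_1[of _ M] core_closed[OF M(1)] add.prems
    by auto
  \<comment> \<open>A bead at 0 would be an empty row on top of an empty diagram; its window is full
    of beads, against \<open>1 \<le> r\<close>.\<close>
  have "x \<noteq> 0"
  proof
    assume "x = 0"
    then have "part M 1 = 0" using x by (simp add: bead_def)
    then have "M = {#}" using part_pos_iff[OF part, of 1] by (auto simp: Suc_le_eq nonempty_has_size)
    then have "{x - int k..<x} - beads M = {}" using \<open>x = 0\<close> by (auto simp: beads_empty)
    then have "?W x = 0" unfolding window_gaps_def by (simp only: card.empty)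
    then show False using x(3) add.prems by simp
  qed
  then have x1: "1 \<le> nat x" "int (nat x) = x" using x(1) by (auto simp: bead_def)
  have "part M 1 \<le> nat x" using x(1) by (auto simp: bead_def)
  then have mx: "\<forall>y \<in># M. y \<le> nat x" by (simp only: part_1_le_iff)
  have "is_core (Suc k) (add_mset (nat x) M)"
    using is_core_add_max[OF mx x1(1) part, of "Suc k"] M x x1 by simp
  moreover have "core_to_bounded k (add_mset (nat x) M) = add_mset r N"
    using core_to_bounded_add_max[OF mx, of k] x x1 M add.prems by auto
  ultimately show ?case by blast
qed

section \<open>The inverse map from bounded partitions to cores\<close>

lemma in_bounded_partitions_iff: "mu \<in> bounded_partitions k \<longleftrightarrow> (\<forall>y \<in># mu. 1 \<le> y \<and> y \<le> k)"
  unfolding bounded_partitions_def mem_Collect_eq part_1_le_iff is_partition_def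
  by (metis One_nat_def Suc_leI gr0I not_one_le_zero)

lemma window_gaps_le: "window_gaps k B b \<le> k"
  unfolding window_gaps_def using card_mono[of "{b - int k..<b}" "{b - int k..<b} - B"] by auto

lemma core_to_bounded_mem: "core_to_bounded k lam \<in> bounded_partitions k"
  unfolding in_bounded_partitions_iff core_to_bounded_eq by (auto simp: window_gaps_le Suc_le_eq)

lemma bounded_to_core:
  assumes "mu \<in> bounded_partitions k"
  shows is_core_bounded_to_core: "is_core (Suc k) (bounded_to_core k mu)"
    and core_to_bounded_to_core: "core_to_bounded k (bounded_to_core k mu) = mu"
proof -
  let ?C = "{kap. is_core (k + 1) kap}"
  have inj: "inj_on (core_to_bounded k) ?C" by (rule inj_onI) (auto intro: core_to_bounded_inj)
  have mu: "mu \<in> core_to_bounded k ` ?C"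
    using exists_core[of mu k] assms by (auto simp: in_bounded_partitions_iff)
  show "is_core (Suc k) (bounded_to_core k mu)"
    using the_inv_into_into[OF inj mu subset_refl] by (simp add: bounded_to_core_def)
  show "core_to_bounded k (bounded_to_core k mu) = mu"
    using f_the_inv_into_f[OF inj mu] by (simp add: bounded_to_core_def)
qed

lemma bounded_to_core_to_bounded: "is_core (Suc k) lam \<Longrightarrow> bounded_to_core k (core_to_bounded k lam) = lam"
  using core_to_bounded_inj bounded_to_core core_to_bounded_mem by metis

lemma core_size_bounded_to_core:
  "mu \<in> bounded_partitions k \<Longrightarrow> core_size (Suc k) (bounded_to_core k mu) = sum_mset mu"
  by (simp add: core_size_eq core_to_bounded_to_core)

subsection \<open>Horizontal strips in terms of beads\<close>

text \<open>This is interlacing of parts. If row \<open>i + 1\<close> of \<open>kap\<close> outgrew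
  row \<open>i\<close> of \<open>tau\<close>, the column at its end would contain new cells in both
  rows.\<close>

lemma horizontal_strip_iff:
  "horizontal_strip kap tau \<longleftrightarrow> (\<forall>i \<ge> 1. bead tau i \<le> bead kap i \<and> bead kap (Suc i) < bead tau i)"
proof
  assume hs: "horizontal_strip kap tau"
  show "\<forall>i \<ge> 1. bead tau i \<le> bead kap i \<and> bead kap (Suc i) < bead tau i"
  proof (intro allI impI)
    fix i :: nat assume i: "1 \<le> i"
    have sub: "part tau i \<le> part kap i" if "1 \<le> i" for i
    proof (rule ccontr)
      assume "\<not> part tau i \<le> part kap i"
      then have "(i, part tau i) \<in> diagram tau" "(i, part tau i) \<notin> diagram kap"
        using \<open>1 \<le> i\<close> by (auto simp: in_diagram_iff)
      then show False using hs by (auto simp: horizontal_strip_def)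
    qed
    have "part kap (Suc i) \<le> part tau i"
    proof (rule ccontr)
      assume *: "\<not> part kap (Suc i) \<le> part tau i"
      let ?j = "part kap (Suc i)"
      have "(i, ?j) \<in> diagram kap - diagram tau" "(Suc i, ?j) \<in> diagram kap - diagram tau"
        using * i part_antimono[of i "Suc i" kap] part_antimono[of i "Suc i" tau]
        by (auto simp: in_diagram_iff)
      moreover have "inj_on snd (diagram kap - diagram tau)" using hs by (simp add: horizontal_strip_def)
      ultimately have "(i, ?j) = (Suc i, ?j)" by (intro inj_onD[where f = snd]) auto
      then show False by simp
    qed
    then show "bead tau i \<le> bead kap i \<and> bead kap (Suc i) < bead tau i"
      using sub[OF i] by (simp add: bead_def)
  qed
next
  assume *: "\<forall>i \<ge> 1. bead tau i \<le> bead kap i \<and> bead kap (Suc i) < bead tau i"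
  then have rows: "part tau i \<le> part kap i" "part kap (Suc i) \<le> part tau i" if "1 \<le> i" for i
    using that by (auto simp: bead_def)
  have less: False if "(i, j) \<in> diagram kap - diagram tau" "(i', j) \<in> diagram kap - diagram tau" "i < i'" for i i' j
    using that rows(2)[of i] part_antimono[of "Suc i" i' kap] by (auto simp: in_diagram_iff)
  have "inj_on snd (diagram kap - diagram tau)"
  proof (rule inj_onI)
    fix c c' assume c: "c \<in> diagram kap - diagram tau" "c' \<in> diagram kap - diagram tau" "snd c = snd c'"
    obtain i j i' where "c = (i, j)" "c' = (i', j)" using c(3) by (cases c; cases c') auto
    then show "c = c'" using less[of i j i'] less[of i' j i] c by (cases i i' rule: linorder_cases) auto
  qed
  moreover have "diagram tau \<subseteq> diagram kap"
    using rows(1) order_trans by (fastforce simp: in_diagram_iff)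
  ultimately show "horizontal_strip kap tau" by (simp add: horizontal_strip_def)
qed

text \<open>These are the contents of the skew shape: along a diagonal each diagram is an initial
  segment, so two nested diagrams differ there exactly when the counts differ.\<close>

definition strip_contents :: "partition \<Rightarrow> partition \<Rightarrow> int set" where
  "strip_contents kap tau = {x. bead_count tau x < bead_count kap x}"

lemma contents_diff:
  "(\<lambda>(i, j). int j - int i) ` (diagram kap - diagram tau) = strip_contents kap tau"
proof
  show "(\<lambda>(i, j). int j - int i) ` (diagram kap - diagram tau) \<subseteq> strip_contents kap tau"
  proof clarify
    fix i j assume "(i, j) \<in> diagram kap" "(i, j) \<notin> diagram tau"
    then have "1 \<le> i" "int j - int i \<le> bead kap i" "\<not> int j - int i \<le> bead tau i"
      by (auto simp: in_diagram_iff bead_def)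
    then show "int j - int i \<in> strip_contents kap tau"
      by (simp add: strip_contents_def le_bead_iff)
  qed
  show "strip_contents kap tau \<subseteq> (\<lambda>(i, j). int j - int i) ` (diagram kap - diagram tau)"
  proof
    fix x assume x: "x \<in> strip_contents kap tau"
    define i where "i = bead_count kap x"
    have i: "1 \<le> i" "x \<le> bead kap i" "\<not> x \<le> bead tau i"
      using x le_bead_iff[of i x kap] le_bead_iff[of i x tau] by (auto simp: strip_contents_def i_def)
    then have "(i, nat (x + int i)) \<in> diagram kap - diagram tau" "int (nat (x + int i)) - int i = x"
      by (auto simp: in_diagram_iff bead_def)
    then show "x \<in> (\<lambda>(i, j). int j - int i) ` (diagram kap - diagram tau)" by force
  qed
qed

lemma residues_diff:
  "residue k ` (diagram kap - diagram tau) = (\<lambda>x. x mod (int k + 1)) ` strip_contents kap tau"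
  unfolding contents_diff[symmetric] image_image by (rule image_cong) (auto simp: residue_def)

lemma bead_count_at_bead: "1 \<le> i \<Longrightarrow> bead_count lam (bead lam i) = i"
  using le_bead_iff[of i "bead lam i" lam] le_bead_iff[of "Suc i" "bead lam i" lam] bead_less[of i "Suc i" lam]
  by auto

text \<open>Interlacing leaves room for at most one new cell on each diagonal. At the content
  \<open>bead tau i\<close> that cell would have to lie in row \<open>i + 1\<close>, which stays
  below this bead.\<close>

lemma horizontal_strip_counts:
  assumes "horizontal_strip kap tau"
  shows "bead_count kap x = bead_count tau x + (if x \<in> strip_contents kap tau then 1 else 0)"
    and "strip_contents kap tau \<inter> beads tau = {}"
proof -
  have rows: "bead tau i \<le> bead kap i" "bead kap (Suc i) < bead tau i" if "1 \<le> i" for i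
    using assms that by (auto simp: horizontal_strip_iff)
  have "bead_count tau x \<le> bead_count kap x"
  proof (cases "bead_count tau x = 0")
    case False
    then show ?thesis
      using le_bead_iff[of "bead_count tau x" x tau] le_bead_iff[of "bead_count tau x" x kap] rows(1)[of "bead_count tau x"]
      by (simp add: Suc_le_eq)
  qed simp
  moreover have "bead_count kap x \<le> bead_count tau x + 1"
  proof (cases "bead_count kap x \<le> 1")
    case False
    then obtain m where m: "bead_count kap x = Suc m" "1 \<le> m" by (cases "bead_count kap x") auto
    then show ?thesis
      using le_bead_iff[of "Suc m" x kap] le_bead_iff[of m x tau] rows(2)[of m] by simp
  qed simp
  ultimately show "bead_count kap x = bead_count tau x + (if x \<in> strip_contents kap tau then 1 else 0)"
    by (auto simp: strip_contents_def)
  show "strip_contents kap tau \<inter> beads tau = {}"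
  proof safe
    fix y assume y: "y \<in> strip_contents kap tau" "y \<in> beads tau"
    then obtain i where i: "1 \<le> i" "y = bead tau i" by (auto simp: beads_def)
    then have "Suc i \<le> bead_count kap y" using y(1) by (auto simp: strip_contents_def bead_count_at_bead)
    then have "y \<le> bead kap (Suc i)" by (subst le_bead_iff) auto
    then show "y \<in> {}" using rows(2)[OF i(1)] i by simp
  qed
qed

lemma horizontal_stripI:
  assumes "\<And>x. bead_count kap x = bead_count tau x + (if x \<in> D then 1 else 0)" "D \<inter> beads tau = {}"
  shows "horizontal_strip kap tau" and "strip_contents kap tau = D"
proof -
  show "strip_contents kap tau = D" by (auto simp: strip_contents_def assms(1))
  show "horizontal_strip kap tau" unfolding horizontal_strip_iff
  proof (intro allI impI conjI)
    fix i :: nat assume i: "1 \<le> i"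
    then have "i \<le> bead_count kap (bead tau i)" using assms(1)[of "bead tau i"] by (simp add: bead_count_at_bead)
    then show "bead tau i \<le> bead kap i" using i by (simp add: le_bead_iff)
    have "bead tau i \<notin> D" using assms(2) i by (auto simp: beads_def)
    then have "\<not> Suc i \<le> bead_count kap (bead tau i)" using i by (simp add: assms(1) bead_count_at_bead)
    then show "bead kap (Suc i) < bead tau i" using le_bead_iff[of "Suc i" "bead tau i" kap] by simp
  qed
qed

text \<open>Compares \<open>bead_count_rec\<close> for the two partitions. In effect each maximal
  run of consecutive strip contents carries one bead, from the place just below the run to its
  top.\<close>

lemma strip_contents_rec:
  assumes "horizontal_strip kap tau"
  shows "(if x \<in> strip_contents kap tau then 1 else 0) + (if x \<in> beads tau then 1 else 0) =
    (if x + 1 \<in> strip_contents kap tau then 1 else 0) + (if x \<in> beads kap then 1 else (0::nat))"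
  using horizontal_strip_counts(1)[OF assms, of x] horizontal_strip_counts(1)[OF assms, of "x + 1"]
    bead_count_rec[of kap x] bead_count_rec[of tau x]
  by (auto split: if_splits)

text \<open>The last cell of row \<open>i\<close> has content \<open>bead tau i\<close>. It is
  removable when the next row is strictly shorter, that is, when no bead sits directly below; the
  cell that could block it has content one smaller.\<close>

lemma corner_contents:
  assumes "horizontal_strip kap tau"
  shows "(\<lambda>(i, j). int j - int i) ` {c \<in> removable_corners tau. \<not> blocked kap c} =
    {b \<in> beads tau. b - 1 \<notin> beads tau \<and> b - 1 \<notin> strip_contents kap tau}" (is "?f ` ?C = ?S")
proof
  have blocked: "blocked kap (i, part tau i) \<longleftrightarrow> bead tau i - 1 \<in> strip_contents kap tau"
    if "1 \<le> i" "1 \<le> part tau i" "bead tau i - 1 \<notin> beads tau" for i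
  proof -
    have "blocked kap (i, part tau i) \<longleftrightarrow> bead tau i - 1 \<le> bead kap (Suc i)"
      using that by (auto simp: blocked_def in_diagram_iff bead_def)
    also have "\<dots> \<longleftrightarrow> Suc i \<le> bead_count kap (bead tau i - 1)" by (simp add: le_bead_iff)
    also have "\<dots> \<longleftrightarrow> bead_count tau (bead tau i - 1) < bead_count kap (bead tau i - 1)"
      using bead_count_rec[of tau "bead tau i - 1"] that by (simp add: bead_count_at_bead Suc_le_eq)
    finally show ?thesis by (simp add: strip_contents_def)
  qed
  show "?f ` ?C \<subseteq> ?S"
  proof (rule image_subsetI)
    fix cell assume "cell \<in> ?C"
    then obtain i j where cell: "cell = (i, j)"
      and c: "(i, j) \<in> removable_corners tau" "\<not> blocked kap (i, j)" by (cases cell) auto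
    then have ij: "1 \<le> i" "1 \<le> j" "j = part tau i" "part tau (Suc i) < j"
      by (auto simp: removable_corners_def in_diagram_iff)
    then have b: "int j - int i = bead tau i" by (simp add: bead_def)
    have "bead tau i - 1 \<notin> beads tau"
    proof
      assume "bead tau i - 1 \<in> beads tau"
      then obtain l where l: "1 \<le> l" "bead tau l = bead tau i - 1" by (auto simp: beads_def)
      then have "i < l" using bead_less_iff[of i l tau] ij(1) by simp
      then have "bead tau l \<le> bead tau (Suc i)" using bead_less[of "Suc i" l tau] by (cases "l = Suc i") auto
      then show False using l ij by (simp add: bead_def)
    qed
    then show "?f cell \<in> ?S"
      using c(2) blocked[of i] ij unfolding cell prod.case b by (auto simp: beads_def)
  qed
  show "?S \<subseteq> ?f ` ?C"
  proof
    fix b assume b: "b \<in> ?S"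
    then obtain i where i: "1 \<le> i" "b = bead tau i" by (auto simp: beads_def)
    have "bead tau (Suc i) \<in> beads tau" by (simp add: beads_def)
    then have "bead tau (Suc i) \<noteq> b - 1" using b by auto
    then have less: "part tau (Suc i) < part tau i"
      using bead_less[of i "Suc i" tau] i by (simp add: bead_def)
    then have "(i, part tau i) \<in> removable_corners tau" using i by (auto simp: removable_corners_def in_diagram_iff)
    moreover have "\<not> blocked kap (i, part tau i)" using blocked[of i] i b less by auto
    moreover have "b = ?f (i, part tau i)" using i by (simp add: bead_def)
    ultimately show "b \<in> ?f ` ?C" by blast
  qed
qed

lemma corner_residues_eq:
  assumes "horizontal_strip kap tau"
  shows "corner_residues k kap tau =
    card ((\<lambda>x. x mod (int k + 1)) ` {b \<in> beads tau. b - 1 \<notin> beads tau \<and> b - 1 \<notin> strip_contents kap tau})"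
  unfolding corner_residues_def corner_contents[OF assms, symmetric] image_image
  by (rule arg_cong[where f = card], rule image_cong) (auto simp: residue_def)

subsection \<open>Cores of unions of rectangles\<close>

lemma image_mset_sum: "image_mset f (\<Sum>i\<in>A. M i) = (\<Sum>i\<in>A. image_mset f (M i))"
  by (induction A rule: infinite_finite_induct) auto

text \<open>
  \<open>N 0, \<dots>, N (Q - 1)\<close> are the widths of the rectangles; the remaining values let the formulas cover
  the full levels \<open>q < 0\<close> and the top level \<open>Q\<close>, which carries the single bead \<open>0\<close>. In
  \<open>level_set d\<close> the bead \<open>0\<close> of level \<open>q\<close> has moved to position \<open>d q\<close>, passing the contents \<open>run d\<close>.
\<close>
locale rectangle_levels =
  fixes k Q :: nat and N :: "int \<Rightarrow> int"
  assumes N_mono: "q \<le> q' \<Longrightarrow> N q \<le> N q'"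
    and N_neg: "q < 0 \<Longrightarrow> N q = 0"
    and N_pos: "0 \<le> q \<Longrightarrow> 1 \<le> N q"
    and N_le: "N q \<le> int k"
    and N_top: "N (int Q) = int k"
begin

definition rectangles :: partition where
  "rectangles = (\<Sum>q<Q. replicate_mset (k + 1 - nat (N (int q))) (nat (N (int q))))"

text \<open>Minus the number of beads from \<open>base\<close> upwards: level \<open>q < Q\<close>
  holds \<open>k + 1 - N q\<close> of them and level \<open>Q\<close> holds one. This is the
  normalisation demanded by \<open>exists_partition_beads\<close>.\<close>

definition base :: int where
  "base = - int (1 + (\<Sum>q<Q. k + 1 - nat (N (int q))))"

definition pos :: "int \<Rightarrow> int \<Rightarrow> int" where
  "pos q j = base + (int k + 1) * q + j"

definition level_set :: "(int \<Rightarrow> int) \<Rightarrow> int set" where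
  "level_set d = {x. (x - base) div (int k + 1) \<le> int Q \<and>
     ((x - base) mod (int k + 1) = d ((x - base) div (int k + 1)) \<or>
      N ((x - base) div (int k + 1)) < (x - base) mod (int k + 1))}"

text \<open>The last alternative is closure under subtracting \<open>k + 1\<close>: the place one
  level below the moved bead must carry either the moved bead of that level or one of its fixed
  beads.\<close>

definition admissible :: "(int \<Rightarrow> int) \<Rightarrow> bool" where
  "admissible d \<longleftrightarrow> (\<forall>q \<le> int Q. 0 \<le> d q \<and> d q \<le> N q \<and> (d q = d (q - 1) \<or> N (q - 1) < d q))"

definition run :: "(int \<Rightarrow> int) \<Rightarrow> int set" where
  "run d = {x. (x - base) div (int k + 1) \<le> int Q \<and> 1 \<le> (x - base) mod (int k + 1) \<and>
     (x - base) mod (int k + 1) \<le> d ((x - base) div (int k + 1))}"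

lemma k_pos: "1 \<le> k"
  using N_pos[of "int Q"] N_top by simp

lemma N_nonneg: "0 \<le> N q"
  using N_neg[of q] N_pos[of q] by (cases "q < 0") auto

lemma pos_div_mod:
  assumes "0 \<le> j" "j \<le> int k"
  shows "(pos q j - base) div (int k + 1) = q" "(pos q j - base) mod (int k + 1) = j"
proof -
  have "pos q j - base = j + (int k + 1) * q" by (simp add: pos_def)
  moreover have "j div (int k + 1) = 0" "j mod (int k + 1) = j" using assms by auto
  ultimately show "(pos q j - base) div (int k + 1) = q" "(pos q j - base) mod (int k + 1) = j"
    by simp_all
qed

lemma pos_cases:
  obtains q j where "x = pos q j" "0 \<le> j" "j \<le> int k"
proof (rule that)
  show "x = pos ((x - base) div (int k + 1)) ((x - base) mod (int k + 1))"
    unfolding pos_def using mult_div_mod_eq[of "int k + 1" "x - base"] by linarith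
  show "0 \<le> (x - base) mod (int k + 1)" by simp
  show "(x - base) mod (int k + 1) \<le> int k"
    using pos_mod_bound[of "int k + 1" "x - base"] by linarith
qed

lemma pos_eq_iff:
  "0 \<le> j \<Longrightarrow> j \<le> int k \<Longrightarrow> 0 \<le> j' \<Longrightarrow> j' \<le> int k \<Longrightarrow> pos q j = pos q' j' \<longleftrightarrow> q = q' \<and> j = j'"
  by (metis pos_div_mod)

lemma pos_in_level_set:
  "0 \<le> j \<Longrightarrow> j \<le> int k \<Longrightarrow> pos q j \<in> level_set d \<longleftrightarrow> q \<le> int Q \<and> (j = d q \<or> N q < j)"
  by (simp add: level_set_def pos_div_mod)

lemma pos_in_run:
  "0 \<le> j \<Longrightarrow> j \<le> int k \<Longrightarrow> pos q j \<in> run d \<longleftrightarrow> q \<le> int Q \<and> 1 \<le> j \<and> j \<le> d q"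
  by (simp add: run_def pos_div_mod)

lemma pos_step: "pos q j - (int k + 1) = pos (q - 1) j"
  by (simp add: pos_def algebra_simps)

lemma pos_succ: "pos q j + 1 = (if j = int k then pos (q + 1) 0 else pos q (j + 1))"
  by (simp add: pos_def algebra_simps)

lemma pos_less_iff:
  assumes "0 \<le> j" "j \<le> int k" "0 \<le> j'" "j' \<le> int k"
  shows "pos q' j' < pos q j \<longleftrightarrow> q' < q \<or> (q' = q \<and> j' < j)"
proof (cases q q' rule: linorder_cases)
  case less
  then have "(int k + 1) * (q + 1) \<le> (int k + 1) * q'" by (intro mult_left_mono) auto
  then have "\<not> pos q' j' < pos q j" using assms unfolding pos_def by (simp add: algebra_simps)
  then show ?thesis using less by simp
next
  case greater
  then have "(int k + 1) * (q' + 1) \<le> (int k + 1) * q" by (intro mult_left_mono) auto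
  then have "pos q' j' < pos q j" using assms unfolding pos_def by (simp add: algebra_simps)
  then show ?thesis using greater by simp
qed (simp add: pos_def)

lemma pos_window_iff:
  assumes "0 \<le> j" "j \<le> int k" "0 \<le> j'" "j' \<le> int k"
  shows "pos q' j' \<in> {pos q j - int k..<pos q j} \<longleftrightarrow> (q' = q \<and> j' < j) \<or> (q' = q - 1 \<and> j < j')"
proof -
  have "pos q j - int k \<le> pos q' j' \<longleftrightarrow> pos (q - 1) j < pos q' j'"
    using pos_step[of q j] by linarith
  then show ?thesis using pos_less_iff assms by auto
qed

lemma admissible_bounds:
  assumes "admissible d" "q \<le> int Q"
  shows "0 \<le> d q" "d q \<le> N q" "d q \<le> int k" "d q = d (q - 1) \<or> N (q - 1) < d q"
  using assms N_le[of q] by (auto simp: admissible_def intro: order_trans)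

lemma admissible_mono: "admissible d \<Longrightarrow> q \<le> int Q \<Longrightarrow> d (q - 1) \<le> d q"
  using admissible_bounds(2)[of d "q - 1"] admissible_bounds(4)[of d q] by force

lemma pos_in_image:
  assumes "S \<subseteq> {0..int k}" "0 \<le> j" "j \<le> int k"
  shows "pos q' j \<in> pos q ` S \<longleftrightarrow> q' = q \<and> j \<in> S"
proof
  assume "pos q' j \<in> pos q ` S"
  then obtain i where i: "i \<in> S" "pos q' j = pos q i" by auto
  then have "0 \<le> i" "i \<le> int k" using assms(1) by auto
  then show "q' = q \<and> j \<in> S" using i pos_eq_iff[of j i q' q] assms by auto
qed auto

lemma card_pos_image: "card (pos q ` S) = card S"
  by (rule card_image) (auto simp: inj_on_def pos_def)

text \<open>The window sees places below \<open>d q\<close> on level \<open>q\<close>, all gaps, and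
  places above \<open>d q\<close> on level \<open>q - 1\<close>, where the gaps reach up to
  \<open>N (q - 1)\<close>. The moved bead of level \<open>q - 1\<close> is not among the latter:
  either it sits at \<open>d q\<close>, just outside the window, or \<open>d q\<close> already
  exceeds \<open>N (q - 1)\<close>.\<close>

lemma window_gaps_top:
  assumes "admissible d" "q \<le> int Q"
  shows "int (window_gaps k (level_set d) (pos q (d q))) = max (d q) (N (q - 1))"
proof -
  note d = admissible_bounds[OF assms]
  have d': "0 \<le> d (q - 1)" "d (q - 1) \<le> N (q - 1)" using admissible_bounds[OF assms(1), of "q - 1"] assms(2) by auto
  have N: "N (q - 1) \<le> int k" by (rule N_le)
  let ?A = "{0..<d q}" and ?B = "{d q<..N (q - 1)}"
  have "{pos q (d q) - int k..<pos q (d q)} - level_set d = pos q ` ?A \<union> pos (q - 1) ` ?B" (is "?L = ?R")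
  proof (rule set_eqI)
    fix x
    obtain q' j where x: "x = pos q' j" and j: "0 \<le> j" "j \<le> int k" by (rule pos_cases)
    have A: "x \<in> pos q ` ?A \<longleftrightarrow> q' = q \<and> j \<in> ?A" unfolding x using d j by (intro pos_in_image) auto
    have B: "x \<in> pos (q - 1) ` ?B \<longleftrightarrow> q' = q - 1 \<and> j \<in> ?B" unfolding x using d j N by (intro pos_in_image) auto
    show "x \<in> ?L \<longleftrightarrow> x \<in> ?R"
      unfolding Un_iff A B unfolding x Diff_iff pos_window_iff[OF d(1,3) j] pos_in_level_set[OF j]
      using d d' j assms(2) by auto
  qed
  moreover have "pos q ` ?A \<inter> pos (q - 1) ` ?B = {}"
  proof safe
    fix a b assume "pos q a = pos (q - 1) b" "a \<in> ?A" "b \<in> ?B"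
    then show "pos q a \<in> {}" using pos_eq_iff[of a b q "q - 1"] d N by auto
  qed
  ultimately have "window_gaps k (level_set d) (pos q (d q)) = card ?A + card ?B"
    unfolding window_gaps_def by (simp add: card_Un_disjoint card_pos_image)
  then show ?thesis using d by simp
qed

text \<open>On the previous level only places above \<open>j\<close> are seen, and these are beads
  because \<open>N\<close> is monotone. On level \<open>q\<close> the places from 0 to
  \<open>N q\<close> hold a single bead, the moved one, wherever it stands.\<close>

lemma window_gaps_rest:
  assumes "admissible d" "q \<le> int Q" "N q < j" "j \<le> int k"
  shows "int (window_gaps k (level_set d) (pos q j)) = N q"
proof -
  note d = admissible_bounds[OF assms(1,2)]
  have N: "0 \<le> N q" "N (q - 1) \<le> N q" by (auto intro: N_nonneg N_mono)
  let ?A = "{0..N q} - {d q}"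
  have "{pos q j - int k..<pos q j} - level_set d = pos q ` ?A" (is "?L = ?R")
  proof (rule set_eqI)
    fix x
    obtain q' i where x: "x = pos q' i" and i: "0 \<le> i" "i \<le> int k" by (rule pos_cases)
    have A: "x \<in> ?R \<longleftrightarrow> q' = q \<and> i \<in> ?A" unfolding x using assms i by (intro pos_in_image) auto
    have j: "0 \<le> j" using assms(3) N by simp
    show "x \<in> ?L \<longleftrightarrow> x \<in> ?R"
      unfolding A unfolding x Diff_iff pos_window_iff[OF j assms(4) i] pos_in_level_set[OF i]
      using d assms N i by auto
  qed
  then have "window_gaps k (level_set d) (pos q j) = card ?A"
    unfolding window_gaps_def by (simp add: card_pos_image)
  also have "\<dots> = card {0..N q} - 1" using d by (subst card_Diff_singleton) auto
  finally show ?thesis using N by simp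
qed

lemma level_set_closed:
  assumes "admissible d" "b \<in> level_set d"
  shows "b - int (Suc k) \<in> level_set d"
proof -
  obtain q j where b: "b = pos q j" and j: "0 \<le> j" "j \<le> int k" by (rule pos_cases)
  have q: "q \<le> int Q" "j = d q \<or> N q < j" using assms(2) j by (auto simp: b pos_in_level_set)
  have "N (q - 1) \<le> N q" by (rule N_mono) simp
  then have "pos (q - 1) j \<in> level_set d"
    using q j admissible_bounds(4)[OF assms(1) q(1)] by (auto simp: pos_in_level_set)
  moreover have "b - int (Suc k) = pos (q - 1) j" unfolding b pos_step[symmetric] by simp
  ultimately show ?thesis by simp
qed

definition level :: "(int \<Rightarrow> int) \<Rightarrow> int \<Rightarrow> int set" where
  "level d q = insert (pos q (d q)) (pos q ` {N q<..int k})"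

lemma finite_level: "finite (level d q)" by (simp add: level_def)

lemma in_level_iff:
  assumes "admissible d" "q \<le> int Q" "0 \<le> j" "j \<le> int k"
  shows "pos q' j \<in> level d q \<longleftrightarrow> q' = q \<and> pos q' j \<in> level_set d"
proof -
  have *: "pos q' j \<in> pos q ` {N q<..int k} \<longleftrightarrow> q' = q \<and> j \<in> {N q<..int k}"
    using N_nonneg[of q] assms by (intro pos_in_image) auto
  show ?thesis
    unfolding level_def insert_iff * pos_in_level_set[OF assms(3,4)]
    using pos_eq_iff[of j "d q" q' q] admissible_bounds[OF assms(1,2)] assms by auto
qed

lemma levels_disjoint:
  assumes "admissible d" "q \<le> int Q" "q' \<le> int Q" "q \<noteq> q'"
  shows "level d q \<inter> level d q' = {}"
proof safe
  fix x assume x: "x \<in> level d q" "x \<in> level d q'"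
  obtain p j where "x = pos p j" "0 \<le> j" "j \<le> int k" by (rule pos_cases)
  then show "x \<in> {}" using x in_level_iff assms by metis
qed

definition levels :: "(int \<Rightarrow> int) \<Rightarrow> int set" where
  "levels d = (\<Union>q\<le>Q. level d (int q))"

lemma in_levels_iff:
  assumes "admissible d"
  shows "x \<in> levels d \<longleftrightarrow> x \<in> level_set d \<and> base \<le> x"
proof -
  obtain q j where x: "x = pos q j" and j: "0 \<le> j" "j \<le> int k" by (rule pos_cases)
  have "base = pos 0 0" by (simp add: pos_def)
  then have "base \<le> x \<longleftrightarrow> 0 \<le> q"
    using pos_less_iff[of 0 j q 0] j unfolding x by (auto simp: not_less[symmetric])
  moreover have "x \<in> levels d \<longleftrightarrow> (\<exists>p\<le>Q. q = int p \<and> x \<in> level_set d)"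
    unfolding levels_def x using in_level_iff[OF assms _ j] by auto
  moreover have "q \<le> int Q" if "x \<in> level_set d" using that j by (simp add: x pos_in_level_set)
  ultimately show ?thesis by (metis nonneg_int_cases of_nat_0_le_iff of_nat_le_iff)
qed

lemma below_base:
  assumes "admissible d" "x < base"
  shows "x \<in> level_set d"
proof -
  obtain q j where x: "x = pos q j" and j: "0 \<le> j" "j \<le> int k" by (rule pos_cases)
  have "base = pos 0 0" by (simp add: pos_def)
  then have "q < 0" using assms(2) pos_less_iff[of 0 j q 0] j by (simp add: x)
  then show ?thesis
    using j N_neg admissible_bounds[OF assms(1), of q] by (auto simp: x pos_in_level_set)
qed

text \<open>When \<open>d\<close> is 0 the moved bead contributes \<open>N (q - 1)\<close>, the one
  row that the fixed beads of level \<open>q - 1\<close> lack to complete their rectangle.\<close>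

lemma level_multiset:
  assumes "admissible d" "q \<le> int Q"
  shows "image_mset (window_gaps k (level_set d)) (mset_set (level d q)) =
    add_mset (nat (max (d q) (N (q - 1)))) (replicate_mset (k - nat (N q)) (nat (N q)))"
proof -
  let ?W = "window_gaps k (level_set d)"
  note d = admissible_bounds[OF assms]
  have N: "0 \<le> N q" by (rule N_nonneg)
  have "pos q (d q) \<notin> pos q ` {N q<..int k}"
    using d N by (subst pos_in_image) auto
  then have "mset_set (level d q) = add_mset (pos q (d q)) (mset_set (pos q ` {N q<..int k}))"
    by (simp add: level_def)
  moreover have "?W (pos q (d q)) = nat (max (d q) (N (q - 1)))"
    using window_gaps_top[OF assms] by simp
  moreover have "image_mset ?W (mset_set (pos q ` {N q<..int k})) =
      image_mset (\<lambda>_. nat (N q)) (mset_set (pos q ` {N q<..int k}))"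
  proof (rule image_mset_cong)
    fix x assume "x \<in># mset_set (pos q ` {N q<..int k})"
    then obtain j where "x = pos q j" "N q < j" "j \<le> int k" by auto
    then show "?W x = nat (N q)" using window_gaps_rest[OF assms, of j] by simp
  qed
  moreover have "card (pos q ` {N q<..int k}) = k - nat (N q)"
    using N by (simp add: card_pos_image nat_diff_distrib)
  ultimately show ?thesis by (simp add: image_mset_const_eq)
qed

lemma levels_mset_set:
  assumes "admissible d"
  shows "mset_set (levels d) = (\<Sum>q\<le>Q. mset_set (level d (int q)))"
proof -
  have "mset_set (\<Union>q\<le>m. level d (int q)) = (\<Sum>q\<le>m. mset_set (level d (int q)))" if "m \<le> Q" for m
    using that
  proof (induction m)
    case (Suc m)
    have "level d (int q) \<inter> level d (int (Suc m)) = {}" if "q \<le> m" for q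
      using that Suc.prems by (intro levels_disjoint[OF assms]) auto
    then have "(\<Union>q\<le>m. level d (int q)) \<inter> level d (int (Suc m)) = {}" by blast
    then show ?case
      using Suc by (simp add: atMost_Suc Un_commute[of "level d _"] mset_set_Union finite_level add.commute)
  qed simp
  then show ?thesis by (simp add: levels_def)
qed

lemma card_levels:
  assumes "admissible d"
  shows "base = - int (card (levels d))"
proof -
  have "card (levels d) = size (mset_set (levels d))" by simp
  also have "\<dots> = (\<Sum>q\<le>Q. size (image_mset (window_gaps k (level_set d)) (mset_set (level d (int q)))))"
    by (simp add: levels_mset_set[OF assms] size_multiset_sum)
  also have "\<dots> = (\<Sum>q\<le>Q. 1 + (k - nat (N (int q))))"
    by (rule sum.cong) (auto simp: level_multiset[OF assms] simp del: size_image_mset)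
  also have "\<dots> = (\<Sum>q<Q. 1 + (k - nat (N (int q)))) + 1"
    by (simp add: lessThan_Suc_atMost[symmetric] N_top)
  also have "(\<Sum>q<Q. 1 + (k - nat (N (int q)))) = (\<Sum>q<Q. k + 1 - nat (N (int q)))"
    using N_le by (intro sum.cong) (auto simp: Suc_diff_le nat_le_iff)
  finally show ?thesis by (simp add: base_def)
qed

lemma exists_core_level_set:
  assumes "admissible d"
  shows "\<exists>kap. is_core (Suc k) kap \<and> beads kap = level_set d"
proof -
  have "finite (levels d)" by (simp add: levels_def finite_level)
  moreover have "\<forall>x \<in> levels d. - int (card (levels d)) \<le> x"
    using in_levels_iff[OF assms] card_levels[OF assms] by auto
  ultimately obtain kap where kap: "is_partition kap" "beads kap = {..< - int (card (levels d))} \<union> levels d"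
    using exists_partition_beads by blast
  then have "beads kap = level_set d"
    unfolding card_levels[OF assms, symmetric] using in_levels_iff[OF assms] below_base[OF assms] by force
  moreover from this have "is_core (Suc k) kap"
    using level_set_closed[OF assms] by (subst is_core_iff[OF kap(1)]) auto
  ultimately show ?thesis by blast
qed

lemma core_to_bounded_level_set:
  assumes "admissible d" "beads kap = level_set d"
  shows "core_to_bounded k kap = filter_mset (\<lambda>x. 0 < x)
    (\<Sum>q\<le>Q. add_mset (nat (max (d (int q)) (N (int q - 1)))) (replicate_mset (k - nat (N (int q))) (nat (N (int q)))))"
proof -
  have "core_to_bounded k kap = filter_mset (\<lambda>x. 0 < x) (image_mset (window_gaps k (beads kap)) (mset_set (levels d)))"
  proof (rule core_to_bounded_beads)
    show "finite (levels d)" by (simp add: levels_def finite_level)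
    show "levels d \<subseteq> beads kap" using in_levels_iff[OF assms(1)] assms(2) by auto
    fix b assume b: "b \<in> beads kap" "0 < window_gaps k (beads kap) b"
    show "b \<in> levels d"
    proof (rule ccontr)
      assume "b \<notin> levels d"
      then have "b < base" using b(1) in_levels_iff[OF assms(1)] assms(2) by force
      then have "{b - int k..<b} \<subseteq> level_set d" using below_base[OF assms(1)] by auto
      then have "{b - int k..<b} - beads kap = {}" using assms(2) by auto
      then have "window_gaps k (beads kap) b = 0" unfolding window_gaps_def by (simp only: card.empty)
      then show False using b(2) by simp
    qed
  qed
  also have "image_mset (window_gaps k (beads kap)) (mset_set (levels d)) =
      (\<Sum>q\<le>Q. image_mset (window_gaps k (level_set d)) (mset_set (level d (int q))))"
    unfolding assms(2) levels_mset_set[OF assms(1)] by (rule image_mset_sum)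
  also have "\<dots> = (\<Sum>q\<le>Q. add_mset (nat (max (d (int q)) (N (int q - 1)))) (replicate_mset (k - nat (N (int q))) (nat (N (int q)))))"
    by (rule sum.cong) (auto simp: level_multiset[OF assms(1)])
  finally show ?thesis .
qed

definition cut :: "nat \<Rightarrow> int \<Rightarrow> int" where
  "cut s q = min (int s) (N q)"

lemma admissible_cut: "admissible (cut s)"
  unfolding admissible_def
proof (intro allI impI conjI)
  fix q
  show "0 \<le> cut s q" "cut s q \<le> N q" using N_nonneg[of q] by (auto simp: cut_def)
  show "cut s q = cut s (q - 1) \<or> N (q - 1) < cut s q"
    using N_mono[of "q - 1" q] by (auto simp: cut_def min_def)
qed

text \<open>Each summand is the median of \<open>s\<close>, \<open>N (q - 1)\<close> and
  \<open>N q\<close>; the sum inserts \<open>s\<close> into the increasing sequence of widths. The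
  induction carries the leftover \<open>cut s m\<close>, which is exchanged with \<open>N m\<close>
  when the next level is added.\<close>

lemma median_sum:
  "(\<Sum>q\<le>m. {#nat (max (cut s (int q)) (N (int q - 1)))#}) =
    add_mset (nat (cut s (int m))) (\<Sum>q<m. {#nat (N (int q))#})"
proof (induction m)
  case 0
  then show ?case using N_neg[of "-1"] N_nonneg[of 0] by (simp add: cut_def)
next
  case (Suc m)
  have N: "N (int m) \<le> N (int (Suc m))" by (rule N_mono) simp
  have "{#nat (cut s (int m)), nat (max (cut s (int (Suc m))) (N (int m)))#} = {#nat (cut s (int (Suc m))), nat (N (int m))#}"
    using N by (auto simp: cut_def min_def max_def)
  then show ?case using Suc by simp
qed

text \<open>The leftover of \<open>median_sum\<close> at level \<open>Q\<close> is \<open>s\<close>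
  itself, since \<open>N Q = k\<close>; the other widths complete the rectangles. The filter covers
  \<open>s = 0\<close>, where no part is added.\<close>

lemma core_to_bounded_cut:
  assumes "s \<le> k" "beads kap = level_set (cut s)"
  shows "core_to_bounded k kap = rectangles + filter_mset (\<lambda>x. 0 < x) {#s#}"
proof -
  let ?r = "\<lambda>q. replicate_mset (k - nat (N (int q))) (nat (N (int q)))"
  have "(\<Sum>q\<le>Q. add_mset (nat (max (cut s (int q)) (N (int q - 1)))) (?r q)) =
      (\<Sum>q\<le>Q. {#nat (max (cut s (int q)) (N (int q - 1)))#}) + (\<Sum>q\<le>Q. ?r q)"
    by (simp flip: sum.distrib)
  also have "(\<Sum>q\<le>Q. ?r q) = (\<Sum>q<Q. ?r q)"
    by (simp add: lessThan_Suc_atMost[symmetric] N_top)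
  also have "nat (cut s (int Q)) = s" using assms(1) by (simp add: cut_def N_top)
  then have "(\<Sum>q\<le>Q. {#nat (max (cut s (int q)) (N (int q - 1)))#}) = {#s#} + (\<Sum>q<Q. {#nat (N (int q))#})"
    using median_sum[of s Q] by simp
  also have "{#s#} + (\<Sum>q<Q. {#nat (N (int q))#}) + (\<Sum>q<Q. ?r q) = {#s#} + (\<Sum>q<Q. {#nat (N (int q))#} + ?r q)"
    by (simp only: sum.distrib add.assoc)
  also have "(\<Sum>q<Q. {#nat (N (int q))#} + ?r q) = rectangles"
    unfolding rectangles_def
  proof (rule sum.cong)
    fix q
    have "k + 1 - nat (N (int q)) = Suc (k - nat (N (int q)))" using N_le[of "int q"] by (simp add: Suc_diff_le nat_le_iff)
    then show "{#nat (N (int q))#} + ?r q = replicate_mset (k + 1 - nat (N (int q))) (nat (N (int q)))" by simp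
  qed simp
  finally have "core_to_bounded k kap = filter_mset (\<lambda>x. 0 < x) ({#s#} + rectangles)"
    unfolding core_to_bounded_level_set[OF admissible_cut assms(2)] by (rule arg_cong)
  moreover have "filter_mset (\<lambda>x. 0 < x) rectangles = rectangles"
  proof -
    have "0 < x" if x: "x \<in># rectangles" for x
    proof -
      obtain q :: nat where "x = nat (N (int q))" using x by (auto simp: rectangles_def set_mset_sum in_replicate_mset split: if_splits)
      then show ?thesis using N_pos[of "int q"] by simp
    qed
    then show ?thesis by (simp add: filter_mset_eq_conv)
  qed
  ultimately show ?thesis by (simp add: add.commute)
qed

end

subsection \<open>Weak strips over unions of rectangles\<close>

lemma mod_eq_imp_eq:
  fixes i j n :: int
  assumes "i mod n = j mod n" "\<bar>i - j\<bar> < n"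
  shows "i = j"
proof -
  have "n dvd \<bar>i - j\<bar>" using assms(1) by (simp add: mod_eq_dvd_iff)
  then have "\<not> 0 < \<bar>i - j\<bar>" using zdvd_not_zless assms(2) by blast
  then show ?thesis by simp
qed

lemma sum_mset_sum: "sum_mset (\<Sum>i\<in>A. M i) = (\<Sum>i\<in>A. sum_mset (M i))"
  by (induction A rule: infinite_finite_induct) auto

context rectangle_levels
begin

abbreviation flat :: "int \<Rightarrow> int" where "flat \<equiv> \<lambda>_. 0"

lemma admissible_flat: "admissible flat"
  by (simp add: admissible_def N_nonneg)

lemma cut_0: "cut 0 = flat"
  using N_nonneg by (auto simp: cut_def min_def fun_eq_iff)

lemma run_rec:
  assumes "admissible d"
  shows "(if x \<in> run d then 1 else 0) + (if x \<in> level_set flat then 1 else 0) =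
    (if x + 1 \<in> run d then 1 else 0) + (if x \<in> level_set d then 1 else (0::nat))"
proof -
  obtain q j where x: "x = pos q j" and j: "0 \<le> j" "j \<le> int k" by (rule pos_cases)
  have succ: "x + 1 \<in> run d \<longleftrightarrow> q \<le> int Q \<and> j + 1 \<le> d q"
  proof (cases "j = int k")
    case True
    then have "x + 1 \<notin> run d" using pos_in_run[of 0 "q + 1" d] by (simp add: x pos_succ)
    then show ?thesis using admissible_bounds(3)[OF assms, of q] True by auto
  next
    case False
    then show ?thesis using j pos_in_run[of "j + 1" q d] by (simp add: x pos_succ)
  qed
  show ?thesis
    unfolding succ unfolding x pos_in_run[OF j] pos_in_level_set[OF j]
    using j N_nonneg[of q] admissible_bounds[OF assms, of q] by auto
qed

lemma run_disjoint:
  assumes "admissible d"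
  shows "run d \<inter> level_set flat = {}"
proof safe
  fix x assume x: "x \<in> run d" "x \<in> level_set flat"
  obtain q j where "x = pos q j" "0 \<le> j" "j \<le> int k" by (rule pos_cases)
  then show "x \<in> {}"
    using x admissible_bounds(2)[OF assms, of q] by (auto simp: pos_in_run pos_in_level_set)
qed

lemma run_bounded: "\<exists>M. \<forall>x \<ge> M. x \<notin> run d"
proof (intro exI allI impI)
  fix x assume x: "pos (int Q + 1) 0 \<le> x"
  obtain q j where "x = pos q j" "0 \<le> j" "j \<le> int k" by (rule pos_cases)
  then show "x \<notin> run d"
    using x pos_less_iff[of 0 j q "int Q + 1"] by (auto simp: pos_in_run not_less[symmetric])
qed

text \<open>Far to the right all three terms vanish. From there downwards both sides change in the
  same way, by \<open>bead_count_rec\<close> and \<open>run_rec\<close>.\<close>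

lemma bead_count_level_set:
  assumes "admissible d" "beads kap = level_set d" "beads tau = level_set flat"
  shows "bead_count kap x = bead_count tau x + (if x \<in> run d then 1 else 0)"
proof -
  obtain M where M: "\<forall>x \<ge> M. x \<notin> run d" using run_bounded by blast
  define M' where "M' = max M (max (int (part kap 1)) (int (part tau 1)))"
  show ?thesis
  proof (cases "x \<le> M'")
    case True
    then show ?thesis
    proof (induction x rule: int_le_induct)
      case base
      show ?case using M by (simp add: M'_def bead_count_eq_0)
    next
      case (step i)
      show ?case
        using bead_count_rec[of kap "i - 1"] bead_count_rec[of tau "i - 1"] step
          run_rec[OF assms(1), of "i - 1"] assms(2,3) by (auto split: if_splits)
    qed
  next
    case False
    then show ?thesis using M by (simp add: M'_def bead_count_eq_0)
  qed
qed

lemma strip_level_set: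
  assumes "admissible d" "beads kap = level_set d" "beads tau = level_set flat"
  shows "horizontal_strip kap tau" "strip_contents kap tau = run d"
  using horizontal_stripI[of kap tau "run d"] bead_count_level_set[OF assms] run_disjoint[OF assms(1)] assms(3)
  by auto

lemma admissible_mono_top:
  assumes "admissible d" "q \<le> int Q"
  shows "d q \<le> d (int Q)"
proof -
  have "d (int Q - int m) \<le> d (int Q)" for m
  proof (induction m)
    case (Suc m)
    have "d (int Q - int m - 1) \<le> d (int Q - int m)" by (rule admissible_mono[OF assms(1)]) simp
    then show ?case using Suc by (simp add: algebra_simps)
  qed simp
  from this[of "nat (int Q - q)"] show ?thesis using assms(2) by simp
qed

lemma inj_on_residue: "inj_on (\<lambda>j. (c + j) mod (int k + 1)) {1..int k}"
proof (rule inj_onI)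
  fix i j assume ij: "i \<in> {1..int k}" "j \<in> {1..int k}" "(c + i) mod (int k + 1) = (c + j) mod (int k + 1)"
  from ij(3) have "c + i = c + j" by (rule mod_eq_imp_eq) (use ij(1,2) in auto)
  then show "i = j" by simp
qed

lemma pos_mod: "pos q j mod (int k + 1) = (base + j) mod (int k + 1)"
proof -
  have "pos q j = base + j + (int k + 1) * q" by (simp add: pos_def)
  then show ?thesis by (simp only: mod_mult_self2)
qed

text \<open>Place \<open>j\<close> has the same residue on every level, and \<open>d\<close> is
  largest on level \<open>Q\<close>, so only the run of that level has to be counted.\<close>

lemma card_residues_run:
  assumes "admissible d"
  shows "int (card ((\<lambda>x. x mod (int k + 1)) ` run d)) = d (int Q)"
proof -
  note dQ = admissible_bounds[OF assms, of "int Q"]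
  have "(\<lambda>x. x mod (int k + 1)) ` run d = (\<lambda>j. (base + j) mod (int k + 1)) ` {1..d (int Q)}"
  proof
    show "(\<lambda>x. x mod (int k + 1)) ` run d \<subseteq> (\<lambda>j. (base + j) mod (int k + 1)) ` {1..d (int Q)}"
    proof (rule image_subsetI)
      fix x assume x: "x \<in> run d"
      obtain q j where "x = pos q j" "0 \<le> j" "j \<le> int k" by (rule pos_cases)
      then show "x mod (int k + 1) \<in> (\<lambda>j. (base + j) mod (int k + 1)) ` {1..d (int Q)}"
        using x admissible_mono_top[OF assms, of q] by (auto simp: pos_in_run pos_mod)
    qed
    show "(\<lambda>j. (base + j) mod (int k + 1)) ` {1..d (int Q)} \<subseteq> (\<lambda>x. x mod (int k + 1)) ` run d"
    proof (rule image_subsetI)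
      fix j assume "j \<in> {1..d (int Q)}"
      then have "pos (int Q) j \<in> run d" using dQ by (simp add: pos_in_run)
      then show "(base + j) mod (int k + 1) \<in> (\<lambda>x. x mod (int k + 1)) ` run d"
        unfolding pos_mod[of "int Q", symmetric] by blast
    qed
  qed
  moreover have "inj_on (\<lambda>j. (base + j) mod (int k + 1)) {1..d (int Q)}"
    by (rule inj_on_subset[OF inj_on_residue]) (use dQ in auto)
  ultimately show ?thesis using dQ by (simp add: card_image)
qed

lemma weak_strip_cut:
  assumes "s \<le> k" "is_core (Suc k) kap" "beads kap = level_set (cut s)"
    and "is_core (Suc k) tau" "beads tau = level_set flat"
  shows "weak_strip k s kap tau"
proof -
  have "core_size (Suc k) kap = core_size (Suc k) tau + s"
    using core_to_bounded_cut[OF assms(1,3)] core_to_bounded_cut[of 0 tau] assms(5)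
    by (simp add: core_size_eq cut_0)
  moreover have "card (residue k ` (diagram kap - diagram tau)) = s"
    using card_residues_run[OF admissible_cut, of s] assms(1)
    by (simp add: residues_diff strip_level_set(2)[OF admissible_cut assms(3,5)] cut_def N_top)
  ultimately show ?thesis
    using assms strip_level_set(1)[OF admissible_cut assms(3,5)] by (simp add: weak_strip_def)
qed

lemma card_residues_interval:
  "card ((\<lambda>x. x mod (int k + 1)) ` {y + 1..y + int k + 1}) = k + 1"
proof -
  have "inj_on (\<lambda>x. x mod (int k + 1)) {y + 1..y + int k + 1}"
  proof (rule inj_onI)
    fix i j assume ij: "i \<in> {y + 1..y + int k + 1}" "j \<in> {y + 1..y + int k + 1}" "i mod (int k + 1) = j mod (int k + 1)"
    from ij(3) show "i = j" by (rule mod_eq_imp_eq) (use ij(1,2) in auto)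
  qed
  then show ?thesis by (simp add: card_image nat_add_distrib)
qed

text \<open>A bead at a place other than 0 lies above \<open>N q\<close>, so the next integer is
  again a bead: a fixed one of the same level, or the bead 0 of the next. Level \<open>Q\<close> has
  no such bead.\<close>

lemma addable_pos:
  assumes "y \<in> level_set flat" "y + 1 \<notin> level_set flat"
  obtains q where "y = pos q 0"
proof -
  obtain q j where y: "y = pos q j" and j: "0 \<le> j" "j \<le> int k" by (rule pos_cases)
  have q: "q \<le> int Q" "j = 0 \<or> N q < j" using assms(1) j by (auto simp: y pos_in_level_set)
  have "j = 0"
  proof (rule ccontr)
    assume "j \<noteq> 0"
    then have Nj: "N q < j" using q by simp
    show False
    proof (cases "j = int k")
      case True
      then have "q < int Q" using q(1) Nj N_top by (cases "q = int Q") auto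
      then show False using assms(2) True by (simp add: y pos_succ pos_in_level_set)
    next
      case False
      then show False using assms(2) q Nj j by (simp add: y pos_succ pos_in_level_set)
    qed
  qed
  then show thesis using that y by blast
qed

text \<open>Going down from such a content through consecutive strip contents, the descent stops at
  a bead of \<open>tau\<close> without a bead directly above it, hence at place 0 of a lower level.
  The strip then contains \<open>k + 1\<close> consecutive contents, too many residues.\<close>

lemma strip_avoids_base_residue:
  assumes "horizontal_strip kap tau" "beads tau = level_set flat"
    and "card (residue k ` (diagram kap - diagram tau)) \<le> k"
  shows "pos q 0 \<notin> strip_contents kap tau"
proof
  let ?D = "strip_contents kap tau"
  assume D: "pos q 0 \<in> ?D"
  define S where "S = {m :: nat. pos q 0 - int m \<notin> ?D}"
  \<comment> \<open>Far enough down every place is a bead of \<open>tau\<close>, and strip contents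
    avoid beads, so the descent ends.\<close>
  have "\<exists>m. m \<in> S"
  proof
    let ?m = "nat (pos q 0 - (- int (size tau) - 1)) + nat (- pos q 0)"
    have "pos q 0 - int ?m < - int (size tau)" by auto
    then have "pos q 0 - int ?m \<in> beads tau" by (rule beads_below)
    then have "pos q 0 - int ?m \<notin> ?D" using horizontal_strip_counts(2)[OF assms(1)] by blast
    then show "?m \<in> S" unfolding S_def by (rule CollectI)
  qed
  then have "(LEAST m. m \<in> S) \<in> S" by (metis LeastI)
  moreover define m where "m = (LEAST m. m \<in> S)"
  ultimately have m: "pos q 0 - int m \<notin> ?D" by (simp add: S_def)
  have before: "pos q 0 - int i \<in> ?D" if "i < m" for i
    using not_less_Least[of i "\<lambda>m. m \<in> S"] that by (auto simp: m_def S_def)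
  have "m \<noteq> 0" using m D by (cases m) auto
  define y where "y = pos q 0 - int m"
  have "pos q 0 - int (m - 1) \<in> ?D" using before[of "m - 1"] \<open>m \<noteq> 0\<close> by simp
  then have y1: "y + 1 \<in> ?D" using \<open>m \<noteq> 0\<close> by (simp add: y_def of_nat_diff algebra_simps)
  then have "y \<in> beads tau" using strip_contents_rec[OF assms(1), of y] m by (auto simp: y_def split: if_splits)
  moreover have "y + 1 \<notin> beads tau" using y1 horizontal_strip_counts(2)[OF assms(1)] by auto
  ultimately obtain p where p: "y = pos p 0" using addable_pos assms(2) by metis
  have "y < pos q 0" using \<open>m \<noteq> 0\<close> by (simp add: y_def)
  then have "p < q" using pos_less_iff[of 0 0 p q] by (simp add: p)
  then have "(int k + 1) * (p + 1) \<le> (int k + 1) * q" by (intro mult_left_mono) auto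
  then have far: "y + int k + 1 \<le> pos q 0" unfolding p pos_def by (simp add: algebra_simps)
  have "{y + 1..y + int k + 1} \<subseteq> ?D"
  proof
    fix z assume "z \<in> {y + 1..y + int k + 1}"
    then have "z = pos q 0 - int (nat (pos q 0 - z))" "nat (pos q 0 - z) < m"
      using far by (auto simp: y_def)
    then show "z \<in> ?D" using before by metis
  qed
  then have "card ((\<lambda>x. x mod (int k + 1)) ` {y + 1..y + int k + 1}) \<le> card ((\<lambda>x. x mod (int k + 1)) ` ?D)"
  proof (intro card_mono image_mono)
    show "finite ((\<lambda>x. x mod (int k + 1)) ` ?D)"
    proof (rule finite_subset[of _ "{0..<int k + 1}"], rule image_subsetI)
      fix x :: int
      have "x mod (int k + 1) < int k + 1" by (rule pos_mod_bound) simp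
      then show "x mod (int k + 1) \<in> {0..<int k + 1}" by simp
    qed simp
  qed
  then show False using assms(3) by (simp add: card_residues_interval residues_diff)
qed

text \<open>With place 0 excluded, the strip decomposes by levels, and on each level it is an
  initial segment of the places from 1. Avoiding the beads of \<open>tau\<close> bounds its length
  by \<open>N q\<close>, and \<open>kap\<close> being a core gives the remaining condition of
  admissibility.\<close>

lemma strip_over_flat:
  assumes "horizontal_strip kap tau" "beads tau = level_set flat" "is_core (Suc k) kap"
    and "card (residue k ` (diagram kap - diagram tau)) \<le> k"
  obtains d where "admissible d" "beads kap = level_set d" "strip_contents kap tau = run d"
proof -
  let ?D = "strip_contents kap tau"
  note pos0 = strip_avoids_base_residue[OF assms(1,2,4)]
  define S where "S q = {j :: nat. 1 \<le> j \<and> j \<le> k \<and> pos q (int j) \<in> ?D}" for q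
  define d where "d q = int (card (S q))" for q
  have disj: "x \<notin> level_set flat" if "x \<in> ?D" for x
    using horizontal_strip_counts(2)[OF assms(1)] assms(2) that by auto
  note rec = strip_contents_rec[OF assms(1), unfolded assms(2)]
  \<comment> \<open>If \<open>j - 1\<close> were missing, the recursion would put a bead of
    \<open>tau\<close> there. Not being at place 0, it would lie above \<open>N q\<close>, so
    \<open>j\<close> would carry a bead of \<open>tau\<close> as well.\<close>
  have prev: "pos q (j - 1) \<in> ?D" if "pos q j \<in> ?D" "2 \<le> j" "j \<le> int k" for q j
  proof (rule ccontr)
    assume "pos q (j - 1) \<notin> ?D"
    then have "pos q (j - 1) \<in> level_set flat"
      using rec[of "pos q (j - 1)"] that by (auto simp: pos_succ split: if_splits)
    then have "pos q j \<in> level_set flat" using that by (simp add: pos_in_level_set)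
    then show False using disj that(1) by blast
  qed
  have S: "S q = {1..card (S q)}" for q
  proof (rule down_closed_eq)
    show "finite (S q)" by (rule finite_subset[of _ "{..k}"]) (auto simp: S_def)
    fix i j :: nat assume ij: "1 \<le> i" "i \<le> j" "j \<in> S q"
    from ij(2,1,3) show "i \<in> S q"
    proof (induction rule: inc_induct)
      case (step n)
      then have "Suc n \<in> S q" by simp
      then show ?case using prev[of q "int (Suc n)"] step by (auto simp: S_def)
    qed
  qed (auto simp: S_def)
  have D_iff: "pos q j \<in> ?D \<longleftrightarrow> 1 \<le> j \<and> j \<le> d q" if "0 \<le> j" "j \<le> int k" for q j
  proof (cases "j = 0")
    case True then show ?thesis using pos0 by simp
  next
    case False
    then have "pos q j \<in> ?D \<longleftrightarrow> nat j \<in> S q" using that by (auto simp: S_def nat_le_iff Suc_le_eq)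
    also have "\<dots> \<longleftrightarrow> nat j \<in> {1..card (S q)}" using S[of q] by simp
    finally show ?thesis using False that by (auto simp: d_def)
  qed
  have d_k: "0 \<le> d q" "d q \<le> int k" for q
  proof -
    have "card (S q) \<le> card {1..k}" by (rule card_mono) (auto simp: S_def)
    then show "0 \<le> d q" "d q \<le> int k" by (auto simp: d_def)
  qed
  have d_N: "d q \<le> N q" if "q \<le> int Q" for q
  proof (rule ccontr)
    assume "\<not> d q \<le> N q"
    then have "pos q (d q) \<in> level_set flat" "pos q (d q) \<in> ?D"
      using that d_k[of q] N_nonneg[of q] by (auto simp: pos_in_level_set D_iff)
    then show False using disj by blast
  qed
  \<comment> \<open>Above level \<open>Q\<close> there is no bead of \<open>tau\<close> that could
    start a run.\<close>
  have d_0: "d q = 0" if "int Q < q" for q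
  proof (rule ccontr)
    assume "d q \<noteq> 0"
    then have "pos q 1 \<in> ?D" using d_k[of q] k_pos by (simp add: D_iff)
    then have "pos q 0 \<in> level_set flat" using rec[of "pos q 0"] pos0[of q] k_pos by (auto simp: pos_succ split: if_splits)
    then show False using that by (simp add: pos_in_level_set)
  qed
  have beads: "beads kap = level_set d"
  proof (rule set_eqI)
    fix x
    obtain q j where x: "x = pos q j" and j: "0 \<le> j" "j \<le> int k" by (rule pos_cases)
    have succ: "x + 1 \<in> ?D \<longleftrightarrow> j < d q"
      using j D_iff[of "j + 1" q] pos0[of "q + 1"] d_k[of q] by (auto simp: x pos_succ)
    have "(if 1 \<le> j \<and> j \<le> d q then 1 else 0) + (if q \<le> int Q \<and> (j = 0 \<or> N q < j) then 1 else 0) =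
        (if j < d q then 1 else 0) + (if x \<in> beads kap then 1 else (0::nat))"
      using rec[of x] unfolding succ unfolding x D_iff[OF j] pos_in_level_set[OF j] .
    then show "x \<in> beads kap \<longleftrightarrow> x \<in> level_set d"
      unfolding x pos_in_level_set[OF j]
      using j d_N[of q] d_0[of q] d_k[of q] N_nonneg[of q] by (cases "q \<le> int Q") (auto split: if_splits)
  qed
  have "admissible d" unfolding admissible_def
  proof (intro allI impI conjI)
    fix q assume q: "q \<le> int Q"
    show "0 \<le> d q" "d q \<le> N q" using d_k d_N q by auto
    have "pos q (d q) \<in> beads kap" using q d_k by (simp add: beads pos_in_level_set)
    then have "pos q (d q) - int (Suc k) \<in> level_set d" using core_closed[OF assms(3)] beads by blast
    moreover have "pos q (d q) - int (Suc k) = pos (q - 1) (d q)" using pos_step[of q "d q"] by simp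
    ultimately show "d q = d (q - 1) \<or> N (q - 1) < d q" using d_k by (simp add: pos_in_level_set)
  qed
  moreover have "?D = run d"
  proof (rule set_eqI)
    fix x
    obtain q j where x: "x = pos q j" and j: "0 \<le> j" "j \<le> int k" by (rule pos_cases)
    show "x \<in> ?D \<longleftrightarrow> x \<in> run d"
      unfolding x D_iff[OF j] pos_in_run[OF j] using d_0[of q] by (cases "q \<le> int Q") auto
  qed
  ultimately show thesis using that beads by blast
qed

lemma core_size_level_set:
  assumes "admissible d" "beads kap = level_set d"
  shows "int (core_size (Suc k) kap) = (\<Sum>q\<le>Q. max (d (int q)) (N (int q - 1)) + int (k - nat (N (int q))) * N (int q))"
proof -
  have "int (core_size (Suc k) kap) = int (\<Sum>q\<le>Q. nat (max (d (int q)) (N (int q - 1))) + (k - nat (N (int q))) * nat (N (int q)))"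
    unfolding core_size_eq core_to_bounded_level_set[OF assms] sum_mset_filter_pos
    by (simp add: sum_mset_sum)
  also have "\<dots> = (\<Sum>q\<le>Q. max (d (int q)) (N (int q - 1)) + int (k - nat (N (int q))) * N (int q))"
    using N_nonneg by (simp add: max.coboundedI2)
  finally show ?thesis .
qed

text \<open>The strip size \<open>s\<close> is obtained twice. The residues give
  \<open>d Q = s\<close>, a telescoping sum of the steps \<open>d q - d (q - 1)\<close>; the core
  sizes give the sum of the excesses of \<open>d q\<close> over \<open>N (q - 1)\<close>, taken as 0
  when negative. By admissibility each excess is at most the corresponding step, so all agree:
  \<open>d\<close> increases at \<open>q\<close> only if level \<open>q - 1\<close> has used all its
  room.\<close>

lemma weak_strip_unique:
  assumes "s \<le> k" "weak_strip k s kap tau" "beads tau = level_set flat"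
  shows "beads kap = level_set (cut s)"
proof -
  have ws: "horizontal_strip kap tau" "is_core (Suc k) kap"
      "core_size (Suc k) kap = core_size (Suc k) tau + s"
      "card (residue k ` (diagram kap - diagram tau)) = s"
    using assms(2) by (auto simp: weak_strip_def)
  obtain d where d: "admissible d" "beads kap = level_set d" "strip_contents kap tau = run d"
    using strip_over_flat[OF ws(1) assms(3) ws(2)] ws(4) assms(1) by auto
  have top: "d (int Q) = int s"
    using card_residues_run[OF d(1)] ws(4) by (simp add: residues_diff d(3))
  note b = admissible_bounds[OF d(1)]
  let ?u = "\<lambda>q::nat. max (d (int q)) (N (int q - 1)) - N (int q - 1)"
  let ?v = "\<lambda>q::nat. d (int q) - d (int q - 1)"
  have "(\<Sum>q\<le>Q. ?u q) = int s"
    using core_size_level_set[OF d(1,2)] core_size_level_set[OF admissible_flat assms(3)] ws(3) N_nonneg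
    by (simp add: sum.distrib sum_subtractf max.absorb2)
  moreover have "(\<Sum>q\<le>m. ?v q) = d (int m) - d (- 1)" for m
    by (induction m) auto
  moreover have "d (- 1) = 0" using b[of "-1"] N_neg[of "-1"] by simp
  ultimately have sums: "(\<Sum>q\<le>Q. ?u q) = (\<Sum>q\<le>Q. ?v q)" using top by simp
  have le: "?u q \<le> ?v q" if "q \<in> {..Q}" for q
    using b[of "int q"] b(2)[of "int q - 1"] that by (auto simp: max_def)
  have jump: "d (int q) = d (int q - 1) \<or> d (int q - 1) = N (int q - 1)" if "q \<le> Q" for q
    using sum_mono_inv[OF sums le, of q] b(4)[of "int q"] that by (auto simp: max_def split: if_splits)
  \<comment> \<open>Descending from \<open>d Q = s\<close>, a level either inherits the value of the
    level above or is full; in the latter case \<open>d \<le> s\<close> shows that this is still the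
    minimum of \<open>s\<close> and \<open>N\<close>.\<close>
  have eq: "d (int Q - int m) = cut s (int Q - int m)" for m
  proof (induction m)
    case 0
    then show ?case using top assms(1) by (simp add: cut_def N_top)
  next
    case (Suc m)
    let ?q = "int Q - int m"
    have N: "N (?q - 1) \<le> N ?q" by (rule N_mono) simp
    have q1: "int Q - int (Suc m) = ?q - 1" by simp
    have dN: "0 \<le> d (?q - 1)" "d (?q - 1) \<le> N (?q - 1)" using b[of "?q - 1"] by auto
    show ?case
    proof (cases "?q < 0")
      case True
      then show ?thesis using dN N_neg[of "?q - 1"] unfolding q1 by (simp add: cut_def)
    next
      case False
      then have "d ?q = d (?q - 1) \<or> d (?q - 1) = N (?q - 1)" using jump[of "nat ?q"] by (simp add: nat_le_iff)
      moreover have "d (?q - 1) \<le> int s" using admissible_mono_top[OF d(1), of "?q - 1"] top by simp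
      ultimately show ?thesis using Suc N dN unfolding q1 by (auto simp: cut_def min_def split: if_splits)
    qed
  qed
  have "d q = cut s q" if "q \<le> int Q" for q
    using eq[of "nat (int Q - q)"] that by simp
  then have "level_set d = level_set (cut s)" by (auto simp: level_set_def)
  then show ?thesis using d(2) by simp
qed

text \<open>On levels from 0 on, the gaps of \<open>tau\<close> are the places 1 to
  \<open>N q\<close>, so the corner bead comes right after place \<open>N q\<close>; if
  \<open>N q = k\<close> it is the bead 0 of the next level, which is missing for
  \<open>q = Q\<close>. The strip content at \<open>N q\<close> is absent exactly when
  \<open>s < N q\<close>. Equal widths give equal residues, hence a set of widths is
  counted.\<close>

lemma corner_residues_cut:
  assumes "s \<le> k" "beads kap = level_set (cut s)" "beads tau = level_set flat"
  shows "corner_residues k kap tau = card {N (int q) | q. q < Q \<and> int s < N (int q)}"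
proof -
  let ?S = "{N (int q) | q. q < Q \<and> int s < N (int q)}"
  note strip = strip_level_set[OF admissible_cut assms(2,3)]
  have succ: "c + 1 \<in> level_set flat \<and> c \<notin> level_set flat \<and> c \<notin> run (cut s) \<longleftrightarrow>
      (\<exists>q::nat. q < Q \<and> int s < N (int q) \<and> c = pos (int q) (N (int q)))" for c
  proof -
    obtain q j where c: "c = pos q j" and j: "0 \<le> j" "j \<le> int k" by (rule pos_cases)
    have "c + 1 \<in> level_set flat \<longleftrightarrow> (if j = int k then q < int Q else q \<le> int Q \<and> N q \<le> j)"
      using j N_nonneg[of q] by (auto simp: c pos_succ pos_in_level_set)
    moreover have "c \<notin> level_set flat \<longleftrightarrow> int Q < q \<or> (j \<noteq> 0 \<and> j \<le> N q)"
      using j by (auto simp: c pos_in_level_set)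
    moreover have "c \<notin> run (cut s) \<longleftrightarrow> int Q < q \<or> j = 0 \<or> cut s q < j"
      using j by (auto simp: c pos_in_run)
    ultimately have *: "c + 1 \<in> level_set flat \<and> c \<notin> level_set flat \<and> c \<notin> run (cut s) \<longleftrightarrow>
        (if j = int k then q < int Q else q \<le> int Q \<and> N q \<le> j) \<and>
        (int Q < q \<or> (j \<noteq> 0 \<and> j \<le> N q)) \<and> (int Q < q \<or> j = 0 \<or> cut s q < j)" by blast
    have "c + 1 \<in> level_set flat \<and> c \<notin> level_set flat \<and> c \<notin> run (cut s) \<longleftrightarrow>
        0 \<le> q \<and> q < int Q \<and> int s < N q \<and> j = N q"
    proof (cases "0 \<le> q \<and> q \<le> int Q")
      case True
      then show ?thesis
        using * j N_le[of q] N_pos[of q] N_top by (cases "j = int k"; cases "q = int Q") (auto simp: cut_def min_def)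
    next
      case False
      then consider "q < 0" | "int Q < q" by linarith
      then show ?thesis
      proof cases
        case 1
        then show ?thesis unfolding * using j N_neg[of q] by auto
      next
        case 2
        then show ?thesis unfolding * by simp
      qed
    qed
    also have "\<dots> \<longleftrightarrow> (\<exists>p::nat. p < Q \<and> int s < N (int p) \<and> c = pos (int p) (N (int p)))"
    proof
      assume "0 \<le> q \<and> q < int Q \<and> int s < N q \<and> j = N q"
      then show "\<exists>p::nat. p < Q \<and> int s < N (int p) \<and> c = pos (int p) (N (int p))"
        unfolding c by (intro exI[of _ "nat q"]) auto
    next
      assume "\<exists>p::nat. p < Q \<and> int s < N (int p) \<and> c = pos (int p) (N (int p))"
      then obtain p :: nat where p: "p < Q" "int s < N (int p)" "pos q j = pos (int p) (N (int p))"
        unfolding c by blast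
      then have "q = int p \<and> j = N (int p)"
        using pos_eq_iff[OF j N_nonneg N_le] by blast
      then show "0 \<le> q \<and> q < int Q \<and> int s < N q \<and> j = N q" using p by auto
    qed
    finally show ?thesis .
  qed
  have "{b \<in> beads tau. b - 1 \<notin> beads tau \<and> b - 1 \<notin> strip_contents kap tau} =
      {pos (int q) (N (int q)) + 1 | q. q < Q \<and> int s < N (int q)}"
  proof (rule set_eqI)
    fix b
    show "b \<in> {b \<in> beads tau. b - 1 \<notin> beads tau \<and> b - 1 \<notin> strip_contents kap tau} \<longleftrightarrow>
        b \<in> {pos (int q) (N (int q)) + 1 | q. q < Q \<and> int s < N (int q)}"
      using succ[of "b - 1"] unfolding strip(2) assms(3) by (auto simp: algebra_simps)
  qed
  then have "(\<lambda>x. x mod (int k + 1)) ` {b \<in> beads tau. b - 1 \<notin> beads tau \<and> b - 1 \<notin> strip_contents kap tau} =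
      (\<lambda>q. (pos (int q) (N (int q)) + 1) mod (int k + 1)) ` {q. q < Q \<and> int s < N (int q)}"
    by (simp only: setcompr_eq_image image_image)
  also have "\<dots> = (\<lambda>q. (base + 1 + N (int q)) mod (int k + 1)) ` {q. q < Q \<and> int s < N (int q)}"
  proof (rule image_cong)
    fix q :: nat
    have "pos (int q) (N (int q)) + 1 = base + 1 + N (int q) + (int k + 1) * int q" by (simp add: pos_def)
    then show "(pos (int q) (N (int q)) + 1) mod (int k + 1) = (base + 1 + N (int q)) mod (int k + 1)"
      by (simp only: mod_mult_self2)
  qed simp
  also have "\<dots> = (\<lambda>j. (base + 1 + j) mod (int k + 1)) ` ?S"
    by (simp only: setcompr_eq_image image_image)
  finally have "corner_residues k kap tau = card ((\<lambda>j. (base + 1 + j) mod (int k + 1)) ` ?S)"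
    using corner_residues_eq[OF strip(1), of k] by simp
  also have "\<dots> = card ?S"
    by (rule card_image, rule inj_on_subset[OF inj_on_residue]) (use N_le in auto)
  finally show ?thesis .
qed

end

section \<open>The Pieri rule over a union of rectangles\<close>

context rectangle_levels
begin

lemma rectangles_cut_bounded: "s \<le> k \<Longrightarrow> rectangles + filter_mset (\<lambda>x. 0 < x) {#s#} \<in> bounded_partitions k"
  using exists_core_level_set[OF admissible_cut, of s] core_to_bounded_cut core_to_bounded_mem by metis

lemma bounded_to_core_cut:
  assumes "s \<le> k"
  shows "is_core (Suc k) (bounded_to_core k (rectangles + filter_mset (\<lambda>x. 0 < x) {#s#}))"
    and "beads (bounded_to_core k (rectangles + filter_mset (\<lambda>x. 0 < x) {#s#})) = level_set (cut s)"
proof -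
  obtain kap where kap: "is_core (Suc k) kap" "beads kap = level_set (cut s)"
    using exists_core_level_set[OF admissible_cut] by blast
  then have "bounded_to_core k (rectangles + filter_mset (\<lambda>x. 0 < x) {#s#}) = kap"
    using bounded_to_core_to_bounded[OF kap(1)] core_to_bounded_cut[OF assms kap(2)] by simp
  then show "is_core (Suc k) (bounded_to_core k (rectangles + filter_mset (\<lambda>x. 0 < x) {#s#}))"
    "beads (bounded_to_core k (rectangles + filter_mset (\<lambda>x. 0 < x) {#s#})) = level_set (cut s)"
    using kap by auto
qed

lemma beads_bounded_to_core_rectangles:
  "is_core (Suc k) (bounded_to_core k rectangles)" "beads (bounded_to_core k rectangles) = level_set flat"
  using bounded_to_core_cut[of 0] by (simp_all add: cut_0)

lemma weak_strips_over_rectangles: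
  assumes "s \<le> k"
  shows "{mu \<in> bounded_partitions k. weak_strip k s (bounded_to_core k mu) (bounded_to_core k rectangles)} =
    {rectangles + filter_mset (\<lambda>x. 0 < x) {#s#}}"
proof (intro equalityI subsetI)
  fix mu assume mu: "mu \<in> {mu \<in> bounded_partitions k. weak_strip k s (bounded_to_core k mu) (bounded_to_core k rectangles)}"
  then have "beads (bounded_to_core k mu) = level_set (cut s)"
    using weak_strip_unique[OF assms _ beads_bounded_to_core_rectangles(2)] by simp
  then show "mu \<in> {rectangles + filter_mset (\<lambda>x. 0 < x) {#s#}}"
    using core_to_bounded_cut[OF assms] core_to_bounded_to_core[of mu k] mu by auto
next
  fix mu assume "mu \<in> {rectangles + filter_mset (\<lambda>x. 0 < x) {#s#}}"
  then show "mu \<in> {mu \<in> bounded_partitions k. weak_strip k s (bounded_to_core k mu) (bounded_to_core k rectangles)}"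
    using rectangles_cut_bounded[OF assms] weak_strip_cut[OF assms bounded_to_core_cut[OF assms] beads_bounded_to_core_rectangles]
    by simp
qed

lemma corner_residues_rectangles:
  assumes "s \<le> k"
  shows "corner_residues k (bounded_to_core k (rectangles + filter_mset (\<lambda>x. 0 < x) {#s#})) (bounded_to_core k rectangles) =
    card {N (int q) | q. q < Q \<and> int s < N (int q)}"
  by (rule corner_residues_cut[OF assms bounded_to_core_cut(2)[OF assms] beads_bounded_to_core_rectangles(2)])

end

definition rectangle_union :: "nat \<Rightarrow> nat multiset \<Rightarrow> partition" where
  "rectangle_union k T = (\<Sum>x\<in>#T. k_rectangle k x)"

lemma rectangle_union_strips:
  assumes k: "1 \<le> k" and T: "\<forall>x \<in># T. 1 \<le> x \<and> x \<le> k" and s: "s \<le> k"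
  defines "P \<equiv> rectangle_union k T" and "Ps \<equiv> rectangle_union k T + filter_mset (\<lambda>x. 0 < x) {#s#}"
  shows "{mu \<in> bounded_partitions k. weak_strip k s (bounded_to_core k mu) (bounded_to_core k P)} = {Ps}"
    and "corner_residues k (bounded_to_core k Ps) (bounded_to_core k P) = card {x \<in> set_mset T. s < x}"
    and "Ps \<in> bounded_partitions k"
proof -
  define xs where "xs = sorted_list_of_multiset T"
  have xs: "mset xs = T" "sorted xs" "set xs = set_mset T" by (auto simp: xs_def)
  \<comment> \<open>The sorted widths, padded by 0 for the full levels below and by \<open>k\<close>
    from the top level on.\<close>
  define N where "N q = (if q < 0 then 0 else if q < int (length xs) then int (xs ! nat q) else int k)" for q :: int
  have nth: "1 \<le> xs ! i \<and> xs ! i \<le> k" if "i < length xs" for i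
    using nth_mem[OF that] T xs(3) by auto
  interpret rectangle_levels k "length xs" N
  proof
    fix q q' :: int assume "q \<le> q'"
    then show "N q \<le> N q'"
      using nth[of "nat q"] sorted_nth_mono[OF xs(2), of "nat q" "nat q'"] by (auto simp: N_def nat_less_iff)
  next
    fix q :: int
    show "N q = 0" if "q < 0" using that by (simp add: N_def)
    show "1 \<le> N q" if "0 \<le> q" using that nth[of "nat q"] k by (auto simp: N_def nat_less_iff)
    show "N q \<le> int k" using nth[of "nat q"] by (auto simp: N_def nat_less_iff)
    show "N (int (length xs)) = int k" by (simp add: N_def)
  qed
  have "rectangle_union k T = sum_list (map (k_rectangle k) xs)"
    by (simp add: rectangle_union_def flip: xs(1) mset_map sum_mset_sum_list)
  also have "\<dots> = (\<Sum>q<length xs. k_rectangle k (xs ! q))"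
    by (simp add: sum_list_sum_nth atLeast0LessThan)
  also have "\<dots> = rectangles"
    unfolding rectangles_def by (rule sum.cong) (auto simp: N_def k_rectangle_def)
  finally have rect: "rectangle_union k T = rectangles" .
  show "{mu \<in> bounded_partitions k. weak_strip k s (bounded_to_core k mu) (bounded_to_core k P)} = {Ps}"
    unfolding P_def Ps_def rect by (rule weak_strips_over_rectangles[OF s])
  show "Ps \<in> bounded_partitions k" unfolding Ps_def rect by (rule rectangles_cut_bounded[OF s])
  have "{N (int q) | q. q < length xs \<and> int s < N (int q)} = int ` {x \<in> set_mset T. s < x}"
    unfolding xs(3)[symmetric] by (force simp: N_def in_set_conv_nth)
  then show "corner_residues k (bounded_to_core k Ps) (bounded_to_core k P) = card {x \<in> set_mset T. s < x}"
    unfolding P_def Ps_def rect corner_residues_rectangles[OF s] by (simp add: card_image)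
qed

subsection \<open>Evaluation of polynomials\<close>

definition monomial_value :: "(nat \<Rightarrow> complex) \<Rightarrow> (nat \<Rightarrow>\<^sub>0 nat) \<Rightarrow> complex" where
  "monomial_value x e = (\<Prod>i\<in>Poly_Mapping.keys e. x i ^ Poly_Mapping.lookup e i)"

definition poly_value :: "(nat \<Rightarrow> complex) \<Rightarrow> ((nat \<Rightarrow>\<^sub>0 nat) \<Rightarrow>\<^sub>0 int) \<Rightarrow> complex" where
  "poly_value x p = (\<Sum>e\<in>Poly_Mapping.keys p. of_int (Poly_Mapping.lookup p e) * monomial_value x e)"

lemma monomial_value_superset:
  "finite A \<Longrightarrow> Poly_Mapping.keys e \<subseteq> A \<Longrightarrow> monomial_value x e = (\<Prod>i\<in>A. x i ^ Poly_Mapping.lookup e i)"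
  unfolding monomial_value_def by (rule prod.mono_neutral_left) (auto simp: in_keys_iff)

lemma monomial_value_add: "monomial_value x (e + e') = monomial_value x e * monomial_value x e'"
proof -
  let ?A = "Poly_Mapping.keys e \<union> Poly_Mapping.keys e'"
  have "monomial_value x (e + e') = (\<Prod>i\<in>?A. x i ^ Poly_Mapping.lookup (e + e') i)"
    using Poly_Mapping.keys_add[of e e'] by (intro monomial_value_superset) auto
  also have "\<dots> = (\<Prod>i\<in>?A. x i ^ Poly_Mapping.lookup e i) * (\<Prod>i\<in>?A. x i ^ Poly_Mapping.lookup e' i)"
    by (simp add: lookup_add power_add prod.distrib)
  finally show ?thesis by (simp add: monomial_value_superset[of ?A])
qed

lemma poly_value_0 [simp]: "poly_value x 0 = 0"
  by (simp add: poly_value_def)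

lemma poly_value_single: "poly_value x (Poly_Mapping.single e c) = of_int c * monomial_value x e"
  by (cases "c = 0") (simp_all add: poly_value_def)

lemma poly_value_add: "poly_value x (p + q) = poly_value x p + poly_value x q"
  unfolding poly_value_def by (rule setsum_keys_plus_distrib) (auto simp: algebra_simps)

lemma poly_value_diff: "poly_value x (p - q) = poly_value x p - poly_value x q"
  using poly_value_add[of x "p - q" q] by simp

lemma poly_value_mult: "poly_value x (p * q) = poly_value x p * poly_value x q"
proof -
  \<comment> \<open>Integer-valued maps of finite support form the free abelian group on the
    monomials, so \<open>frag_induction\<close> reduces each factor to a monomial.\<close>
  have "poly_value x (Poly_Mapping.single e 1 * q) = monomial_value x e * poly_value x q" for e
  proof (rule frag_induction[of q UNIV])
    fix e' show "poly_value x (Poly_Mapping.single e 1 * frag_of e') = monomial_value x e * poly_value x (frag_of e')"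
      by (simp add: mult_single poly_value_single monomial_value_add)
  qed (auto simp: algebra_simps poly_value_diff)
  note single = this
  show ?thesis
  proof (rule frag_induction[of p UNIV])
    fix e show "poly_value x (frag_of e * q) = poly_value x (frag_of e) * poly_value x q"
      using single[of e] by (simp add: poly_value_single)
  qed (auto simp: algebra_simps poly_value_diff)
qed

subsection \<open>Values of complete homogeneous polynomials\<close>

definition exponents :: "nat \<Rightarrow> nat \<Rightarrow> (nat \<Rightarrow>\<^sub>0 nat) set" where
  "exponents n r = {e. Poly_Mapping.keys e \<subseteq> {..<n} \<and> (\<Sum>i<n. Poly_Mapping.lookup e i) = r}"

lemma hsym_eq: "hsym r n = (\<Sum>e\<in>exponents n r. Poly_Mapping.single e 1)"
  by (simp add: hsym_def exponents_def)

lemma exponents_0_Suc: "exponents 0 (Suc r) = {}"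
  by (simp add: exponents_def)

text \<open>Either the last variable does not occur, or one factor of it can be removed. This is the
  recursion of complete homogeneous polynomials at the level of exponents.\<close>

lemma exponents_Suc_Suc:
  "exponents (Suc n) (Suc r) =
    exponents n (Suc r) \<union> (\<lambda>e. e + Poly_Mapping.single n 1) ` exponents (Suc n) r" (is "?L = ?A \<union> ?B")
  and exponents_disjoint: "exponents n (Suc r) \<inter> (\<lambda>e. e + Poly_Mapping.single n 1) ` exponents (Suc n) r = {}"
proof -
  have not_in: "Poly_Mapping.lookup e n = 0" if "Poly_Mapping.keys e \<subseteq> {..<n}" for e :: "nat \<Rightarrow>\<^sub>0 nat"
    using that by (auto simp: in_keys_iff)
  show "?A \<inter> ?B = {}"
    using not_in by (force simp: exponents_def lookup_add)
  show "?L = ?A \<union> ?B"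
  proof (intro equalityI subsetI)
    fix e assume e: "e \<in> ?L"
    show "e \<in> ?A \<union> ?B"
    proof (cases "Poly_Mapping.lookup e n = 0")
      case True
      then have "Poly_Mapping.keys e \<subseteq> {..<n}"
      proof -
        have "n \<notin> Poly_Mapping.keys e" using True by (simp add: in_keys_iff)
        then show ?thesis using e by (auto simp: exponents_def lessThan_Suc)
      qed
      then show ?thesis using e True by (simp add: exponents_def)
    next
      case False
      define e' where "e' = e - Poly_Mapping.single n 1"
      have look: "Poly_Mapping.lookup e' i = Poly_Mapping.lookup e i - (if i = n then 1 else 0)" for i
        by (simp add: e'_def lookup_minus lookup_single when_def)
      have "e = e' + Poly_Mapping.single n 1"
        by (rule poly_mapping_eqI) (use False in \<open>auto simp: lookup_add look lookup_single when_def\<close>)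
      moreover have "Poly_Mapping.keys e' \<subseteq> {..<Suc n}"
      proof
        fix i assume "i \<in> Poly_Mapping.keys e'"
        then have "i \<in> Poly_Mapping.keys e" unfolding in_keys_iff look by (cases "i = n") auto
        then show "i \<in> {..<Suc n}" using e by (auto simp: exponents_def)
      qed
      moreover have "(\<Sum>i<Suc n. Poly_Mapping.lookup e' i) = r"
        using e False by (auto simp: exponents_def look)
      ultimately show ?thesis by (auto simp: exponents_def)
    qed
  next
    fix e assume "e \<in> ?A \<union> ?B"
    then show "e \<in> ?L"
    proof
      assume "e \<in> ?A"
      then show ?thesis using not_in[of e] by (auto simp: exponents_def less_Suc_eq)
    next
      assume "e \<in> ?B"
      then obtain e' where e': "e = e' + Poly_Mapping.single n 1" "e' \<in> exponents (Suc n) r" by auto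
      have "Poly_Mapping.keys e \<subseteq> {..<Suc n}"
        using e' Poly_Mapping.keys_add[of e' "Poly_Mapping.single n 1"] by (auto simp: exponents_def)
      moreover have "(\<Sum>i<n. Poly_Mapping.lookup (Poly_Mapping.single n (1::nat)) i) = 0"
        by (rule sum.neutral) (auto simp: lookup_single when_def)
      ultimately show ?thesis using e' by (simp add: exponents_def lookup_add sum.distrib)
    qed
  qed
qed

lemma finite_exponents: "finite (exponents n r)"
proof (induction n arbitrary: r)
  case 0
  have "exponents 0 r \<subseteq> {0}" by (auto simp: exponents_def)
  then show ?case by (rule finite_subset) simp
next
  case (Suc n)
  show ?case
  proof (induction r)
    case 0
    have "exponents (Suc n) 0 \<subseteq> {0}"
    proof
      fix e assume e: "e \<in> exponents (Suc n) 0"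
      then have "Poly_Mapping.lookup e i = 0" for i
        by (cases "i < Suc n") (auto simp: exponents_def in_keys_iff less_Suc_eq)
      then show "e \<in> {0}" by (simp add: poly_mapping_eq_iff fun_eq_iff)
    qed
    then show ?case by (rule finite_subset) simp
  next
    case (Suc r)
    then show ?case using Suc.IH \<open>\<And>r. finite (exponents n r)\<close> by (simp add: exponents_Suc_Suc)
  qed
qed

lemma hsym_Suc_Suc:
  "hsym (Suc r) (Suc n) = hsym (Suc r) n + Poly_Mapping.single (Poly_Mapping.single n 1) 1 * hsym r (Suc n)"
proof -
  let ?f = "\<lambda>e. e + Poly_Mapping.single n (1::nat)"
  have "hsym (Suc r) (Suc n) = (\<Sum>e\<in>exponents n (Suc r). Poly_Mapping.single e 1) + (\<Sum>e\<in>?f ` exponents (Suc n) r. Poly_Mapping.single e 1)"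
    unfolding hsym_eq exponents_Suc_Suc
    by (rule sum.union_disjoint) (auto simp: finite_exponents exponents_disjoint[simplified])
  also have "(\<Sum>e\<in>?f ` exponents (Suc n) r. Poly_Mapping.single e (1::int)) = (\<Sum>e\<in>exponents (Suc n) r. Poly_Mapping.single (?f e) 1)"
    by (subst sum.reindex) (auto simp: inj_on_def)
  also have "\<dots> = Poly_Mapping.single (Poly_Mapping.single n 1) 1 * hsym r (Suc n)"
    by (simp add: hsym_eq sum_distrib_left mult_single add.commute)
  finally show ?thesis by (simp add: hsym_eq)
qed

text \<open>The classical generating function: by \<open>hsym_Suc_Suc\<close> a further variable
  divides the series by \<open>1 - x t\<close>.\<close>

lemma hsym_value_fps:
  "Abs_fps (\<lambda>r. poly_value x (hsym r n)) * (\<Prod>i<n. 1 - fps_const (x i) * fps_X) = 1"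
proof (induction n)
  case 0
  have "Abs_fps (\<lambda>r. poly_value x (hsym r 0)) = 1"
  proof (rule fps_ext)
    fix r show "Abs_fps (\<lambda>r. poly_value x (hsym r 0)) $ r = 1 $ r"
      using poly_value_single[of x 0 1]
      by (cases r) (simp_all add: hsym_0 hsym_eq[of "Suc _"] exponents_0_Suc monomial_value_def)
  qed
  then show ?case by simp
next
  case (Suc n)
  let ?H = "\<lambda>n. Abs_fps (\<lambda>r. poly_value x (hsym r n))"
  have "?H (Suc n) = ?H n + fps_const (x n) * fps_X * ?H (Suc n)"
  proof (rule fps_ext)
    fix r
    show "?H (Suc n) $ r = (?H n + fps_const (x n) * fps_X * ?H (Suc n)) $ r"
      by (cases r)
        (simp_all add: hsym_0 hsym_Suc_Suc poly_value_add poly_value_mult poly_value_single monomial_value_def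
          mult.assoc)
  qed
  then have "?H (Suc n) * (1 - fps_const (x n) * fps_X) = ?H n" by (simp add: algebra_simps)
  then show ?case using Suc.IH by (simp add: mult.assoc[symmetric] mult.commute mult.left_commute)
qed

text \<open>The reversed polynomial is monic because the constant coefficient is 1. Reversing its
  linear factors \<open>t - x\<close> gives \<open>1 - x t\<close>.\<close>

lemma factorization_const_one:
  fixes p :: "complex poly"
  assumes "poly p 0 = 1"
  shows "\<exists>xs. length xs = degree p \<and> p = (\<Prod>x\<leftarrow>xs. [:1, - x:])"
proof -
  have c0: "coeff p 0 = 1" using assms by (simp add: poly_0_coeff_0)
  then have "p \<noteq> 0" by auto
  have refl_deg: "degree (reflect_poly p) = degree p" using c0 by simp
  have "reflect_poly p \<noteq> 0" using \<open>p \<noteq> 0\<close> by simp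
  then obtain A where A: "size A = degree (reflect_poly p)"
      "reflect_poly p = smult (lead_coeff (reflect_poly p)) (\<Prod>x\<in>#A. [:-x, 1:])"
    using alg_closed_imp_factorization by blast
  have "lead_coeff (reflect_poly p) = 1" using c0 by (simp add: coeff_reflect_poly)
  then have "reflect_poly p = (\<Prod>x\<in>#A. [:-x, 1:])" using A(2) by simp
  then have "reflect_poly (reflect_poly p) = reflect_poly (\<Prod>x\<in>#A. [:-x, 1:])" by simp
  moreover have "reflect_poly (reflect_poly p) = p" using c0 by simp
  moreover obtain xs where "A = mset xs" by (metis ex_mset)
  moreover have "reflect_poly (\<Prod>x\<leftarrow>xs. [:-x, 1:]) = (\<Prod>x\<leftarrow>xs. [:1, - x:])" for xs :: "complex list"
  proof (induction xs)
    case (Cons a xs)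
    have "reflect_poly [:- a, 1:] = [:1, - a:]" by (simp add: reflect_poly_def)
    then show ?case using Cons unfolding list.map prod_list.Cons reflect_poly_mult by (simp only:)
  qed simp
  ultimately show ?thesis using A(1) refl_deg by (intro exI[of _ xs]) (simp flip: prod_mset_prod_list)
qed

text \<open>The prescribed values form a series \<open>C\<close> with constant term 1. Its inverse,
  truncated at degree \<open>k\<close>, is a product of at most \<open>k\<close> factors
  \<open>1 - x t\<close>; at these \<open>x\<close> the series of the \<open>h\<close> and
  \<open>C\<close> are inverse to series that agree up to degree \<open>k\<close>, so they agree up
  to degree \<open>k\<close> themselves.\<close>

lemma hsym_values_arbitrary:
  fixes c :: "nat \<Rightarrow> complex"
  shows "\<exists>x. \<forall>r\<in>{1..k}. poly_value x (hsym r k) = c r"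
proof -
  define C where "C = Abs_fps (\<lambda>r. if r = 0 then 1 else c r)"
  define E where "E = inverse C"
  have CE: "C * E = 1" by (simp add: E_def C_def inverse_mult_eq_1')
  have E0: "E $ 0 = 1" by (simp add: E_def C_def)
  define p where "p = Poly (map (fps_nth E) [0..<Suc k])"
  have coeff_p: "coeff p j = (if j \<le> k then E $ j else 0)" for j
    by (auto simp: p_def nth_default_def simp del: upt_Suc)
  then have "poly p 0 = 1" by (simp add: poly_0_coeff_0 E0)
  then obtain xs where xs: "length xs = degree p" "p = (\<Prod>x\<leftarrow>xs. [:1, - x:])"
    using factorization_const_one by blast
  have len: "length xs \<le> k" unfolding xs(1) by (rule degree_le) (simp add: coeff_p)
  \<comment> \<open>Missing roots are replaced by 0, whose factor is 1.\<close>
  define x where "x i = (if i < length xs then xs ! i else 0)" for i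
  have "(\<Prod>i<k. 1 - fps_const (x i) * fps_X) = (\<Prod>i<length xs. 1 - fps_const (xs ! i) * fps_X)"
    by (rule prod.mono_neutral_cong_right) (use len in \<open>auto simp: x_def\<close>)
  also have "\<dots> = (\<Prod>i<length xs. fps_of_poly [:1, - (xs ! i):])"
    by (simp add: fps_of_poly_pCons flip: fps_const_neg)
  also have "\<dots> = fps_of_poly (\<Prod>i<length xs. [:1, - (xs ! i):])"
    by (simp add: fps_of_poly_prod)
  also have "(\<Prod>i<length xs. [:1, - (xs ! i):]) = p"
    unfolding xs(2) by (simp add: prod.list_conv_set_nth atLeast0LessThan)
  finally have prod: "(\<Prod>i<k. 1 - fps_const (x i) * fps_X) = fps_of_poly p" .
  let ?H = "Abs_fps (\<lambda>r. poly_value x (hsym r k))"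
  have H: "?H * fps_of_poly p = 1" using hsym_value_fps[of x k] by (simp add: prod)
  have "?H $ r = C $ r" if "r \<le> k" for r
    using that
  proof (induction r rule: less_induct)
    case (less r)
    have "(\<Sum>i<r. ?H $ i * coeff p (r - i)) = (\<Sum>i<r. C $ i * E $ (r - i))"
    proof (rule sum.cong)
      fix i assume "i \<in> {..<r}"
      then show "?H $ i * coeff p (r - i) = C $ i * E $ (r - i)"
        using less.IH[of i] less.prems coeff_p[of "r - i"] by simp
    qed simp
    moreover have "(?H * fps_of_poly p) $ r = (\<Sum>i<r. ?H $ i * coeff p (r - i)) + ?H $ r * coeff p 0"
      by (simp add: fps_mult_nth lessThan_Suc_atMost[symmetric] atLeast0AtMost)
    moreover have "(C * E) $ r = (\<Sum>i<r. C $ i * E $ (r - i)) + C $ r * E $ 0"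
      by (simp add: fps_mult_nth lessThan_Suc_atMost[symmetric] atLeast0AtMost)
    ultimately show ?case using H CE coeff_p[of 0] E0 by simp
  qed
  then have "poly_value x (hsym r k) = c r" if "r \<in> {1..k}" for r
    using that by (auto simp: C_def)
  then show ?thesis by blast
qed

subsection \<open>Algebraic independence of the first complete homogeneous functions\<close>

text \<open>With these rules the simplifier eta-expands ring operations on \<^typ>\<open>symfun\<close>.\<close>
declare zero_fun_apply [simp del] one_fun_apply [simp del] plus_fun_apply [simp del] times_fun_apply [simp del]

definition symval :: "nat \<Rightarrow> symfun \<Rightarrow> (nat \<Rightarrow> complex) \<Rightarrow> complex" where
  "symval k f x = poly_value x (f k)"

lemma symval_add: "symval k (f + f') x = symval k f x + symval k f' x"
  by (simp add: symval_def plus_fun_apply poly_value_add)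

lemma symval_mult: "symval k (f * f') x = symval k f x * symval k f' x"
  by (simp add: symval_def times_fun_apply poly_value_mult)

lemma symval_0: "symval k 0 x = 0"
  by (simp add: symval_def zero_fun_apply)

lemma symval_1: "symval k 1 x = 1"
  using poly_value_single[of x 0 1] by (simp add: symval_def one_fun_apply monomial_value_def)

lemma symval_uminus: "symval k (- f) x = - symval k f x"
  using symval_add[of k "- f" f x] by (simp add: symval_0 add_eq_0_iff)

lemma symval_sum: "symval k (\<Sum>i\<in>A. f i) x = (\<Sum>i\<in>A. symval k (f i) x)"
  by (induction A rule: infinite_finite_induct) (simp_all only: sum.infinite sum.empty sum.insert symval_0 symval_add not_False_eq_True)

lemma symval_of_nat: "symval k (of_nat m) x = of_nat m"
  by (induction m) (simp_all only: of_nat_0 of_nat_Suc symval_0 symval_1 symval_add)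

lemma symval_of_int: "symval k (of_int m) x = of_int m"
proof (cases m rule: int_diff_cases)
  case (diff a b)
  then have "symval k (of_int m) x = symval k (of_nat a + - of_nat b) x" by simp
  then show ?thesis using diff by (simp only: symval_add symval_uminus symval_of_nat) simp
qed

lemma symval_power: "symval k (f ^ m) x = symval k f x ^ m"
  by (induction m) (simp_all only: power_0 power_Suc symval_1 symval_mult)

definition hprod :: "partition \<Rightarrow> symfun" where
  "hprod mu = (\<Prod>r\<in>#mu. hsym r)"

lemma symval_hprod: "symval k (hprod mu) x = (\<Prod>r\<in>#mu. symval k (hsym r) x)"
  unfolding hprod_def
  by (induction mu) (simp_all only: image_mset_empty image_mset_add_mset prod_mset_empty prod_mset.add_mset symval_1 symval_mult)

lemma prod_mset_power: "(\<Prod>r\<in>#M. f r ^ m) = (\<Prod>r\<in>#M. f r) ^ m" for f :: "'a \<Rightarrow> 'b :: comm_monoid_mult"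
  by (induction M) (simp_all add: power_mult_distrib)

lemma of_nat_prod_mset: "of_nat (\<Prod>r\<in>#M. f r) = (\<Prod>r\<in>#M. of_nat (f r) :: 'b :: comm_semiring_1)"
  by (induction M) simp_all

text \<open>A Vandermonde argument: the relation extends from powers to all polynomials, and one
  that vanishes at every other \<open>b i\<close> isolates \<open>a j\<close>.\<close>

lemma power_sums_independent:
  fixes b :: "'a \<Rightarrow> complex"
  assumes "finite F" "inj_on b F" "\<And>m. (\<Sum>i\<in>F. a i * b i ^ m) = 0" "j \<in> F"
  shows "a j = 0"
proof -
  have poly: "(\<Sum>i\<in>F. a i * poly p (b i)) = 0" for p :: "complex poly"
  proof -
    have "(\<Sum>i\<in>F. a i * poly p (b i)) = (\<Sum>i\<in>F. \<Sum>m\<le>degree p. coeff p m * (a i * b i ^ m))"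
      by (simp add: poly_altdef sum_distrib_left mult.left_commute)
    also have "\<dots> = (\<Sum>m\<le>degree p. coeff p m * (\<Sum>i\<in>F. a i * b i ^ m))"
      by (subst sum.swap) (simp add: sum_distrib_left)
    finally show ?thesis by (simp add: assms(3))
  qed
  define p where "p = (\<Prod>i\<in>F - {j}. [:- b i, 1:])"
  have "poly p (b i) = 0" if "i \<in> F - {j}" for i
    unfolding p_def poly_prod using that assms(1) by (intro prod_zero) auto
  then have "(\<Sum>i\<in>F. a i * poly p (b i)) = a j * poly p (b j)"
    using assms(1,4) by (simp add: sum.remove)
  moreover have "poly p (b j) \<noteq> 0"
    using assms(1,2,4) by (auto simp: p_def poly_prod inj_on_def)
  ultimately show ?thesis using poly by simp
qed

text \<open>
  Giving \<open>h\<^sub>r\<close> the value \<open>q\<^sub>r ^ m\<close> for pairwise distinct primes \<open>q\<^sub>r\<close> separates the monomials in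
  the \<open>h\<^sub>r\<close> by unique factorization.
\<close>
lemma hprod_independent:
  assumes "finite F"
    and bounded: "\<And>mu. mu \<in> F \<Longrightarrow> \<forall>r\<in>#mu. 1 \<le> r \<and> r \<le> k"
    and zero: "\<And>x. (\<Sum>mu\<in>F. a mu * symval k (hprod mu) x) = 0"
    and mu: "mu \<in> F"
  shows "a mu = 0"
proof -
  define q where "q = enumerate {p :: nat. prime p}"
  have inf: "infinite {p :: nat. prime p}" by (rule primes_infinite)
  have prime_q: "prime (q r)" for r using enumerate_in_set[OF inf] by (auto simp: q_def)
  have inj_q: "inj q" unfolding q_def by (rule strict_mono_imp_inj_on) (auto intro!: strict_mono_enumerate inf)
  let ?b = "\<lambda>mu. \<Prod>r\<in>#mu. q r"
  have "prime_factorization (?b mu) = image_mset q mu" for mu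
    by (rule prime_factorization_prod_mset_primes) (auto simp: prime_q)
  then have inj_b: "inj ?b"
    by (intro injI) (metis inj_q multiset.inj_map inj_eq)
  have "(\<Sum>mu\<in>F. a mu * of_nat (?b mu) ^ m) = 0" for m
  proof -
    obtain x where x: "\<forall>r\<in>{1..k}. poly_value x (hsym r k) = of_nat (q r) ^ m"
      using hsym_values_arbitrary[of k "\<lambda>r. of_nat (q r) ^ m"] by blast
    have "symval k (hprod mu) x = of_nat (?b mu) ^ m" if "mu \<in> F" for mu
    proof -
      have "symval k (hprod mu) x = (\<Prod>r\<in>#mu. of_nat (q r) ^ m)"
        unfolding symval_hprod using bounded[OF that] x
        by (intro arg_cong[where f = prod_mset] image_mset_cong) (auto simp: symval_def)
      then show ?thesis by (simp add: prod_mset_power of_nat_prod_mset)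
    qed
    then have "(\<Sum>mu\<in>F. a mu * of_nat (?b mu) ^ m) = (\<Sum>mu\<in>F. a mu * symval k (hprod mu) x)"
      by (intro sum.cong) auto
    then show ?thesis using zero by simp
  qed
  moreover have "inj_on (\<lambda>mu. of_nat (?b mu) :: complex) F"
    using inj_b by (auto simp: inj_on_def)
  ultimately show ?thesis using power_sums_independent[OF assms(1), of "\<lambda>mu. of_nat (?b mu)" a mu] mu by blast
qed

interpretation int_module: module "\<lambda>(c :: int) (f :: symfun). of_int c * f"
  by standard (simp_all add: algebra_simps)

abbreviation parts_upto :: "nat \<Rightarrow> partition set" where
  "parts_upto k \<equiv> {mu. \<forall>r\<in>#mu. 1 \<le> r \<and> r \<le> k}"

lemma Lambda_k_span:
  assumes "f \<in> Lambda_k k"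
  shows "f \<in> int_module.span (hprod ` parts_upto k)"
  using assms
proof induction
  case one
  have "hprod {#} \<in> int_module.span (hprod ` parts_upto k)"
    by (intro int_module.span_base imageI) simp
  moreover have "hprod {#} = 1" by (simp only: hprod_def image_mset_empty prod_mset_empty)
  ultimately show ?case by (simp only:)
next
  case (gen r)
  have "hprod {#r#} \<in> int_module.span (hprod ` parts_upto k)"
    by (intro int_module.span_base imageI) (use gen in simp)
  moreover have "hprod {#r#} = hsym r"
    by (simp only: hprod_def image_mset_add_mset image_mset_empty prod_mset.add_mset prod_mset_empty mult_1_right)
  ultimately show ?case by (simp only:)
next
  case (diff f f')
  then show ?case by (intro int_module.span_diff) auto
next
  case (mult f f')
  let ?S = "hprod ` parts_upto k"
  have basis: "f * g \<in> int_module.span ?S" if fg: "f \<in> ?S" "g \<in> ?S" for f g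
  proof -
    obtain mu nu where "f = hprod mu" "g = hprod nu" "mu \<in> parts_upto k" "nu \<in> parts_upto k"
      using fg by auto
    then have "f * g = hprod (mu + nu)" "mu + nu \<in> parts_upto k" by (auto simp only: hprod_def image_mset_union prod_mset_Un set_mset_union)
    then show ?thesis using int_module.span_base by auto
  qed
  have right: "f * g \<in> int_module.span ?S" if "f \<in> ?S" "g \<in> int_module.span ?S" for f g
    using that(2)
  proof (induction rule: int_module.span_induct_alt)
    case base
    then show ?case by (simp add: int_module.span_zero)
  next
    case (step c g g')
    have "f * (of_int c * g + g') = of_int c * (f * g) + f * g'" by (simp add: algebra_simps)
    then show ?case
      using step basis[OF that(1)] by (auto intro!: int_module.span_add int_module.span_scale)
  qed
  show ?case
    using mult.IH(1)
  proof (induction rule: int_module.span_induct_alt)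
    case base
    then show ?case by (simp add: int_module.span_zero)
  next
    case (step c g g')
    have "(of_int c * g + g') * f' = of_int c * (g * f') + g' * f'" by (simp add: algebra_simps)
    then show ?case
      using step right[OF _ mult.IH(2)] by (auto intro!: int_module.span_add int_module.span_scale)
  qed
qed

text \<open>Restriction to \<open>k\<close> variables is injective on \<open>Lambda_k\<close>: the
  products \<open>hprod\<close> span, and already their values in \<open>k\<close> variables are
  independent.\<close>

lemma Lambda_k_eq_0:
  assumes "f \<in> Lambda_k k" "f k = 0"
  shows "f = 0"
proof -
  obtain t c where t: "finite t" "t \<subseteq> hprod ` parts_upto k" "f = (\<Sum>v\<in>t. of_int (c v) * v)"
    using Lambda_k_span[OF assms(1)] unfolding int_module.span_explicit by blast
  \<comment> \<open>Representatives on which \<open>hprod\<close> is injective turn the sum over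
    symmetric functions into a sum over partitions.\<close>
  then obtain F where F: "F \<subseteq> parts_upto k" "inj_on hprod F" "t = hprod ` F"
    by (auto simp: subset_image_inj)
  have fin: "finite F" using t(1) F by (simp add: finite_image_iff)
  have f: "f = (\<Sum>mu\<in>F. of_int (c (hprod mu)) * hprod mu)" using t(3) F by (simp add: sum.reindex)
  have "(\<Sum>mu\<in>F. of_int (c (hprod mu)) * symval k (hprod mu) x) = 0" for x
  proof -
    have "symval k f x = 0" by (simp add: symval_def assms(2))
    then show ?thesis by (simp add: f symval_sum symval_mult symval_of_int)
  qed
  then have "(of_int (c (hprod mu)) :: complex) = 0" if "mu \<in> F" for mu
    using hprod_independent[OF fin, of k "\<lambda>mu. of_int (c (hprod mu))" mu] F that by auto
  then show ?thesis by (simp add: f)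
qed

text \<open>Evaluations are complex functions, so dimensions can be compared over a field; the
  symmetric functions themselves form a module over the integers.\<close>

interpretation function_space: vector_space "\<lambda>(c :: complex) (f :: (nat \<Rightarrow> complex) \<Rightarrow> complex) x. c * f x"
  by standard (simp_all add: fun_eq_iff plus_fun_apply algebra_simps)

subsection \<open>Inverting the Pieri rule\<close>

text \<open>The coefficient of \<open>t^j\<close> in \<open>(1 - t)^(-a)\<close>.\<close>

definition multichoose :: "nat \<Rightarrow> nat \<Rightarrow> nat" where
  "multichoose a j = (if j = 0 then 1 else (a + j - 1) choose j)"

lemma multichoose_0: "multichoose 0 j = (if j = 0 then 1 else 0)"
  by (auto simp: multichoose_def binomial_eq_0)

lemma multichoose_Suc_Suc: "multichoose (Suc a) (Suc j) = multichoose (Suc a) j + multichoose a (Suc j)"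
  by (cases j) (simp_all add: multichoose_def)

text \<open>The coefficient of \<open>t^s\<close> in \<open>(1 - t)^(-a)\<close> times the series of
  \<open>h\<close>; so \<open>hsum_Suc_Suc\<close> expresses multiplication by
  \<open>1 - t\<close>.\<close>

definition hsum :: "(nat \<Rightarrow> 'a :: comm_ring_1) \<Rightarrow> nat \<Rightarrow> nat \<Rightarrow> 'a" where
  "hsum h a s = (\<Sum>u\<le>s. of_nat (multichoose a (s - u)) * h u)"

lemma hsum_0: "hsum h 0 s = h s"
proof -
  have "hsum h 0 s = (\<Sum>u\<in>{s}. of_nat (multichoose 0 (s - u)) * h u)"
    unfolding hsum_def by (rule sum.mono_neutral_right) (auto simp: multichoose_0)
  then show ?thesis by (simp add: multichoose_0)
qed

lemma hsum_Suc_Suc: "hsum h (Suc a) (Suc s) = hsum h (Suc a) s + hsum h a (Suc s)"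
proof -
  have "hsum h (Suc a) (Suc s) = (\<Sum>u\<le>s. of_nat (multichoose (Suc a) (Suc (s - u))) * h u) + h (Suc s)"
    by (simp add: hsum_def multichoose_def[of _ 0] Suc_diff_le)
  also have "\<dots> = hsum h (Suc a) s + ((\<Sum>u\<le>s. of_nat (multichoose a (Suc (s - u))) * h u) + h (Suc s))"
    by (simp add: hsum_def multichoose_Suc_Suc algebra_simps sum.distrib)
  also have "(\<Sum>u\<le>s. of_nat (multichoose a (Suc (s - u))) * h u) + h (Suc s) = hsum h a (Suc s)"
    by (simp add: hsum_def multichoose_def[of _ 0] Suc_diff_le)
  finally show ?thesis .
qed

text \<open>The first \<open>j\<close> terms of the coefficient of \<open>t^r\<close> in
  \<open>(1 - t)^a\<close> times the series of \<open>hsum h a\<close>. The complete sum,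
  \<open>j = r + 1\<close>, is \<open>h r\<close> by cancellation.\<close>

definition partial_alt :: "(nat \<Rightarrow> 'a :: comm_ring_1) \<Rightarrow> nat \<Rightarrow> nat \<Rightarrow> nat \<Rightarrow> 'a" where
  "partial_alt h a r j = (\<Sum>s<j. (- 1) ^ (r - s) * (of_nat (a choose (r - s)) * hsum h a s))"

text \<open>
  Lowering the parameter by one in the middle of the alternating sum: this is what makes the
  inversion work although the parameter varies with the summation index.
\<close>
lemma partial_alt_lower:
  assumes "j \<le> r"
  shows "partial_alt h (Suc a) r j + (- 1) ^ (r - j) * (of_nat (a choose (r - j)) * hsum h (Suc a) j) =
    partial_alt h a r (Suc j)"
  using assms
proof (induction j)
  case 0
  then show ?case by (simp add: partial_alt_def hsum_def multichoose_def)
next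
  case (Suc j)
  define m where "m = r - Suc j"
  have m: "r - j = Suc m" using Suc.prems by (simp add: m_def)
  have 1: "partial_alt h (Suc a) r (Suc j) = partial_alt h (Suc a) r j
      + (- 1) ^ Suc m * (of_nat (Suc a choose Suc m) * hsum h (Suc a) j)"
    by (simp only: partial_alt_def sum.lessThan_Suc m)
  have 2: "partial_alt h a r (Suc (Suc j)) = partial_alt h a r (Suc j)
      + (- 1) ^ m * (of_nat (a choose m) * hsum h a (Suc j))"
    by (simp only: partial_alt_def sum.lessThan_Suc[of _ "Suc j"] m_def)
  have 3: "partial_alt h a r (Suc j) = partial_alt h (Suc a) r j
      + (- 1) ^ Suc m * (of_nat (a choose Suc m) * hsum h (Suc a) j)"
    using Suc.IH Suc.prems by (simp add: m)
  show ?case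
    unfolding 1 2 3 m_def[symmetric] by (simp add: hsum_Suc_Suc algebra_simps)
qed

lemma partial_alt_full: "partial_alt h a r (Suc r) = h r"
proof (induction a)
  case 0
  have "partial_alt h 0 r (Suc r) = (\<Sum>s\<in>{r}. (- 1) ^ (r - s) * (of_nat (0 choose (r - s)) * hsum h 0 s))"
    unfolding partial_alt_def by (rule sum.mono_neutral_right) (auto simp: less_Suc_eq binomial_eq_0)
  then show ?case by (simp add: hsum_0)
next
  case (Suc a)
  have "partial_alt h (Suc a) r (Suc r) = partial_alt h (Suc a) r r + hsum h (Suc a) r"
    by (simp add: partial_alt_def)
  also have "\<dots> = partial_alt h a r (Suc r)" using partial_alt_lower[of r r h a] by simp
  finally show ?case using Suc by simp
qed

text \<open>The binomial uses \<open>a (Suc s)\<close> but \<open>hsum\<close> uses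
  \<open>a s\<close>. Where the two agree the term extends a partial sum with constant parameter;
  where they differ by one the term is precisely the one with which \<open>partial_alt_lower\<close>
  passes to the smaller parameter.\<close>

lemma alternating_hsum:
  assumes "\<And>s. a (Suc s) = a s \<or> a s = Suc (a (Suc s))"
  shows "(\<Sum>s\<le>r. (- 1) ^ (r - s) * (of_nat (a (Suc s) choose (r - s)) * hsum h (a s) s)) = h r"
proof -
  have "(\<Sum>s<j. (- 1) ^ (r - s) * (of_nat (a (Suc s) choose (r - s)) * hsum h (a s) s)) = partial_alt h (a j) r j"
    if "j \<le> Suc r" for j
    using that
  proof (induction j)
    case (Suc j)
    then show ?case
      using assms[of j] partial_alt_lower[of j r h "a (Suc j)"] by (auto simp: partial_alt_def)
  qed (simp add: partial_alt_def)
  from this[of "Suc r"] show ?thesis by (simp add: partial_alt_full lessThan_Suc_atMost)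
qed

text \<open>The Pieri rule is a unitriangular system for \<open>G\<close>, since the term
  \<open>s = r\<close> has coefficient 1. By \<open>alternating_hsum\<close> the claimed values
  solve it.\<close>

lemma pieri_inversion:
  assumes "\<And>s. a (Suc s) = a s \<or> a s = Suc (a (Suc s))"
    and pieri: "\<And>r. r \<le> k \<Longrightarrow> h r * p = (\<Sum>s\<le>r. (- 1) ^ (r - s) * (of_nat (a (Suc s) choose (r - s)) * G s))"
    and "r \<le> k"
  shows "G r = p * hsum h (a r) r"
  using assms(3)
proof (induction r rule: less_induct)
  case (less r)
  let ?t = "\<lambda>X s. (- 1) ^ (r - s) * (of_nat (a (Suc s) choose (r - s)) * X s)"
  have split: "(\<Sum>s\<le>r. ?t X s) = (\<Sum>s<r. ?t X s) + X r" for X :: "nat \<Rightarrow> 'a"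
    by (simp add: lessThan_Suc_atMost[symmetric])
  have "p * h r = (\<Sum>s\<le>r. ?t (\<lambda>s. p * hsum h (a s) s) s)"
    unfolding alternating_hsum[of a, OF assms(1), of r h, symmetric] by (simp add: sum_distrib_left mult.left_commute)
  also have "\<dots> = (\<Sum>s<r. ?t G s) + p * hsum h (a r) r"
    unfolding split using less by simp
  finally have "h r * p = (\<Sum>s<r. ?t G s) + p * hsum h (a r) r" by (simp add: mult.commute)
  then show ?case using pieri[OF less.prems] unfolding split by simp
qed

lemma int_choose_of_nat: "int_choose (int n) j = int (n choose j)"
proof -
  have "(of_int (\<Prod>i = 0..<j. int n - int i) :: real) = of_int (int (n choose j) * fact j)"
    using gbinomial_mult_fact'[of "real n" j] by (simp add: binomial_gbinomial)
  then have "(\<Prod>i = 0..<j. int n - int i) = int (n choose j) * fact j" by (simp only: of_int_eq_iff)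
  then show ?thesis by (simp add: int_choose_def)
qed

text \<open>The case \<open>j = 0\<close> is separate because for \<open>a = 0\<close> the upper
  index is then \<open>-1\<close>, which is no natural number.\<close>

lemma int_choose_multichoose: "int_choose (int a + int j - 1) j = int (multichoose a j)"
proof (cases j)
  case 0
  then show ?thesis by (simp add: int_choose_def multichoose_def)
next
  case (Suc i)
  have "int a + int j - 1 = int (a + j - 1)" by (simp add: Suc)
  then show ?thesis using Suc by (simp only: int_choose_of_nat) (simp add: multichoose_def)
qed

subsection \<open>Nonvanishing of K-k-Schur functions\<close>

text \<open>A filtration by size rather than a grading, because the Pieri rule is not homogeneous:
  multiplying by \<open>h\<close> of degree \<open>r\<close> adds strips of every size up to
  \<open>r\<close>.\<close>

definition schur_span :: "nat \<Rightarrow> (partition \<Rightarrow> symfun) \<Rightarrow> nat \<Rightarrow> ((nat \<Rightarrow> complex) \<Rightarrow> complex) set" where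
  "schur_span k g d = function_space.span ((\<lambda>mu. symval k (g mu)) ` {mu \<in> bounded_partitions k. sum_mset mu \<le> d})"

lemma span_pointwise_sum:
  assumes "\<And>i. i \<in> A \<Longrightarrow> F i \<in> function_space.span B"
  shows "(\<lambda>x. \<Sum>i\<in>A. F i x) \<in> function_space.span B"
  using assms
proof (induction A rule: infinite_finite_induct)
  case (insert i A)
  have "F i + (\<lambda>x. \<Sum>i\<in>A. F i x) \<in> function_space.span B"
    by (rule function_space.span_add) (use insert in auto)
  then show ?case using insert.hyps by (simp add: plus_fun_def)
qed (simp_all add: function_space.span_zero flip: zero_fun_def)

lemma schur_span_mult_hsym:
  assumes g: "K_k_Schur k g" and "r \<le> k" and f: "f \<in> schur_span k g d"
  shows "(\<lambda>x. symval k (hsym r) x * f x) \<in> schur_span k g (d + r)"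
  using f unfolding schur_span_def[of k g d]
proof (induction rule: function_space.span_induct_alt)
  case base
  show ?case by (simp add: schur_span_def function_space.span_zero zero_fun_apply flip: zero_fun_def)
next
  case (step c v y)
  then obtain mu where mu: "mu \<in> bounded_partitions k" "sum_mset mu \<le> d" "v = symval k (g mu)" by auto
  let ?A = "\<lambda>s. {nu \<in> bounded_partitions k. weak_strip k s (bounded_to_core k nu) (bounded_to_core k mu)}"
  let ?c = "\<lambda>s nu. of_nat (corner_residues k (bounded_to_core k nu) (bounded_to_core k mu) choose (r - s)) :: complex"
  have size: "sum_mset nu = sum_mset mu + s" if "nu \<in> ?A s" for nu s
    using that mu(1) core_size_bounded_to_core[of nu k] core_size_bounded_to_core[of mu k]
    by (simp add: weak_strip_def)
  have inner: "(\<lambda>x. \<Sum>nu\<in>?A s. ?c s nu * symval k (g nu) x) \<in> schur_span k g (d + r)" if "s \<le> r" for s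
    unfolding schur_span_def
    by (intro span_pointwise_sum function_space.span_scale function_space.span_base imageI)
      (use size[of _ s] that mu(2) in auto)
  have "(\<lambda>x. \<Sum>s = 0..r. (- 1) ^ (r - s) * (\<Sum>nu\<in>?A s. ?c s nu * symval k (g nu) x)) \<in> schur_span k g (d + r)"
    unfolding schur_span_def
  proof (rule span_pointwise_sum, rule function_space.span_scale)
    fix s assume "s \<in> {0..r}"
    then show "(\<lambda>x. \<Sum>nu\<in>?A s. ?c s nu * symval k (g nu) x) \<in>
        function_space.span ((\<lambda>mu. symval k (g mu)) ` {mu \<in> bounded_partitions k. sum_mset mu \<le> d + r})"
      using inner unfolding schur_span_def by simp
  qed
  also have "(\<lambda>x. \<Sum>s = 0..r. (- 1) ^ (r - s) * (\<Sum>nu\<in>?A s. ?c s nu * symval k (g nu) x)) =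
      (\<lambda>x. symval k (hsym r) x * v x)"
  proof
    fix x
    have "hsym r * g mu = (\<Sum>s = 0..r. (- 1) ^ (r - s) * (\<Sum>nu\<in>?A s.
        of_nat (corner_residues k (bounded_to_core k nu) (bounded_to_core k mu) choose (r - s)) * g nu))"
      using g mu(1) \<open>r \<le> k\<close> unfolding K_k_Schur_def by blast
    from arg_cong[OF this, of "\<lambda>f. symval k f x"]
    show "(\<Sum>s = 0..r. (- 1) ^ (r - s) * (\<Sum>nu\<in>?A s. ?c s nu * symval k (g nu) x)) = symval k (hsym r) x * v x"
      by (simp add: mu(3) symval_mult symval_sum symval_power symval_uminus symval_1 symval_of_nat)
  qed
  finally have "(\<lambda>x. c * (symval k (hsym r) x * v x)) + (\<lambda>x. symval k (hsym r) x * y x) \<in> schur_span k g (d + r)"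
    using step.IH unfolding schur_span_def
    by (intro function_space.span_add function_space.span_scale)
  then show ?case by (simp add: plus_fun_def algebra_simps)
qed

lemma hprod_in_schur_span:
  assumes "K_k_Schur k g" "mu \<in> bounded_partitions k"
  shows "symval k (hprod mu) \<in> schur_span k g (sum_mset mu)"
  using assms(2)
proof (induction mu)
  case empty
  have "g {#} = 1" using assms(1) by (simp add: K_k_Schur_def)
  moreover have "symval k (g {#}) \<in> schur_span k g (sum_mset {#})"
    unfolding schur_span_def by (intro function_space.span_base imageI) (simp add: in_bounded_partitions_iff)
  moreover have "hprod {#} = 1" by (simp add: hprod_def)
  ultimately show ?case by simp
next
  case (add r M)
  have "symval k (hprod (add_mset r M)) = (\<lambda>x. symval k (hsym r) x * symval k (hprod M) x)"
    by (rule ext) (simp add: symval_hprod)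
  moreover have "(\<lambda>x. symval k (hsym r) x * symval k (hprod M) x) \<in> schur_span k g (sum_mset M + r)"
    using add by (intro schur_span_mult_hsym[OF assms(1)]) (auto simp: in_bounded_partitions_iff)
  ultimately show ?case by (simp add: add.commute)
qed

lemma finite_bounded_partitions: "finite {mu \<in> bounded_partitions k. sum_mset mu \<le> d}"
proof (rule finite_subset)
  have "size mu \<le> sum_mset mu" if "mu \<in> bounded_partitions k" for mu
  proof -
    have "\<forall>y\<in>#mu. 1 \<le> y" using that by (auto simp: in_bounded_partitions_iff)
    then show ?thesis by (induction mu) auto
  qed
  then show "{mu \<in> bounded_partitions k. sum_mset mu \<le> d} \<subseteq> mset ` {xs. set xs \<subseteq> {..k} \<and> length xs \<le> d}"
  proof (intro subsetI)
    fix mu assume size: "\<And>mu. mu \<in> bounded_partitions k \<Longrightarrow> size mu \<le> sum_mset mu"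
      and mu: "mu \<in> {mu \<in> bounded_partitions k. sum_mset mu \<le> d}"
    obtain xs where xs: "mu = mset xs" by (metis ex_mset)
    have "length xs \<le> d" using size[of mu] mu xs by simp
    then show "mu \<in> mset ` {xs. set xs \<subseteq> {..k} \<and> length xs \<le> d}"
      using mu xs by (auto simp: in_bounded_partitions_iff)
  qed
  show "finite (mset ` {xs. set xs \<subseteq> {..k} \<and> length xs \<le> d})"
    by (intro finite_imageI finite_lists_length_le) simp
qed

text \<open>
  The independent products \<open>h\<^sub>\<mu>\<close> with \<open>\<bar>\<mu>\<bar> \<le> d\<close> lie in the span of equally many
  \<open>g\<^sub>\<mu>\<close>, so none of the latter vanishes.
\<close>
lemma K_k_Schur_nonzero:
  assumes g: "K_k_Schur k g" and mu: "mu \<in> bounded_partitions k"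
  shows "g mu k \<noteq> 0"
proof
  assume zero: "g mu k = 0"
  define d where "d = sum_mset mu"
  define M where "M = {nu \<in> bounded_partitions k. sum_mset nu \<le> d}"
  let ?G = "\<lambda>mu. symval k (g mu)" and ?H = "\<lambda>mu. symval k (hprod mu)"
  have fin: "finite M" unfolding M_def by (rule finite_bounded_partitions)
  have bounded: "\<forall>r\<in>#nu. 1 \<le> r \<and> r \<le> k" if "nu \<in> M" for nu
    using that by (auto simp: M_def in_bounded_partitions_iff)
  have indep: "a nu = 0" if "F \<subseteq> M" "\<forall>x. (\<Sum>mu\<in>F. a mu * ?H mu x) = 0" "nu \<in> F" for a nu F
    using that bounded finite_subset[OF that(1) fin] by (intro hprod_independent[of F k a nu]) auto
  \<comment> \<open>Needed for counting: the functions of the \<open>h\<close>-products must be as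
    many as the partitions.\<close>
  have inj: "inj_on ?H M"
  proof (rule inj_onI, rule ccontr)
    fix la nu assume *: "la \<in> M" "nu \<in> M" "?H la = ?H nu" "la \<noteq> nu"
    then have "(\<Sum>mu\<in>{la, nu}. (if mu = la then 1 else - 1) * ?H mu x) = 0" for x by simp
    then have "\<forall>x. (\<Sum>mu\<in>{la, nu}. (if mu = la then 1 else - 1) * ?H mu x) = 0" by (rule allI)
    from indep[OF _ this, of la] show False using * by simp
  qed
  have "function_space.independent (?H ` M)"
    unfolding function_space.independent_explicit_finite_subsets
  proof (intro allI impI)
    fix S u assume S: "S \<subseteq> ?H ` M" "finite S" "(\<Sum>v\<in>S. (\<lambda>x. u v * v x)) = 0"
    obtain F where F: "F \<subseteq> M" "inj_on ?H F" "S = ?H ` F" using S(1) by (auto simp: subset_image_inj)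
    have zero: "\<forall>x. (\<Sum>nu\<in>F. u (?H nu) * ?H nu x) = 0"
    proof
      fix x
      have "(\<Sum>v\<in>S. u v * v x) = (\<Sum>v\<in>S. (\<lambda>x. u v * v x)) x"
        by (induction S rule: infinite_finite_induct) (simp_all add: zero_fun_apply plus_fun_apply)
      then show "(\<Sum>nu\<in>F. u (?H nu) * ?H nu x) = 0" using S(3) F by (simp add: sum.reindex zero_fun_apply)
    qed
    have "u (?H nu) = 0" if "nu \<in> F" for nu
      using indep[OF F(1) zero that] .
    then show "\<forall>v\<in>S. u v = 0" using F(3) by blast
  qed
  moreover have "?H ` M \<subseteq> function_space.span (?G ` M - {0})"
  proof (rule image_subsetI)
    fix nu assume nu: "nu \<in> M"
    then have "?H nu \<in> schur_span k g (sum_mset nu)"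
      using hprod_in_schur_span[OF g] by (simp add: M_def)
    moreover have "schur_span k g (sum_mset nu) \<subseteq> function_space.span (?G ` M)"
      unfolding schur_span_def using nu by (intro function_space.span_mono) (auto simp: M_def)
    ultimately show "?H nu \<in> function_space.span (?G ` M - {0})"
      unfolding function_space.span_delete_0 by blast
  qed
  ultimately have "card (?H ` M) \<le> card (?G ` M - {0})"
    using function_space.independent_span_bound[of "?G ` M - {0}" "?H ` M"] fin by simp
  moreover have "?G mu = 0" by (rule ext) (simp add: symval_def zero zero_fun_apply)
  then have "0 \<in> ?G ` M" using mu by (force simp: M_def d_def)
  then have "card (?G ` M - {0}) < card (?G ` M)" using fin by (intro psubset_card_mono) auto
  moreover have "card (?G ` M) \<le> card M" by (rule card_image_le[OF fin])
  ultimately show False using card_image[OF inj] by simp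
qed

subsection \<open>The quotient formula\<close>

lemma hsym_Lambda: "r \<le> k \<Longrightarrow> hsym r \<in> Lambda_k k"
  by (cases "r = 0") (auto simp: hsym_0 intro: Lambda_k.intros)

lemma Lambda_k_zero: "0 \<in> Lambda_k k"
  using Lambda_k.diff[OF Lambda_k.one Lambda_k.one, of k] by simp

lemma Lambda_k_add: "f \<in> Lambda_k k \<Longrightarrow> f' \<in> Lambda_k k \<Longrightarrow> f + f' \<in> Lambda_k k"
  using Lambda_k.diff[OF _ Lambda_k.diff[OF Lambda_k_zero], of f k f'] by simp

lemma Lambda_k_sum: "(\<And>i. i \<in> A \<Longrightarrow> f i \<in> Lambda_k k) \<Longrightarrow> (\<Sum>i\<in>A. f i) \<in> Lambda_k k"
  by (induction A rule: infinite_finite_induct) (auto intro: Lambda_k_zero Lambda_k_add)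

lemma Lambda_k_of_nat: "of_nat m \<in> Lambda_k k"
  by (induction m) (simp_all only: of_nat_0 of_nat_Suc Lambda_k_zero Lambda_k_add Lambda_k.one)

text \<open>Cancellation takes place in component \<open>k\<close>, where polynomials have no zero
  divisors; \<open>Lambda_k_eq_0\<close> lifts the result back to \<open>Lambda_k\<close>.\<close>

lemma is_quotientI:
  assumes "q \<in> Lambda_k k" "f = d * q" "d k \<noteq> 0"
  shows "is_quotient k f d q"
  unfolding is_quotient_def
proof (intro conjI assms(1,2) ballI impI)
  fix q' assume q': "q' \<in> Lambda_k k" "f = d * q'"
  then have "d * (q' - q) = 0" using assms(2) by (simp add: algebra_simps)
  then have "d k * (q' - q) k = 0" by (metis times_fun_apply zero_fun_apply)
  then have "(q' - q) k = 0" using assms(3) by simp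
  then have "q' - q = 0" by (intro Lambda_k_eq_0[OF Lambda_k.diff[OF q'(1) assms(1)]])
  then show "q' = q" by simp
qed

lemma rectangle_union_quotient:
  fixes al :: nat
  assumes k: "1 \<le> k" and g: "K_k_Schur k g" and T: "\<forall>x \<in># T. 1 \<le> x \<and> x \<le> k"
    and r: "1 \<le> r" "r \<le> k"
  defines "al \<equiv> card {x \<in> set_mset T. r \<le> x}"
  shows "is_quotient k (g (rectangle_union k T + {#r#})) (g (rectangle_union k T))
    (\<Sum>s = 0..r. of_int (int_choose (int al + int r - int s - 1) (r - s)) * hsym s)"
proof -
  let ?P = "rectangle_union k T"
  define G where "G s = g (?P + filter_mset (\<lambda>x. 0 < x) {#s#})" for s
  \<comment> \<open>For \<open>s \<ge> 1\<close> this is the number of distinct widths at least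
    \<open>s\<close>, and \<open>a (Suc s)\<close> is the upper index in the Pieri rule. Truncated
    subtraction makes \<open>a 0 = a 1\<close>, so the step condition holds from the start.\<close>
  define a where "a s = card {x \<in> set_mset T. s - 1 < x}" for s :: nat
  note strips = rectangle_union_strips[OF k T]
  have P: "?P \<in> bounded_partitions k" using strips(3)[of 0] by simp
  \<comment> \<open>Widths are counted without multiplicity, so passing \<open>s\<close> loses at
    most the one value \<open>s\<close>.\<close>
  have a_step: "a (Suc s) = a s \<or> a s = Suc (a (Suc s))" for s
  proof (cases "0 < s \<and> s \<in># T")
    case True
    then have "{x \<in> set_mset T. s - 1 < x} = insert s {x \<in> set_mset T. s < x}" by auto
    then show ?thesis by (simp add: a_def)
  next
    case False
    have "{x \<in> set_mset T. s - 1 < x} = {x \<in> set_mset T. s < x}"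
    proof (rule Collect_cong)
      fix x show "x \<in># T \<and> s - 1 < x \<longleftrightarrow> x \<in># T \<and> s < x"
        using T False by (cases "x = s") auto
    qed
    then show ?thesis by (simp add: a_def)
  qed
  have "hsym r * g ?P = (\<Sum>s\<le>r. (- 1) ^ (r - s) * (of_nat (a (Suc s) choose (r - s)) * G s))" if "r \<le> k" for r
  proof -
    have "hsym r * g ?P = (\<Sum>s = 0..r. (- 1) ^ (r - s) *
        (\<Sum>mu | mu \<in> bounded_partitions k \<and> weak_strip k s (bounded_to_core k mu) (bounded_to_core k ?P).
          of_nat (corner_residues k (bounded_to_core k mu) (bounded_to_core k ?P) choose (r - s)) * g mu))"
      using g P that unfolding K_k_Schur_def by blast
    also have "\<dots> = (\<Sum>s\<le>r. (- 1) ^ (r - s) * (of_nat (a (Suc s) choose (r - s)) * G s))"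
    proof (rule sum.cong)
      fix s assume "s \<in> {..r}"
      then have s: "s \<le> k" using that by simp
      show "(- 1) ^ (r - s) *
        (\<Sum>mu | mu \<in> bounded_partitions k \<and> weak_strip k s (bounded_to_core k mu) (bounded_to_core k ?P).
          of_nat (corner_residues k (bounded_to_core k mu) (bounded_to_core k ?P) choose (r - s)) * g mu) =
        (- 1) ^ (r - s) * (of_nat (a (Suc s) choose (r - s)) * G s)"
        by (simp only: strips(1)[OF s] strips(2)[OF s] a_def G_def sum.insert sum.empty finite.emptyI
            empty_iff not_False_eq_True add_0_right diff_Suc_1)
    qed (simp add: atLeast0AtMost)
    finally show ?thesis .
  qed
  then have "G r = g ?P * hsum hsym (a r) r"
    using pieri_inversion[of a k hsym "g ?P" G r, OF a_step] r(2) by blast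
  moreover have "hsum hsym (a r) r = (\<Sum>s = 0..r. of_int (int_choose (int al + int r - int s - 1) (r - s)) * hsym s)"
    unfolding hsum_def
  proof (rule sum.cong)
    fix s assume "s \<in> {0..r}"
    then have "int al + int r - int s - 1 = int al + int (r - s) - 1" by simp
    moreover have "a r = al" unfolding a_def al_def using r(1) by (intro arg_cong[where f = card]) auto
    ultimately show "of_nat (multichoose (a r) (r - s)) * hsym s =
        of_int (int_choose (int al + int r - int s - 1) (r - s)) * hsym s"
      by (simp only: int_choose_multichoose of_int_of_nat_eq)
  qed (simp add: atLeast0AtMost)
  moreover have "hsum hsym (a r) r \<in> Lambda_k k"
    unfolding hsum_def using r(2) by (intro Lambda_k_sum Lambda_k.mult Lambda_k_of_nat hsym_Lambda) auto
  moreover have "G r = g (?P + {#r#})" using r(1) by (simp add: G_def)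
  moreover have "g ?P k \<noteq> 0" by (rule K_k_Schur_nonzero[OF g P])
  ultimately show ?thesis
    using is_quotientI[of "hsum hsym (a r) r" k "G r" "g ?P"] by simp
qed

lemma quotient_sum_0:
  "(\<Sum>s = 0..r. of_int (int_choose (int 0 + int r - int s - 1) (r - s)) * hsym s) = hsym r"
proof -
  have "(\<Sum>s = 0..r. of_int (int_choose (int 0 + int r - int s - 1) (r - s)) * hsym s) = hsum hsym 0 r"
    unfolding hsum_def
  proof (rule sum.cong)
    fix s assume "s \<in> {..r}"
    then have "int 0 + int r - int s - 1 = int 0 + int (r - s) - 1" by simp
    then show "of_int (int_choose (int 0 + int r - int s - 1) (r - s)) * hsym s =
        of_nat (multichoose 0 (r - s)) * hsym s"
      by (simp only: int_choose_multichoose of_int_of_nat_eq)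
  qed (simp add: atLeast0AtMost)
  then show ?thesis by (simp add: hsum_0)
qed

lemma quotient_sum_1:
  "(\<Sum>s = 0..r. of_int (int_choose (int 1 + int r - int s - 1) (r - s)) * hsym s) = (\<Sum>s = 0..r. hsym s)"
proof (rule sum.cong)
  fix s assume "s \<in> {0..r}"
  then have "int 1 + int r - int s - 1 = int 1 + int (r - s) - 1" by simp
  then show "of_int (int_choose (int 1 + int r - int s - 1) (r - s)) * hsym s = hsym s"
    by (simp only: int_choose_multichoose of_int_of_nat_eq) (simp add: multichoose_def)
qed simp

theorem theorem4p4:
  fixes k m r :: nat
    and t a :: "nat \<Rightarrow> nat"
    and P :: partition
    and \<alpha> :: "nat \<Rightarrow> nat"
    and g :: "partition \<Rightarrow> symfun"
  assumes k: "k \<ge> 1" and m: "m \<ge> 1"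
    and g: "K_k_Schur k g"
    and t_range: "\<forall>v \<in> {1..m}. 1 \<le> t v \<and> t v \<le> k"
    and t_distinct: "inj_on t {1..m}"
    and a_pos: "\<forall>v \<in> {1..m}. a v > 0"
    and P: "P = (\<Sum>v = 1..m. repeat_mset (a v) (k_rectangle k (t v)))"
    and \<alpha>: "\<forall>u > 0. \<alpha> u = card {v \<in> {1..m}. t v \<ge> u}"
    and r: "1 \<le> r" "r \<le> k"
  shows
    "is_quotient k (g (P + {#r#})) (g P)
       (\<Sum>s = 0..r. of_int (int_choose (int (\<alpha> r) + int r - int s - 1) (r - s)) * hsym s)
     \<and> (Max (t ` {1..m}) < r \<longrightarrow>
          \<alpha> r = 0 \<and> is_quotient k (g (P + {#r#})) (g P) (hsym r) \<and> hsym r = g {#r#})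
     \<and> (\<forall>u. 1 \<le> u \<and> u \<le> k \<longrightarrow>
          is_quotient k (g (k_rectangle k u + {#r#})) (g (k_rectangle k u))
            (if r > u then hsym r else (\<Sum>s = 0..r. hsym s)))"
proof (intro conjI impI allI)
  define T where "T = (\<Sum>v = 1..m. replicate_mset (a v) (t v))"
  have set_T: "set_mset T = t ` {1..m}"
    using a_pos unfolding T_def by (auto simp: set_mset_sum in_replicate_mset)
  have "rectangle_union k T = P"
  proof -
    have rep: "(\<Sum>x\<in>#replicate_mset n y. k_rectangle k x) = repeat_mset n (k_rectangle k y)" for n y
      by (induction n) auto
    have rep': "(\<Sum>x\<in>#replicate_mset n X. x) = repeat_mset n X" for n and X :: partition
      by (induction n) auto
    have "rectangle_union k (\<Sum>v\<in>A. replicate_mset (a v) (t v)) = (\<Sum>v\<in>A. repeat_mset (a v) (k_rectangle k (t v)))" for A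
      by (induction A rule: infinite_finite_induct) (simp_all add: rectangle_union_def rep rep'[simplified])
    then show ?thesis by (simp add: T_def P)
  qed
  \<comment> \<open>Distinct widths are counted on the left and indices on the right; injectivity of
    \<open>t\<close> identifies the two.\<close>
  moreover have "card {x \<in> set_mset T. r \<le> x} = \<alpha> r"
  proof -
    have "{x \<in> set_mset T. r \<le> x} = t ` {v \<in> {1..m}. r \<le> t v}" by (auto simp: set_T)
    moreover have "inj_on t {v \<in> {1..m}. r \<le> t v}" by (rule inj_on_subset[OF t_distinct]) auto
    ultimately show ?thesis using \<alpha> r(1) by (simp add: card_image)
  qed
  ultimately show main: "is_quotient k (g (P + {#r#})) (g P)
      (\<Sum>s = 0..r. of_int (int_choose (int (\<alpha> r) + int r - int s - 1) (r - s)) * hsym s)"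
    using rectangle_union_quotient[OF k g _ r, of T] t_range set_T by auto
  assume max: "Max (t ` {1..m}) < r"
  have "{v \<in> {1..m}. r \<le> t v} = {}"
  proof (rule equals0I)
    fix v assume v: "v \<in> {v \<in> {1..m}. r \<le> t v}"
    then have "t v \<le> Max (t ` {1..m})" by (intro Max_ge) auto
    moreover have "r \<le> t v" using v by simp
    ultimately show False using max by linarith
  qed
  moreover have "\<alpha> r = card {v \<in> {1..m}. r \<le> t v}" using \<alpha> r(1) by simp
  ultimately show al0: "\<alpha> r = 0" by (simp only: card.empty)
  show "is_quotient k (g (P + {#r#})) (g P) (hsym r)"
    using main unfolding al0 quotient_sum_0 .
next
  \<comment> \<open>The empty union of rectangles is an instance too: its count of widths is 0 and
    its function is 1.\<close>
  have "is_quotient k (g {#r#}) (g {#}) (hsym r)"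
    using rectangle_union_quotient[OF k g _ r, of "{#}"] unfolding rectangle_union_def
    by (simp add: quotient_sum_0[simplified])
  then have "g {#r#} = g {#} * hsym r" unfolding is_quotient_def by blast
  moreover have "g {#} = 1" using g unfolding K_k_Schur_def by blast
  ultimately show "hsym r = g {#r#}" by (simp only: mult_1_left)
next
  fix u assume u: "1 \<le> u \<and> u \<le> k"
  have "rectangle_union k {#u#} = k_rectangle k u" by (simp add: rectangle_union_def)
  then have *: "is_quotient k (g (k_rectangle k u + {#r#})) (g (k_rectangle k u))
      (\<Sum>s = 0..r. of_int (int_choose (int (card {x \<in> set_mset {#u#}. r \<le> x}) + int r - int s - 1) (r - s)) * hsym s)"
    using rectangle_union_quotient[OF k g _ r, of "{#u#}"] u by simp
  show "is_quotient k (g (k_rectangle k u + {#r#})) (g (k_rectangle k u))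
      (if r > u then hsym r else (\<Sum>s = 0..r. hsym s))"
  proof (cases "u < r")
    case True
    then have "card {x \<in> set_mset {#u#}. r \<le> x} = 0" by auto
    then show ?thesis using * True by (simp only: quotient_sum_0 if_True)
  next
    case False
    then have "{x \<in> set_mset {#u#}. r \<le> x} = {u}" by auto
    then have "card {x \<in> set_mset {#u#}. r \<le> x} = 1" by simp
    then show ?thesis using * False by (simp only: quotient_sum_1 if_False)
  qed
qed

end
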